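(* Let $\theta=(\theta_1,\theta_2,\theta_3,\theta_\infty)\in\mathbb{C}^4$, $\iota_k=e^{\pi i\theta_k}$, and let $\mathcal{R}(\iota)$, $w_2(\theta)$, $w_2(\iota)$, the coordinatized monodromy quadruples $(M_1,M_2,M_3,M_\infty)(Z;\iota)$, the mutations $\mu_O,\mu_B,\mu_G$, the colored triangulations and the fat graphs be as in the context. For any labelling $\{\alpha,\beta,\gamma\}=\{O,B,G\}$ set (rightmost mutation performed first) $$\mu_{w_2}:=\mu_\beta\,\mu_\gamma\,\mu_\beta\,\mu_\gamma\,\mu_\beta\,\mu_\alpha\,\mu_\gamma\,\mu_\beta\,\mu_\alpha .$$ Then Okamoto's transformation $w_2$ lifts to the representation space as the entry-wise action of $\mu_{w_2}$, which gives a (rational) map $$\mu_{w_2}:\ \mathcal{R}(\iota)\longrightarrow\mathcal{R}(w_2(\iota)).$$ Explicitly, on the chart $(Z_O,Z_B,Z_G)$ with the initial quiver, the mutation sequence $\mu_{w_2}$ (for every choice of labelling) is the substitution $$Z_O\mapsto\tilde Z_O=\frac{1+Z_O+Z_OZ_B}{Z_B(1+Z_G+Z_OZ_G)},\quad Z_B\mapsto\tilde Z_B=\frac{1+Z_B+Z_BZ_G}{Z_G(1+Z_O+Z_OZ_B)},\quad Z_G\mapsto\tilde Z_G=\frac{1+Z_G+Z_OZ_G}{Z_O(1+Z_B+Z_BZ_G)},$$ and, whenever $Z_OZ_BZ_G=\iota_1\iota_2\iota_3\iota_\infty$ and the expressions are defined and nonzero, the quadruple $(\tilde M_1,\tilde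 M_2,\tilde M_3,\tilde M_\infty):=(M_1,M_2,M_3,M_\infty)(\tilde Z;w_2(\iota))$, obtained from $(M_1,M_2,M_3,M_\infty)(Z;\iota)\in\mathcal{R}(\iota)$ by substituting $Z\mapsto\tilde Z$ and $\iota\mapsto w_2(\iota)$ in every matrix entry, belongs to $\mathcal{R}(w_2(\iota))$ and covers the identity on the monodromy manifold: $$\mathrm{tr}(\tilde M_j\tilde M_k)=\mathrm{tr}(M_jM_k)\ \text{ for all distinct } j,k\in\{1,2,3\},\qquad \tilde\omega_l=\omega_l\ \text{ for } l=1,2,3,4 .$$ Moreover, $\mu_{w_2}$ admits the following two dual geometric characterizations: (a) as the $\pi$-rotation on colored triangulations of the hexagon: read as a sequence of flips starting from the reference equilateral colored triangulation $T_0$, $\mu_{w_2}$ ends at the rotation of $T_0$ by $\pi$; (b) as the inside-out on star-shaped fat graphs of the four-punctured Riemann sphere: read as a sequence of fat graph flips, $\mu_{w_2}$ is the operation that transforms the star-shaped spine dual to $T_0$ into the reversed spine dual to the $\pi$-rotation of $T_0$.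
   Context: **Representation space.** For $\iota=(\iota_1,\iota_2,\iota_3,\iota_\infty)\in(\mathbb{C}^* )^4$, $$\mathcal{R}(\iota)=\{(M_1,M_2,M_3,M_\infty)\in SL_2(\mathbb{C})^4 : M_1M_2M_3M_\infty=\mathbb{1},\ \mathrm{eig}(M_k)=\{\iota_k^{\pm1}\},\ k=1,2,3,\infty\}.$$ Put $a_k=\mathrm{tr}(M_k)$, $a_4:=a_\infty$, $x_i=\mathrm{tr}(M_jM_k)$ for $\{i,j,k\}=\{1,2,3\}$, $\omega_i=a_ia_4+a_ja_k$ for $\{i,j,k\}=\{1,2,3\}$, and $\omega_4=a_1a_2a_3a_4+a_1^2+a_2^2+a_3^2+a_4^2-4$. The data $(x,\omega)$ coordinatize the monodromy manifold (Fricke cubic surface) of the sixth Painlevé equation; quantities with tildes are computed from the tilded matrices. A "lift of $w_2$ to the representation space" is a map $\mathcal{R}(\iota)\to\mathcal{R}(w_2(\iota))$ covering the identity in the data $(x,\omega)$. **Okamoto's transformation.** $$w_2(\theta_1,\theta_2,\theta_3,\theta_\infty)=\tfrac12\big(\theta_1-\theta_2-\theta_3-\theta_\infty,\ -\theta_1+\theta_2-\theta_3-\theta_\infty,\ -\theta_1-\theta_2+\theta_3-\theta_\infty,\ -\theta_1-\theta_2-\theta_3+\theta_\infty\big),$$ and $w_2(\iota)_k:=e^{\pi i\,w_2(\theta)_k}$. **Coordinatization.** For nonzero $Z=(Z_O,Z_B,Z_G)$ with $Z_OZ_BZ_G=\iota_1\iota_2\iota_3\iota_\infty$ let $$M_1=\begin{pmatrix}0&\iota_1Z_O^{-1}\\-\iota_1^{-1}Z_O&\iota_1+\iota_1^{-1}\end{pmatrix},$$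 $$M_2=\begin{pmatrix}\iota_2+\iota_2^{-1}+\iota_2Z_B^{-1}&\iota_2+\iota_2^{-1}+\iota_2Z_B^{-1}+\iota_2^{-1}Z_B\\-\iota_2Z_B^{-1}&-\iota_2Z_B^{-1}\end{pmatrix},$$ $$M_3=\begin{pmatrix}\iota_3+\iota_3^{-1}+\iota_3^{-1}Z_G&\iota_3^{-1}Z_G\\-\iota_3-\iota_3^{-1}-\iota_3Z_G^{-1}-\iota_3^{-1}Z_G&-\iota_3^{-1}Z_G\end{pmatrix},\qquad M_\infty=(M_1M_2M_3)^{-1}.$$ Then $(M_1,M_2,M_3,M_\infty)(Z;\iota)\in\mathcal{R}(\iota)$. Elements of $\mathcal{R}(\iota)$ are considered in this coordinatization. **Cluster structure.** $Z_O,Z_B,Z_G$ are cluster $\mathcal{X}$-coordinates for the initial quiver on vertices $O,B,G$ whose arrows are $B\to O$, $O\to G$, $G\to B$. For a quiver, $\epsilon_{ij}$ is the (signed) number of arrows from $i$ to $j$. The mutation $\mu_k$ changes the quiver by the usual rule (add $i\to j$ for each path $i\to k\to j$, reverse arrows at $k$, cancel 2-cycles) and replaces the coordinates by $X_k'=X_k^{-1}$ and $X_i'=X_i\big(1+X_k^{-\mathrm{sgn}(\epsilon_{ik})}\big)^{-\epsilon_{ik}}$ for $i\neq k$. A sequence of mutations yields the final coordinates as rational functions of the initial ones; the resulting substitution is "the action" of the sequence. **Colored triangulations.** A colored triangulation of the regular hexagon is a triple of pairwise non-crossing diagonals (chords) cutting it into four triangles, together with a bijection from the chords to $\{O,B,G\}$.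 Flipping chord $\alpha$ removes it and inserts the other diagonal of the resulting quadrilateral, with the same color. The cluster coordinate $Z_\alpha$ is attached to the chord colored $\alpha$; the quiver of a colored triangulation has vertices $O,B,G$ and, inside each triangle, an arrow from each chord-side to the next side in counterclockwise order whenever that side is also a chord. The flip of chord $\alpha$ corresponds to $\mu_\alpha$. A triangulation is equilateral if its three chords form an equilateral triangle. The reference triangulation $T_0$ is an equilateral one whose chords are colored $O,G,B$ in counterclockwise order (so its quiver is the initial one above). **Fat graphs.** Label the hexagon's vertices cyclically so that the central triangle of $T_0$ has vertices $v_2,v_4,v_6$. Gluing together the two hexagon sides meeting at $v_1$, likewise at $v_3$ and at $v_5$, produces a sphere with four punctures (the images of $v_1$, of $v_3$, of $v_5$, and the common image of $v_2,v_4,v_6$). The spine (trivalent fat graph on the four-punctured sphere $\Sigma_{0,4}$, each face containing exactly one puncture) dual to a triangulation of the hexagon has one vertex per triangle and one edge per chord and per pair of glued sides. The spine dual to $T_0$ is star-shaped: a central vertex joined by three edges (dual to the chords $O,B,G$) to three vertices each carrying a loop. The flip of a spine at the edge dual to chord $\alpha$ is the operation dual to the flip of chord $\alpha$ (rotation of that edge together with its end vertices), also allowed when the edge is incident to a loop; on the coordinates attached to edges dual to chords it acts by $\mu_\alpha$. (The Casimir element attached to the small loop around a puncture $v_1,v_3,v_5$ is the product of the variables attached to all triangulation edges this loop crosses, so when the edge flipped is incident to that loop it acquires, or loses in the reverse flip, the factor $Z'_\alpha$.) The "inside-out" is the resulting operation reversing the star-shaped spine dual to $T_0$ into the spine dual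 to the rotation of $T_0$ by $\pi$ (the gluing of the hexagon's sides being kept fixed). *)

theory Defs
  imports
    "HOL-Analysis.Analysis"
    "HOL-Computational_Algebra.Polynomial_Factorial"
begin

section \<open>Representation space and Okamoto's transformation\<close>

datatype puncture = P1 | P2 | P3 | Pinf

type_synonym quadruple = "puncture \<Rightarrow> complex^2^2"

definition eigenvalues :: "complex^2^2 \<Rightarrow> complex set" where
  "eigenvalues A = {l. \<exists>v. v \<noteq> 0 \<and> A *v v = l *s v}"

text \<open>In \<open>SL\<^sub>2\<close> the set of eigenvalues determines their multiplicities, so the condition
  \<open>eig(M\<^sub>k) = {\<iota>\<^sub>k, \<iota>\<^sub>k\<^sup>-\<^sup>1}\<close> may be read as an equality of sets even when \<open>\<iota>\<^sub>k = \<plusminus>1\<close>.\<close>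

definition rep_space :: "(puncture \<Rightarrow> complex) \<Rightarrow> quadruple set" where
  "rep_space \<iota> = {M. (\<forall>k. det (M k) = 1)
      \<and> M P1 ** M P2 ** M P3 ** M Pinf = mat 1
      \<and> (\<forall>k. eigenvalues (M k) = {\<iota> k, inverse (\<iota> k)})}"

text \<open>The index \<open>4\<close> of \<open>a\<^sub>4\<close> and \<open>\<omega>\<^sub>4\<close> is identified with \<open>\<infinity>\<close>.\<close>

fun omega :: "quadruple \<Rightarrow> puncture \<Rightarrow> complex" where
  "omega M P1 = trace (M P1) * trace (M Pinf) + trace (M P2) * trace (M P3)"
| "omega M P2 = trace (M P2) * trace (M Pinf) + trace (M P1) * trace (M P3)"
| "omega M P3 = trace (M P3) * trace (M Pinf) + trace (M P1) * trace (M P2)"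
| "omega M Pinf = trace (M P1) * trace (M P2) * trace (M P3) * trace (M Pinf)
      + (trace (M P1))\<^sup>2 + (trace (M P2))\<^sup>2 + (trace (M P3))\<^sup>2 + (trace (M Pinf))\<^sup>2 - 4"

fun w2 :: "(puncture \<Rightarrow> complex) \<Rightarrow> puncture \<Rightarrow> complex" where
  "w2 \<theta> P1 = (\<theta> P1 - \<theta> P2 - \<theta> P3 - \<theta> Pinf) / 2"
| "w2 \<theta> P2 = (- \<theta> P1 + \<theta> P2 - \<theta> P3 - \<theta> Pinf) / 2"
| "w2 \<theta> P3 = (- \<theta> P1 - \<theta> P2 + \<theta> P3 - \<theta> Pinf) / 2"
| "w2 \<theta> Pinf = (- \<theta> P1 - \<theta> P2 - \<theta> P3 + \<theta> Pinf) / 2"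

text \<open>Since \<open>\<theta>\<close> enters \<open>w\<^sub>2(\<iota>)\<close> through half-sums, \<open>w\<^sub>2(\<iota>)\<close> is a function of \<open>\<theta>\<close>,
  namely \<open>iota (w2 \<theta>)\<close>, and not of \<open>\<iota>\<close> alone.\<close>

definition iota :: "(puncture \<Rightarrow> complex) \<Rightarrow> puncture \<Rightarrow> complex" where
  "iota \<theta> k = exp (complex_of_real pi * \<i> * \<theta> k)"


section \<open>Coordinatization\<close>

text \<open>The three quiver vertices \<open>O\<close>, \<open>B\<close>, \<open>G\<close>, which are also the colours of the chords.\<close>

datatype colour = Orange | Blue | Green

definition coord_torus :: "(puncture \<Rightarrow> complex) \<Rightarrow> (colour \<Rightarrow> complex) set" where
  "coord_torus \<iota> = {Z. (\<forall>c. Z c \<noteq> 0)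
      \<and> Z Orange * Z Blue * Z Green = \<iota> P1 * \<iota> P2 * \<iota> P3 * \<iota> Pinf}"

definition chart1 :: "(puncture \<Rightarrow> complex) \<Rightarrow> (colour \<Rightarrow> complex) \<Rightarrow> complex^2^2" where
  "chart1 \<iota> Z = vector
     [vector [0, \<iota> P1 / Z Orange],
      vector [- (Z Orange / \<iota> P1), \<iota> P1 + 1 / \<iota> P1]]"

definition chart2 :: "(puncture \<Rightarrow> complex) \<Rightarrow> (colour \<Rightarrow> complex) \<Rightarrow> complex^2^2" where
  "chart2 \<iota> Z = vector
     [vector [\<iota> P2 + 1 / \<iota> P2 + \<iota> P2 / Z Blue, \<iota> P2 + 1 / \<iota> P2 + \<iota> P2 / Z Blue + Z Blue / \<iota> P2],
      vector [- (\<iota> P2 / Z Blue), - (\<iota> P2 / Z Blue)]]"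

definition chart3 :: "(puncture \<Rightarrow> complex) \<Rightarrow> (colour \<Rightarrow> complex) \<Rightarrow> complex^2^2" where
  "chart3 \<iota> Z = vector
     [vector [\<iota> P3 + 1 / \<iota> P3 + Z Green / \<iota> P3, Z Green / \<iota> P3],
      vector [- \<iota> P3 - 1 / \<iota> P3 - \<iota> P3 / Z Green - Z Green / \<iota> P3, - (Z Green / \<iota> P3)]]"

fun chart :: "(puncture \<Rightarrow> complex) \<Rightarrow> (colour \<Rightarrow> complex) \<Rightarrow> quadruple" where
  "chart \<iota> Z P1 = chart1 \<iota> Z"
| "chart \<iota> Z P2 = chart2 \<iota> Z"
| "chart \<iota> Z P3 = chart3 \<iota> Z"
| "chart \<iota> Z Pinf = matrix_inv (chart1 \<iota> Z ** chart2 \<iota> Z ** chart3 \<iota> Z)"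

text \<open>The entry-wise action of a substitution \<open>s\<close> of the coordinates: a quadruple of
  \<open>\<R>(\<iota>)\<close> in the chart is rewritten with \<open>Z\<close> replaced by \<open>s(Z)\<close> and \<open>\<iota>\<close> by \<open>w\<^sub>2(\<iota>)\<close>
  in every matrix entry.  The coordinates are recovered from the quadruple because
  the chart is injective.\<close>

definition entrywise_action ::
  "(puncture \<Rightarrow> complex) \<Rightarrow> ((colour \<Rightarrow> complex) \<Rightarrow> colour \<Rightarrow> complex) \<Rightarrow> quadruple \<Rightarrow> quadruple" where
  "entrywise_action \<theta> s M =
     chart (iota (w2 \<theta>)) (s (inv_into (coord_torus (iota \<theta>)) (chart (iota \<theta>)) M))"

text \<open>\<open>M\<close> and \<open>N\<close> have the same data \<open>(x, \<omega>)\<close> on the monodromy manifold.\<close>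

definition same_monodromy_data :: "quadruple \<Rightarrow> quadruple \<Rightarrow> bool" where
  "same_monodromy_data M N \<longleftrightarrow>
     (\<forall>j\<in>{P1, P2, P3}. \<forall>k\<in>{P1, P2, P3}. j \<noteq> k \<longrightarrow> trace (N j ** N k) = trace (M j ** M k))
     \<and> (\<forall>l. omega N l = omega M l)"

text \<open>\<open>F\<close>, defined on \<open>D\<close>, lifts \<open>w\<^sub>2\<close> to the representation space.\<close>

definition lifts_w2 :: "(puncture \<Rightarrow> complex) \<Rightarrow> quadruple set \<Rightarrow> (quadruple \<Rightarrow> quadruple) \<Rightarrow> bool" where
  "lifts_w2 \<theta> D F \<longleftrightarrow> D \<subseteq> rep_space (iota \<theta>) \<and> F ` D \<subseteq> rep_space (iota (w2 \<theta>))
     \<and> (\<forall>M\<in>D. same_monodromy_data M (F M))"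


section \<open>Quivers and cluster mutations\<close>

text \<open>A quiver is given by its signed arrow numbers: \<open>\<epsilon> i j\<close> is the number of arrows from
  \<open>i\<close> to \<open>j\<close> minus the number of arrows from \<open>j\<close> to \<open>i\<close>.\<close>

type_synonym quiver = "colour \<Rightarrow> colour \<Rightarrow> int"

type_synonym 'a seed = "quiver \<times> (colour \<Rightarrow> 'a)"

definition initial_arrows :: "(colour \<times> colour) set" where
  "initial_arrows = {(Blue, Orange), (Orange, Green), (Green, Blue)}"

definition initial_quiver :: quiver where
  "initial_quiver i j = of_bool ((i, j) \<in> initial_arrows) - of_bool ((j, i) \<in> initial_arrows)"

text \<open>For \<open>i, j \<noteq> k\<close> the number of paths \<open>i \<rightarrow> k \<rightarrow> j\<close> is \<open>max 0 (\<epsilon> i k) * max 0 (\<epsilon> k j)\<close>;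
  cancelling 2-cycles is automatic for signed arrow numbers.\<close>

definition mutate_quiver :: "colour \<Rightarrow> quiver \<Rightarrow> quiver" where
  "mutate_quiver k \<epsilon> = (\<lambda>i j. if i = k \<or> j = k then - \<epsilon> i j
     else \<epsilon> i j + max 0 (\<epsilon> i k) * max 0 (\<epsilon> k j) - max 0 (\<epsilon> j k) * max 0 (\<epsilon> k i))"

definition mutate_coords :: "colour \<Rightarrow> quiver \<Rightarrow> (colour \<Rightarrow> 'a::field) \<Rightarrow> colour \<Rightarrow> 'a" where
  "mutate_coords k \<epsilon> X = (\<lambda>i. if i = k then inverse (X k)
     else X i * (1 + X k powi (- sgn (\<epsilon> i k))) powi (- \<epsilon> i k))"

definition mutate :: "colour \<Rightarrow> 'a::field seed \<Rightarrow> 'a seed" where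
  "mutate k s = (mutate_quiver k (fst s), mutate_coords k (fst s) (snd s))"

text \<open>The word \<open>\<mu>\<^sub>\<beta>\<mu>\<^sub>\<gamma>\<mu>\<^sub>\<beta>\<mu>\<^sub>\<gamma>\<mu>\<^sub>\<beta>\<mu>\<^sub>\<alpha>\<mu>\<^sub>\<gamma>\<mu>\<^sub>\<beta>\<mu>\<^sub>\<alpha>\<close>.  Words are applied by \<^term>\<open>foldr\<close>, hence with the
  rightmost letter first, and \<open>drop n w\<close> is the part of \<open>w\<close> performed before its last
  \<open>n\<close> steps.\<close>

definition w2_word :: "colour \<Rightarrow> colour \<Rightarrow> colour \<Rightarrow> colour list" where
  "w2_word \<alpha> \<beta> \<gamma> = [\<beta>, \<gamma>, \<beta>, \<gamma>, \<beta>, \<alpha>, \<gamma>, \<beta>, \<alpha>]"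

text \<open>No step of the word divides by zero or produces a zero coordinate
  (recall that \<open>x / 0 = 0\<close> in HOL).\<close>

fun mutations_defined :: "colour list \<Rightarrow> 'a::field seed \<Rightarrow> bool" where
  "mutations_defined [] s \<longleftrightarrow> True"
| "mutations_defined (k # w) s \<longleftrightarrow> mutations_defined w s \<and>
     (let \<epsilon> = fst (foldr mutate w s); X = snd (foldr mutate w s) in
       X k \<noteq> 0 \<and> (\<forall>i. i \<noteq> k \<and> \<epsilon> i k \<noteq> 0 \<longrightarrow> 1 + X k powi (- sgn (\<epsilon> i k)) \<noteq> 0))"

text \<open>The rational function field \<open>\<complex>(Z\<^sub>O, Z\<^sub>B, Z\<^sub>G)\<close> is the fraction field of
  \<open>\<complex>[Z\<^sub>G][Z\<^sub>B][Z\<^sub>O]\<close>, and \<open>indet\<close> is its family of indeterminates.\<close>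

type_synonym ratfun = "complex poly poly poly fract"

fun indet :: "colour \<Rightarrow> ratfun" where
  "indet Orange = to_fract [:0, 1:]"
| "indet Blue = to_fract [:[:0, 1:]:]"
| "indet Green = to_fract [:[:[:0, 1:]:]:]"

fun Ztilde :: "(colour \<Rightarrow> 'a::field) \<Rightarrow> colour \<Rightarrow> 'a" where
  "Ztilde Z Orange = (1 + Z Orange + Z Orange * Z Blue)
      / (Z Blue * (1 + Z Green + Z Orange * Z Green))"
| "Ztilde Z Blue = (1 + Z Blue + Z Blue * Z Green)
      / (Z Green * (1 + Z Orange + Z Orange * Z Blue))"
| "Ztilde Z Green = (1 + Z Green + Z Orange * Z Green)
      / (Z Orange * (1 + Z Blue + Z Blue * Z Green))"

text \<open>The points at which the three expressions above are defined and nonzero.\<close>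

definition Ztilde_domain :: "(colour \<Rightarrow> complex) set" where
  "Ztilde_domain = {Z. (\<forall>c. Z c \<noteq> 0)
      \<and> 1 + Z Orange + Z Orange * Z Blue \<noteq> 0
      \<and> 1 + Z Blue + Z Blue * Z Green \<noteq> 0
      \<and> 1 + Z Green + Z Orange * Z Green \<noteq> 0}"


section \<open>Coloured triangulations of the hexagon\<close>

text \<open>The vertices \<open>v\<^sub>1, \<dots>, v\<^sub>6\<close> of the regular hexagon are the numbers \<open>1, \<dots>, 6\<close>, in
  counterclockwise order; \<open>hexpoint\<close> is their position in the plane.\<close>

definition hexverts :: "nat set" where
  "hexverts = {1..6}"

definition hexpoint :: "nat \<Rightarrow> complex" where
  "hexpoint v = cis (real v * pi / 3)"

definition hexsucc :: "nat \<Rightarrow> nat" where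
  "hexsucc v = v mod 6 + 1"

definition rot_pi :: "nat \<Rightarrow> nat" where
  "rot_pi v = (v + 2) mod 6 + 1"

lemma hexpoint_add_3: "hexpoint (v + 3) = cis pi * hexpoint v"
  unfolding hexpoint_def cis_mult by (rule arg_cong[where f = cis]) (simp add: field_simps)

lemma rot_pi_is_rotation_by_pi:
  assumes "v \<in> hexverts"
  shows "hexpoint (rot_pi v) = cis pi * hexpoint v"
proof (cases "v \<le> 3")
  case True
  with assms have "rot_pi v = v + 3"
    by (auto simp: rot_pi_def hexverts_def)
  then show ?thesis by (simp add: hexpoint_add_3)
next
  case False
  with assms have "v \<in> {4, 5, 6}"
    by (auto simp: hexverts_def)
  then have v: "v = rot_pi v + 3"
    by (auto simp: rot_pi_def)
  have "cis pi * hexpoint v = cis pi * (cis pi * hexpoint (rot_pi v))"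
    by (subst v) (simp only: hexpoint_add_3)
  then show ?thesis by simp
qed

definition hexsides :: "nat set set" where
  "hexsides = {{v, hexsucc v} | v. v \<in> hexverts}"

definition diagonals :: "nat set set" where
  "diagonals = {{u, v} | u v. u \<in> hexverts \<and> v \<in> hexverts \<and> u \<noteq> v} - hexsides"

text \<open>\<open>ccw u v w\<close>: the pairwise distinct vertices \<open>u\<close>, \<open>v\<close>, \<open>w\<close> are met in this order
  when the boundary is travelled counterclockwise.\<close>

definition ccw :: "nat \<Rightarrow> nat \<Rightarrow> nat \<Rightarrow> bool" where
  "ccw u v w \<longleftrightarrow> {u, v, w} \<subseteq> hexverts \<and> (u < v \<and> v < w \<or> v < w \<and> w < u \<or> w < u \<and> u < v)"

definition crossing :: "nat set \<Rightarrow> nat set \<Rightarrow> bool" where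
  "crossing d e \<longleftrightarrow> (\<exists>a b a' b'. d = {a, a'} \<and> e = {b, b'} \<and> ccw a b a' \<and> ccw a' b' a)"

type_synonym triangulation = "colour \<Rightarrow> nat set"

definition coloured_triangulation :: "triangulation \<Rightarrow> bool" where
  "coloured_triangulation T \<longleftrightarrow> inj T \<and> range T \<subseteq> diagonals
     \<and> (\<forall>i j. \<not> crossing (T i) (T j))"

definition triangle :: "triangulation \<Rightarrow> nat set \<Rightarrow> bool" where
  "triangle T t \<longleftrightarrow> t \<subseteq> hexverts \<and> card t = 3
     \<and> (\<forall>u\<in>t. \<forall>v\<in>t. u \<noteq> v \<longrightarrow> {u, v} \<in> hexsides \<union> range T)"

text \<open>The two triangles adjacent to the chord \<open>T \<alpha>\<close> form a quadrilateral, and their two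
  vertices off \<open>T \<alpha>\<close> are the end points of its other diagonal.\<close>

definition flip :: "colour \<Rightarrow> triangulation \<Rightarrow> triangulation" where
  "flip \<alpha> T = T(\<alpha> := {x. x \<notin> T \<alpha> \<and> triangle T (insert x (T \<alpha>))})"

definition triangulation_arrows :: "triangulation \<Rightarrow> colour \<Rightarrow> colour \<Rightarrow> (nat \<times> nat \<times> nat) set" where
  "triangulation_arrows T i j =
     {(u, v, w). ccw u v w \<and> triangle T {u, v, w} \<and> {u, v} = T i \<and> {v, w} = T j}"

definition triangulation_quiver :: "triangulation \<Rightarrow> quiver" where
  "triangulation_quiver T i j =
     int (card (triangulation_arrows T i j)) - int (card (triangulation_arrows T j i))"

definition equilateral :: "triangulation \<Rightarrow> bool" where
  "equilateral T \<longleftrightarrow> coloured_triangulation T \<and>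
     (\<exists>u v w. range T = {{u, v}, {v, w}, {w, u}}
        \<and> dist (hexpoint u) (hexpoint v) = dist (hexpoint v) (hexpoint w)
        \<and> dist (hexpoint v) (hexpoint w) = dist (hexpoint w) (hexpoint u))"

definition reference_triangulation :: "triangulation \<Rightarrow> bool" where
  "reference_triangulation T \<longleftrightarrow> equilateral T \<and>
     (\<exists>u v w. ccw u v w \<and> T Orange = {u, v} \<and> T Green = {v, w} \<and> T Blue = {w, u})"

lemma reference_triangulation_exists:
  "reference_triangulation (\<lambda>c. case c of Orange \<Rightarrow> {2, 4} | Green \<Rightarrow> {4, 6} | Blue \<Rightarrow> {6, 2})"
proof -
  let ?T = "\<lambda>c. case c of Orange \<Rightarrow> {2, 4} | Green \<Rightarrow> {4, 6} | Blue \<Rightarrow> {6, 2 :: nat}"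
  have UNIV_colour: "(UNIV :: colour set) = {Orange, Blue, Green}"
    using colour.exhaust by auto
  have range: "range ?T = {{2, 4}, {4, 6}, {6, 2}}"
    unfolding UNIV_colour by auto
  have hexsides_eq: "hexsides = {{1, 2}, {2, 3}, {3, 4}, {4, 5}, {5, 6}, {6, 1}}"
  proof -
    have verts: "hexverts = {1, 2, 3, 4, 5, 6}" by (auto simp: hexverts_def)
    show ?thesis
      unfolding hexsides_def Setcompr_eq_image verts by (simp add: hexsucc_def flip: numeral_2_eq_2)
  qed
  have "inj ?T"
    by (auto simp: inj_def doubleton_eq_iff split: colour.splits)
  moreover have "range ?T \<subseteq> diagonals"
  proof -
    have diag: "{u, v} \<in> diagonals"
      if "u \<in> hexverts" "v \<in> hexverts" "u \<noteq> v" "{u, v} \<notin> hexsides" for u v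
      unfolding diagonals_def using that by blast
    have "{2, 4} \<in> diagonals" "{4, 6} \<in> diagonals" "{6, 2} \<in> diagonals"
      by (rule diag; simp add: hexverts_def hexsides_eq doubleton_eq_iff)+
    then show ?thesis unfolding range by simp
  qed
  moreover have "\<not> crossing (?T i) (?T j)" for i j
    unfolding crossing_def ccw_def
    by (cases i; cases j) (simp_all add: doubleton_eq_iff, (linarith | presburger)+)
  moreover have "dist (hexpoint (v + 2)) (hexpoint v) = norm (cis (2 * pi / 3) - 1)" for v
  proof -
    have "hexpoint (v + 2) = cis (2 * pi / 3) * hexpoint v"
      unfolding hexpoint_def cis_mult by (rule arg_cong[where f = cis]) (simp add: field_simps)
    then have "hexpoint (v + 2) - hexpoint v = (cis (2 * pi / 3) - 1) * hexpoint v"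
      by (simp add: algebra_simps)
    then show ?thesis by (simp add: dist_norm norm_mult hexpoint_def)
  qed
  from this[of 2] this[of 4] this[of 6]
  have "dist (hexpoint 4) (hexpoint 2) = norm (cis (2 * pi / 3) - 1)"
    "dist (hexpoint 6) (hexpoint 4) = norm (cis (2 * pi / 3) - 1)"
    "dist (hexpoint 8) (hexpoint 6) = norm (cis (2 * pi / 3) - 1)" by simp_all
  moreover have "hexpoint 8 = hexpoint 2"
    using hexpoint_add_3[of 5] hexpoint_add_3[of 2] by simp
  ultimately have "coloured_triangulation ?T"
    and d: "dist (hexpoint 2) (hexpoint 4) = dist (hexpoint 4) (hexpoint 6)"
      "dist (hexpoint 4) (hexpoint 6) = dist (hexpoint 6) (hexpoint 2)"
    unfolding coloured_triangulation_def by (simp_all add: dist_commute)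
  then have "equilateral ?T"
    unfolding equilateral_def
    by (intro conjI exI[of _ 2] exI[of _ 4] exI[of _ 6] range d)
  moreover have "ccw 2 4 6" by (simp add: ccw_def hexverts_def)
  ultimately show ?thesis
    unfolding reference_triangulation_def
    by (intro conjI exI[of _ 2] exI[of _ 4] exI[of _ 6]) simp_all
qed

definition rotate_pi :: "triangulation \<Rightarrow> triangulation" where
  "rotate_pi T = (\<lambda>c. rot_pi ` T c)"


section \<open>Fat graphs on the four-punctured sphere\<close>

text \<open>Gluing the two sides at \<open>v\<^sub>1\<close>, at \<open>v\<^sub>3\<close> and at \<open>v\<^sub>5\<close> identifies \<open>v\<^sub>2\<close>, \<open>v\<^sub>4\<close>, \<open>v\<^sub>6\<close>;
  the punctures are the classes of vertices.\<close>

definition hexpuncture :: "nat \<Rightarrow> nat set" where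
  "hexpuncture v = (if v \<in> {1, 3, 5} then {v} else {2, 4, 6})"

text \<open>A fat graph is given by its half-edges, the permutation \<open>nxt\<close> whose cycles are the
  vertices with their counterclockwise cyclic order, and the involution \<open>opp\<close> whose
  orbits are the edges.  With this convention the faces are the cycles of \<open>nxt \<circ> opp\<close>,
  and \<open>face h\<close> is the puncture in the face of \<open>h\<close>.

  A half-edge of an edge dual to a chord is labelled by the colour of the chord.  A
  half-edge of an edge dual to a pair of glued sides is labelled by the hexagon side
  \<open>v\<^sub>iv\<^sub>i\<^sub>+\<^sub>1\<close> (as \<open>Side i\<close>) it crosses.  Cutting the sphere along the three glued sides gives
  back the hexagon, and a tree embedded in a disc is determined up to isotopy by its cyclic
  orders and its labelled ends on the boundary; so these labels record how the spine
  sits in the punctured sphere, and not only its abstract isomorphism type.\<close>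

datatype edge_label = Chord colour | Side nat

record 'h fatgraph =
  halves :: "'h set"
  nxt :: "'h \<Rightarrow> 'h"
  opp :: "'h \<Rightarrow> 'h"
  label :: "'h \<Rightarrow> edge_label"
  face :: "'h \<Rightarrow> nat set"

definition fg_vertices :: "'h fatgraph \<Rightarrow> 'h set set" where
  "fg_vertices \<Gamma> = (\<lambda>h. {h, nxt \<Gamma> h, nxt \<Gamma> (nxt \<Gamma> h)}) ` halves \<Gamma>"

definition fg_edges :: "'h fatgraph \<Rightarrow> 'h set set" where
  "fg_edges \<Gamma> = (\<lambda>h. {h, opp \<Gamma> h}) ` halves \<Gamma>"

text \<open>Trivalent connected fat graph of genus zero, with exactly one of the four punctures in
  each face.\<close>

definition spine_of_sphere :: "'h fatgraph \<Rightarrow> bool" where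
  "spine_of_sphere \<Gamma> \<longleftrightarrow> finite (halves \<Gamma>) \<and> halves \<Gamma> \<noteq> {}
     \<and> (\<forall>h\<in>halves \<Gamma>. nxt \<Gamma> h \<in> halves \<Gamma> \<and> nxt \<Gamma> h \<noteq> h \<and> nxt \<Gamma> (nxt \<Gamma> (nxt \<Gamma> h)) = h)
     \<and> (\<forall>h\<in>halves \<Gamma>. opp \<Gamma> h \<in> halves \<Gamma> \<and> opp \<Gamma> h \<noteq> h \<and> opp \<Gamma> (opp \<Gamma> h) = h)
     \<and> (\<forall>h\<in>halves \<Gamma>. \<forall>h'\<in>halves \<Gamma>.
          (h, h') \<in> {(x, y). x \<in> halves \<Gamma> \<and> (y = nxt \<Gamma> x \<or> y = opp \<Gamma> x)}\<^sup>*)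
     \<and> face \<Gamma> ` halves \<Gamma> = hexpuncture ` hexverts
     \<and> (\<forall>h\<in>halves \<Gamma>. \<forall>h'\<in>halves \<Gamma>.
          face \<Gamma> h = face \<Gamma> h' \<longleftrightarrow> (\<exists>n. ((nxt \<Gamma> \<circ> opp \<Gamma>) ^^ n) h = h'))
     \<and> int (card (fg_vertices \<Gamma>)) - int (card (fg_edges \<Gamma>)) + 4 = 2"

definition star_shaped :: "'h fatgraph \<Rightarrow> bool" where
  "star_shaped \<Gamma> \<longleftrightarrow> (\<exists>h\<in>halves \<Gamma>.
     label \<Gamma> ` {h, nxt \<Gamma> h, nxt \<Gamma> (nxt \<Gamma> h)} = range Chord
     \<and> (\<forall>k\<in>{h, nxt \<Gamma> h, nxt \<Gamma> (nxt \<Gamma> h)}.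
          opp \<Gamma> (nxt \<Gamma> (opp \<Gamma> k)) = nxt \<Gamma> (nxt \<Gamma> (opp \<Gamma> k))))"

text \<open>Isotopy of spines.\<close>

definition same_spine :: "'h fatgraph \<Rightarrow> 'k fatgraph \<Rightarrow> bool" where
  "same_spine \<Gamma> \<Delta> \<longleftrightarrow> (\<exists>f. bij_betw f (halves \<Gamma>) (halves \<Delta>)
     \<and> (\<forall>h\<in>halves \<Gamma>. f (nxt \<Gamma> h) = nxt \<Delta> (f h) \<and> f (opp \<Gamma> h) = opp \<Delta> (f h)
          \<and> label \<Delta> (f h) = label \<Gamma> h \<and> face \<Delta> (f h) = face \<Gamma> h))"

text \<open>A half-edge of the dual spine is a triangle together with one of its sides, given
  by the side \<open>(u, v)\<close> directed so that the triangle lies on its left.  Its face contains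
  the initial vertex \<open>u\<close>: the half-edge \<open>nxt (opp (u, v))\<close> again has initial vertex \<open>u\<close>, up
  to the gluing.\<close>

definition left_apex :: "triangulation \<Rightarrow> nat \<Rightarrow> nat \<Rightarrow> nat" where
  "left_apex T u v = (THE w. ccw u v w \<and> triangle T {u, v, w})"

definition glued_side :: "nat \<times> nat \<Rightarrow> nat \<times> nat" where
  "glued_side = (\<lambda>(u, v). if u \<in> {1, 3, 5}
     then (if u = 1 then 6 else u - 1, u) else (v, hexsucc v))"

definition dual_spine :: "triangulation \<Rightarrow> (nat \<times> nat) fatgraph" where
  "dual_spine T = \<lparr>
     halves = {(u, v). \<exists>w. ccw u v w \<and> triangle T {u, v, w}},
     nxt = (\<lambda>(u, v). (v, left_apex T u v)),
     opp = (\<lambda>(u, v). if v = hexsucc u then glued_side (u, v) else (v, u)),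
     label = (\<lambda>(u, v). if v = hexsucc u then Side u else Chord (THE c. T c = {u, v})),
     face = (\<lambda>(u, v). hexpuncture u) \<rparr>"

text \<open>Flip of the edge \<open>{h, h'}\<close> labelled \<open>\<alpha>\<close>, joining distinct vertices with cyclic orders
  \<open>(h, a, b)\<close> and \<open>(h', c, d)\<close>: the edge is rotated so that these become \<open>(h, b, c)\<close> and
  \<open>(h', d, a)\<close>.  Any of \<open>a\<close>, \<open>b\<close>, \<open>c\<close>, \<open>d\<close> may be paired by \<open>opp\<close>, that is, the
  edge may be incident to loops.  The half-edges, the edges and their labels persist; the faces of
  \<open>a, b, c, d\<close> do not change, and \<open>h\<close>, \<open>h'\<close> pass to the faces of \<open>d\<close>, \<open>b\<close>, respectively.\<close>

definition flip_fg :: "colour \<Rightarrow> 'h fatgraph \<Rightarrow> 'h fatgraph" where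
  "flip_fg \<alpha> \<Gamma> = \<Gamma>\<lparr>
     nxt := (\<lambda>x.
       if label \<Gamma> x = Chord \<alpha> then nxt \<Gamma> (nxt \<Gamma> x)
       else if label \<Gamma> (nxt \<Gamma> x) = Chord \<alpha> then nxt \<Gamma> (opp \<Gamma> (nxt \<Gamma> x))
       else if label \<Gamma> (nxt \<Gamma> (nxt \<Gamma> x)) = Chord \<alpha> then opp \<Gamma> (nxt \<Gamma> (nxt \<Gamma> x))
       else nxt \<Gamma> x),
     face := (\<lambda>x.
       if label \<Gamma> x = Chord \<alpha> then face \<Gamma> (nxt \<Gamma> (nxt \<Gamma> (opp \<Gamma> x)))
       else face \<Gamma> x) \<rparr>"

text \<open>The quiver governing the coordinates attached to the edges dual to chords.\<close>

definition fg_arrows :: "'h fatgraph \<Rightarrow> colour \<Rightarrow> colour \<Rightarrow> 'h set" where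
  "fg_arrows \<Gamma> i j = {h \<in> halves \<Gamma>. label \<Gamma> h = Chord i \<and> label \<Gamma> (nxt \<Gamma> h) = Chord j}"

definition fg_quiver :: "'h fatgraph \<Rightarrow> quiver" where
  "fg_quiver \<Gamma> i j = int (card (fg_arrows \<Gamma> i j)) - int (card (fg_arrows \<Gamma> j i))"

end

theory Submission
  imports Defs
begin

text \<open>The word \<open>\<mu>\<^sub>\<beta>\<mu>\<^sub>\<gamma>\<mu>\<^sub>\<beta>\<mu>\<^sub>\<gamma>\<mu>\<^sub>\<beta>\<mu>\<^sub>\<alpha>\<mu>\<^sub>\<gamma>\<mu>\<^sub>\<beta>\<mu>\<^sub>\<alpha>\<close> splits into \<open>\<mu>\<^sub>\<alpha>\<mu>\<^sub>\<gamma>\<mu>\<^sub>\<beta>\<mu>\<^sub>\<alpha>\<close>, which already produces the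
  coordinates \<open>Ztilde\<close> with \<open>\<beta>\<close> and \<open>\<gamma>\<close> exchanged, and a pentagon, which undoes the exchange.

  The traces \<open>tr(M\<^sub>jM\<^sub>k)\<close> of the chart are sums of three terms.  Under \<open>Z \<mapsto> Ztilde Z\<close> and \<open>\<iota> \<mapsto> w\<^sub>2(\<iota>)\<close>
  one of them is fixed, because \<open>w\<^sub>2\<close> preserves the quotient \<open>\<iota>\<^sub>k / \<iota>\<^sub>j\<close>, and the other two are exchanged,
  because it maps \<open>\<iota>\<^sub>j\<iota>\<^sub>k\<close> to the inverse of the product of the other two \<open>\<iota>\<close>'s and
  \<open>Z\<^sub>OZ\<^sub>BZ\<^sub>G = \<iota>\<^sub>1\<iota>\<^sub>2\<iota>\<^sub>3\<iota>\<^sub>\<infinity>\<close>.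

  For every triangulation of the hexagon, flipping a chord mutates the quiver, and flipping the dual
  spine gives the dual spine of the flipped triangulation, by a quarter turn of one edge.  What
  this needs about the hexagon is a finite check over its 14 triangulations.\<close>

text \<open>The pentagon comes from the cluster type A_2: the first four mutations reverse the
  quiver, \<beta> and \<gamma> are then joined by a single arrow, and five alternating mutations at
  such a pair restore the seed with the two vertices exchanged. Exchanging two vertices of an
  oriented triangle reverses it again. Values and definedness must be tracked together, since x / 0
  = 0. Every quantity tested along the word is, up to monomials, a product or quotient of the
  factors 1 + Z_c and of the three polynomials of \<open>Ztilde_domain\<close>; hence nothing
  vanishes for indeterminates. Three labellings follow by cyclic symmetry, the other three by
  inverting the seed. Flips given by set comprehensions, apexes given by \<open>THE\<close> and
  faces given as orbits cannot be evaluated. The geometry is therefore mirrored by pairs of numbers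
  and lists of triangles, and \<open>set_triangles\<close> ties the two together. Triangles depend
  only on the set of chords, so each check runs on uncoloured shapes and serves all six
  colourings.\<close>

lemma UNIV_colour: "(UNIV :: colour set) = {Orange, Blue, Green}"
  using colour.exhaust by auto


section \<open>Monodromy data in the chart\<close>

definition mat2 :: "'a \<Rightarrow> 'a \<Rightarrow> 'a \<Rightarrow> 'a \<Rightarrow> 'a::zero^2^2" where
  "mat2 a b c d = vector [vector [a, b], vector [c, d]]"

lemma mat2_nth [simp]: "mat2 a b c d $ 1 $ 1 = a" "mat2 a b c d $ 1 $ 2 = b"
  "mat2 a b c d $ 2 $ 1 = c" "mat2 a b c d $ 2 $ 2 = d"
  by (simp_all add: mat2_def)

lemma mat2_eta: "mat2 (A $ 1 $ 1) (A $ 1 $ 2) (A $ 2 $ 1) (A $ 2 $ 2) = A"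
  by (simp add: vec_eq_iff forall_2)

lemma mat2_mult: "mat2 a b c d ** mat2 a' b' c' d' =
    (mat2 (a * a' + b * c') (a * b' + b * d') (c * a' + d * c') (c * b' + d * d') :: 'a::semiring_1^2^2)"
  by (simp add: vec_eq_iff forall_2 matrix_matrix_mult_def sum_2)

lemma trace_mat2: "trace (mat2 a b c d) = (a + d :: 'a::semiring_1)"
  by (simp add: trace_def sum_2)

lemma det_mat2: "det (mat2 a b c d) = (a * d - b * c :: 'a::comm_ring_1)"
  by (simp add: det_2)

lemma mat_mat2: "mat x = mat2 x 0 0 (x :: 'a::semiring_1)"
  by (simp add: vec_eq_iff forall_2 mat_def)

lemma matrix_inv_mat2:
  fixes a :: "'a::field"
  assumes "a * d - b * c = 1"
  shows "matrix_inv (mat2 a b c d) = mat2 d (- b) (- c) a"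
  unfolding matrix_inv_def
proof (rule some_equality)
  have "mat2 a b c d ** mat2 d (- b) (- c) a = mat 1" "mat2 d (- b) (- c) a ** mat2 a b c d = mat 1"
    using assms by (simp_all add: mat2_mult mat_mat2 algebra_simps)
  then show inv: "mat2 a b c d ** mat2 d (- b) (- c) a = mat 1 \<and> mat2 d (- b) (- c) a ** mat2 a b c d = mat 1"
    by blast
  fix B assume "mat2 a b c d ** B = mat 1 \<and> B ** mat2 a b c d = mat 1"
  with inv show "B = mat2 d (- b) (- c) a"
    by (metis matrix_mul_assoc matrix_mul_lid matrix_mul_rid)
qed

text \<open>In determinant one the inverse is the adjugate, which exchanges the diagonal entries.
  This transfers trace and determinant of M_1 M_2 M_3 to M_\<infinity>.\<close>

lemma trace_matrix_inv_SL2: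
  fixes A :: "'a::field^2^2"
  assumes "det A = 1"
  shows "trace (matrix_inv A) = trace A" "det (matrix_inv A) = 1" "A ** matrix_inv A = mat 1"
proof -
  obtain a b c d where A: "A = mat2 a b c d" by (metis mat2_eta)
  with assms have det: "a * d - b * c = 1" by (simp add: det_mat2)
  show "trace (matrix_inv A) = trace A" "det (matrix_inv A) = 1" "A ** matrix_inv A = mat 1"
    using det unfolding A matrix_inv_mat2[OF det]
    by (simp_all add: trace_mat2 det_mat2 mat2_mult mat_mat2 algebra_simps)
qed

text \<open>The characteristic polynomial l^2 - (i + 1/i) l + 1 factors as (l - i)(l - 1/i). As only
  the set of roots is claimed, i = 1 and i = -1 are no exceptions.\<close>

lemma eigenvalues_SL2:
  assumes "det A = 1" "trace A = i + 1 / i" "i \<noteq> 0"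
  shows "eigenvalues A = {i, inverse i}"
proof -
  obtain a b c d where A: "A = mat2 a b c d" by (metis mat2_eta)
  with assms have det: "a * d - b * c = 1" and tr: "a + d = i + 1 / i"
    by (simp_all add: det_mat2 trace_mat2)
  have "l \<in> eigenvalues A \<longleftrightarrow> det (A - mat l) = 0" for l
  proof -
    have "A *v v = l *s v \<longleftrightarrow> (A - mat l) *v v = 0" for v
      by (auto simp: vec_eq_iff mat_def matrix_vector_mult_def sum_2 forall_2 algebra_simps)
    then have "l \<in> eigenvalues A \<longleftrightarrow> \<not> (\<forall>v. (A - mat l) *v v = 0 \<longrightarrow> v = 0)"
      by (auto simp: eigenvalues_def)
    also have "\<dots> \<longleftrightarrow> det (A - mat l) = 0"
      using matrix_left_invertible_ker[of "A - mat l"] invertible_left_inverse[of "A - mat l"]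
        invertible_det_nz[of "A - mat l"] by blast
    finally show ?thesis .
  qed
  moreover have "det (A - mat l) = (l - i) * (l - inverse i)" for l
  proof -
    have "A - mat l = mat2 (a - l) b c (d - l)"
      by (simp add: A mat_mat2 vec_eq_iff forall_2)
    then have "det (A - mat l) = (a * d - b * c) - (a + d) * l + l * l"
      by (simp add: det_mat2 algebra_simps)
    also have "\<dots> = (l - i) * (l - inverse i)"
      unfolding det tr using assms(3) by (simp add: field_simps)
    finally show ?thesis .
  qed
  ultimately show ?thesis by auto
qed

section \<open>Determinants and traces of the coordinatized matrices\<close>

context
  fixes \<iota> :: "puncture \<Rightarrow> complex" and Z :: "colour \<Rightarrow> complex"
  assumes \<iota>: "\<And>k. \<iota> k \<noteq> 0" and Z: "\<And>c. Z c \<noteq> 0"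
begin

lemmas chart_mat2 = chart1_def[folded mat2_def] chart2_def[folded mat2_def] chart3_def[folded mat2_def]

lemma det_chart: "det (chart1 \<iota> Z) = 1" "det (chart2 \<iota> Z) = 1" "det (chart3 \<iota> Z) = 1"
  by (simp_all add: chart_mat2 det_mat2 \<iota> Z field_simps)

lemma trace_chart: "trace (chart1 \<iota> Z) = \<iota> P1 + 1 / \<iota> P1" "trace (chart2 \<iota> Z) = \<iota> P2 + 1 / \<iota> P2"
  "trace (chart3 \<iota> Z) = \<iota> P3 + 1 / \<iota> P3"
  by (simp_all add: chart_mat2 trace_mat2)

text \<open>The grouping by monomials in \<iota> makes the three coefficients match the left-hand
  sides of \<open>Ztilde_identities\<close>. The other two traces are its cyclic shifts along
  Orange, Blue, Green.\<close>

lemma trace_chart_12: "trace (chart1 \<iota> Z ** chart2 \<iota> Z) =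
   - (\<iota> P2 / \<iota> P1 * ((1 + Z Orange + Z Orange * Z Blue) / Z Blue) + Z Orange * (1 + Z Blue) / (\<iota> P1 * \<iota> P2)
      + \<iota> P1 * \<iota> P2 * ((1 + Z Orange) / (Z Orange * Z Blue)))"
  by (simp add: chart_mat2 mat2_mult trace_mat2 \<iota> Z field_simps)

lemma trace_chart_23: "trace (chart2 \<iota> Z ** chart3 \<iota> Z) =
   - (\<iota> P3 / \<iota> P2 * ((1 + Z Blue + Z Blue * Z Green) / Z Green) + Z Blue * (1 + Z Green) / (\<iota> P2 * \<iota> P3)
      + \<iota> P2 * \<iota> P3 * ((1 + Z Blue) / (Z Blue * Z Green)))"
  by (simp add: chart_mat2 mat2_mult trace_mat2 \<iota> Z field_simps)

lemma trace_chart_13: "trace (chart1 \<iota> Z ** chart3 \<iota> Z) =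
   - (\<iota> P1 / \<iota> P3 * ((1 + Z Green + Z Orange * Z Green) / Z Orange) + Z Green * (1 + Z Orange) / (\<iota> P1 * \<iota> P3)
      + \<iota> P1 * \<iota> P3 * ((1 + Z Green) / (Z Orange * Z Green)))"
  by (simp add: chart_mat2 mat2_mult trace_mat2 \<iota> Z field_simps)

text \<open>On \<open>coord_torus\<close> this is \<iota>_\<infinity> + 1/\<iota>_\<infinity>; here
  the equation defining the torus enters.\<close>

lemma trace_chart_123: "trace (chart1 \<iota> Z ** chart2 \<iota> Z ** chart3 \<iota> Z) =
    Z Orange * Z Blue * Z Green / (\<iota> P1 * \<iota> P2 * \<iota> P3) + \<iota> P1 * \<iota> P2 * \<iota> P3 / (Z Orange * Z Blue * Z Green)"
  by (simp add: chart_mat2 mat2_mult trace_mat2 \<iota> Z field_simps)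

end

lemma iota_nz: "iota \<theta> k \<noteq> 0"
  by (simp add: iota_def)

lemma chart_in_rep_space:
  assumes \<iota>: "\<And>k. \<iota> k \<noteq> 0" and Z: "Z \<in> coord_torus \<iota>"
  shows "chart \<iota> Z \<in> rep_space \<iota>" and "trace (chart \<iota> Z k) = \<iota> k + 1 / \<iota> k"
proof -
  have nz: "Z c \<noteq> 0" for c using Z by (simp add: coord_torus_def)
  have prod: "Z Orange * Z Blue * Z Green = \<iota> P1 * \<iota> P2 * \<iota> P3 * \<iota> Pinf"
    using Z by (simp add: coord_torus_def)
  let ?M = "chart1 \<iota> Z ** chart2 \<iota> Z ** chart3 \<iota> Z"
  note dets = det_chart[of \<iota> Z, OF \<iota> nz] and traces = trace_chart[of \<iota> Z, OF \<iota> nz]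
  have M: "det ?M = 1" by (simp add: det_mul dets)
  have "trace ?M = \<iota> Pinf + 1 / \<iota> Pinf"
    unfolding trace_chart_123[of \<iota> Z, OF \<iota> nz] prod using \<iota> by simp
  then have trace: "trace (chart \<iota> Z k) = \<iota> k + 1 / \<iota> k" for k
    using trace_matrix_inv_SL2(1)[OF M] by (cases k) (simp_all add: traces)
  then show "trace (chart \<iota> Z k) = \<iota> k + 1 / \<iota> k" .
  have det: "det (chart \<iota> Z k) = 1" for k
    using trace_matrix_inv_SL2(2)[OF M] by (cases k) (simp_all add: dets)
  moreover have "chart \<iota> Z P1 ** chart \<iota> Z P2 ** chart \<iota> Z P3 ** chart \<iota> Z Pinf = mat 1"
    using trace_matrix_inv_SL2(3)[OF M] by simp
  ultimately show "chart \<iota> Z \<in> rep_space \<iota>"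
    unfolding rep_space_def using eigenvalues_SL2[OF det trace \<iota>] by simp
qed

text \<open>Each coordinate can be read off one off-diagonal entry. Injectivity makes the
  \<open>inv_into\<close> in \<open>entrywise_action\<close> recover the coordinates.\<close>

lemma inj_on_chart:
  assumes "\<And>k. \<iota> k \<noteq> 0"
  shows "inj_on (chart \<iota>) (coord_torus \<iota>)"
proof (rule inj_onI)
  fix Z Z' assume Z: "Z \<in> coord_torus \<iota>" "Z' \<in> coord_torus \<iota>" and eq: "chart \<iota> Z = chart \<iota> Z'"
  have nz: "Z c \<noteq> 0" "Z' c \<noteq> 0" for c using Z by (simp_all add: coord_torus_def)
  have "chart1 \<iota> Z $ 1 $ 2 = chart1 \<iota> Z' $ 1 $ 2" "chart2 \<iota> Z $ 2 $ 1 = chart2 \<iota> Z' $ 2 $ 1"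
    "chart3 \<iota> Z $ 1 $ 2 = chart3 \<iota> Z' $ 1 $ 2"
    using fun_cong[OF eq, of P1] fun_cong[OF eq, of P2] fun_cong[OF eq, of P3] by simp_all
  then have "Z Orange = Z' Orange" "Z Blue = Z' Blue" "Z Green = Z' Green"
    using assms nz by (simp_all add: chart1_def chart2_def chart3_def frac_eq_eq)
  then show "Z = Z'" by (metis (full_types) colour.exhaust ext)
qed

text \<open>The half-sums in \<open>w\<^sub>2\<close> become products of the square roots \<open>e k\<close> of \<open>\<iota>\<^sub>k\<close>.\<close>

lemma iota_w2:
  fixes \<theta> :: "puncture \<Rightarrow> complex"
  defines "e \<equiv> \<lambda>k. exp (complex_of_real pi * \<i> * \<theta> k / 2)"
  shows "iota \<theta> k = e k * e k"
    "iota (w2 \<theta>) P1 = e P1 / (e P2 * e P3 * e Pinf)" "iota (w2 \<theta>) P2 = e P2 / (e P1 * e P3 * e Pinf)"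
    "iota (w2 \<theta>) P3 = e P3 / (e P1 * e P2 * e Pinf)" "iota (w2 \<theta>) Pinf = e Pinf / (e P1 * e P2 * e P3)"
  unfolding iota_def e_def exp_add[symmetric] exp_diff[symmetric]
  by (auto intro!: arg_cong[where f = exp] simp: field_simps)

lemma iota_w2_relations:
  "iota (w2 \<theta>) P1 * iota (w2 \<theta>) P2 * iota (w2 \<theta>) P3 * iota (w2 \<theta>) Pinf
     = inverse (iota \<theta> P1 * iota \<theta> P2 * iota \<theta> P3 * iota \<theta> Pinf)"
  "iota (w2 \<theta>) P1 * iota (w2 \<theta>) P2 = 1 / (iota \<theta> P3 * iota \<theta> Pinf)"
  "iota (w2 \<theta>) P2 * iota (w2 \<theta>) P3 = 1 / (iota \<theta> P1 * iota \<theta> Pinf)"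
  "iota (w2 \<theta>) P1 * iota (w2 \<theta>) P3 = 1 / (iota \<theta> P2 * iota \<theta> Pinf)"
  "iota (w2 \<theta>) P2 / iota (w2 \<theta>) P1 = iota \<theta> P2 / iota \<theta> P1"
  "iota (w2 \<theta>) P3 / iota (w2 \<theta>) P2 = iota \<theta> P3 / iota \<theta> P2"
  "iota (w2 \<theta>) P1 / iota (w2 \<theta>) P3 = iota \<theta> P1 / iota \<theta> P3"
  unfolding iota_w2[of \<theta>] by (simp_all add: field_simps)

text \<open>How the three coefficients of one trace transform. Stated for free x, y, z so that its
  cyclic shifts cover all three traces.\<close>

lemma Ztilde_identities:
  fixes x y z :: "'a::field"
  assumes nz: "x \<noteq> 0" "y \<noteq> 0" "z \<noteq> 0" "1 + x + x * y \<noteq> 0" "1 + y + y * z \<noteq> 0" "1 + z + x * z \<noteq> 0"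
  defines "x' \<equiv> (1 + x + x * y) / (y * (1 + z + x * z))" and "y' \<equiv> (1 + y + y * z) / (z * (1 + x + x * y))"
  shows "x' * (1 + y') = (1 + y) / (y * z)" "(1 + x') / (x' * y') = (1 + x) * z"
    "(1 + x' + x' * y') / y' = (1 + x + x * y) / y"
proof -
  \<comment> \<open>Both sums factor into pieces already present in x' and y', so the first two
    identities become cancellations; the third follows from 1 + x' + x'y' = 1 + x'(1 + y').\<close>
  have y1: "1 + y' = (1 + y) * (1 + z + x * z) / (z * (1 + x + x * y))"
    and x1: "1 + x' = (1 + x) * (1 + y + y * z) / (y * (1 + z + x * z))"
    unfolding x'_def y'_def using nz
    by (simp_all add: add_divide_eq_iff divide_add_eq_iff) (simp_all add: algebra_simps)
  show 1: "x' * (1 + y') = (1 + y) / (y * z)"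
    unfolding y1 x'_def using nz by simp
  show "(1 + x') / (x' * y') = (1 + x) * z"
    unfolding x1 unfolding x'_def y'_def using nz by simp
  have "1 + x' + x' * y' = 1 + x' * (1 + y')" by (simp add: algebra_simps)
  also have "\<dots> = (1 + y + y * z) / (y * z)"
    unfolding 1 using nz by (simp add: add_divide_eq_iff)
  finally show "(1 + x' + x' * y') / y' = (1 + x + x * y) / y"
    unfolding y'_def using nz by simp
qed

text \<open>The three polynomials occur once as numerator and once as denominator, so the product of
  the coordinates is inverted, just as \<open>w2\<close> inverts the product of the four
  \<iota>'s.\<close>

lemma Ztilde_in_coord_torus:
  assumes "Z \<in> coord_torus (iota \<theta>)" "Z \<in> Ztilde_domain"
  shows "Ztilde Z \<in> coord_torus (iota (w2 \<theta>))"
proof -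
  have nz: "Z c \<noteq> 0" "1 + Z Orange + Z Orange * Z Blue \<noteq> 0" "1 + Z Blue + Z Blue * Z Green \<noteq> 0"
    "1 + Z Green + Z Orange * Z Green \<noteq> 0" for c
    using assms(2) by (simp_all add: Ztilde_domain_def)
  have cancel: "p / (y * r) * (q / (z * p)) * (r / (x * q)) = inverse (x * y * z)"
    if "p \<noteq> 0" "q \<noteq> 0" "r \<noteq> 0" for p q r x y z :: complex
    using that by (simp add: divide_simps)
  have "Ztilde Z c \<noteq> 0" for c using nz by (cases c) simp_all
  moreover have "Ztilde Z Orange * Ztilde Z Blue * Ztilde Z Green = inverse (Z Orange * Z Blue * Z Green)"
    unfolding Ztilde.simps by (rule cancel) (use nz in simp_all)
  ultimately show ?thesis
    using assms(1) unfolding coord_torus_def iota_w2_relations(1)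
    by (simp del: Ztilde.simps inverse_mult_distrib)
qed

text \<open>The exchange of two terms: after substituting kl = xyz/(ij), the first term on the left
  is the first on the right, and likewise for the second.\<close>

lemma trace_identity:
  fixes i j k l x y z :: complex
  assumes "i \<noteq> 0" "j \<noteq> 0" "k \<noteq> 0" "l \<noteq> 0" "x * y * z = i * j * k * l"
  shows "(1 + y) / (y * z) / (1 / (k * l)) + 1 / (k * l) * ((1 + x) * z)
       = x * (1 + y) / (i * j) + i * j * ((1 + x) / (x * y))"
proof -
  have nz: "x \<noteq> 0" "y \<noteq> 0" "z \<noteq> 0" using assms by auto
  have kl: "k * l = x * y * z / (i * j)" using assms by (simp add: field_simps)
  show ?thesis unfolding kl using nz assms(1,2) by (simp add: field_simps)
qed

text \<open>One computation performed for the cyclic shifts (O, B, G), (B, G, O) and (G, O, B); the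
  product relation is reordered to fit each of them.\<close>

lemma traces_preserved:
  assumes Z: "Z \<in> coord_torus (iota \<theta>)" "Z \<in> Ztilde_domain"
  defines "N \<equiv> chart (iota (w2 \<theta>)) (Ztilde Z)" and "M \<equiv> chart (iota \<theta>) Z"
  shows "trace (N P1 ** N P2) = trace (M P1 ** M P2)" "trace (N P2 ** N P3) = trace (M P2 ** M P3)"
    "trace (N P1 ** N P3) = trace (M P1 ** M P3)"
proof -
  have nz: "Z c \<noteq> 0" "1 + Z Orange + Z Orange * Z Blue \<noteq> 0" "1 + Z Blue + Z Blue * Z Green \<noteq> 0"
    "1 + Z Green + Z Orange * Z Green \<noteq> 0" for c
    using Z(2) by (simp_all add: Ztilde_domain_def)
  have prod: "Z Orange * Z Blue * Z Green = iota \<theta> P1 * iota \<theta> P2 * iota \<theta> P3 * iota \<theta> Pinf"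
    using Z(1) by (simp add: coord_torus_def)
  have nz': "Ztilde Z c \<noteq> 0" for c
    using Ztilde_in_coord_torus[OF Z] by (simp add: coord_torus_def)
  let ?O = "Z Orange" and ?B = "Z Blue" and ?G = "Z Green"
  have id12: "Ztilde Z Orange * (1 + Ztilde Z Blue) = (1 + ?B) / (?B * ?G)"
      "(1 + Ztilde Z Orange) / (Ztilde Z Orange * Ztilde Z Blue) = (1 + ?O) * ?G"
      "(1 + Ztilde Z Orange + Ztilde Z Orange * Ztilde Z Blue) / Ztilde Z Blue = (1 + ?O + ?O * ?B) / ?B"
    using Ztilde_identities[of ?O ?B ?G] nz by simp_all
  have id23: "Ztilde Z Blue * (1 + Ztilde Z Green) = (1 + ?G) / (?G * ?O)"
      "(1 + Ztilde Z Blue) / (Ztilde Z Blue * Ztilde Z Green) = (1 + ?B) * ?O"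
      "(1 + Ztilde Z Blue + Ztilde Z Blue * Ztilde Z Green) / Ztilde Z Green = (1 + ?B + ?B * ?G) / ?G"
    using Ztilde_identities[of ?B ?G ?O] nz by (simp_all add: mult.commute)
  have id31: "Ztilde Z Green * (1 + Ztilde Z Orange) = (1 + ?O) / (?O * ?B)"
      "(1 + Ztilde Z Green) / (Ztilde Z Orange * Ztilde Z Green) = (1 + ?G) * ?B"
      "(1 + Ztilde Z Green + Ztilde Z Orange * Ztilde Z Green) / Ztilde Z Orange = (1 + ?G + ?O * ?G) / ?O"
    using Ztilde_identities[of ?G ?O ?B] nz by (simp_all add: mult.commute)
  note rel = iota_w2_relations[of \<theta>]
  show "trace (N P1 ** N P2) = trace (M P1 ** M P2)"
    unfolding N_def M_def chart.simps trace_chart_12[of "iota (w2 \<theta>)", OF iota_nz nz'] trace_chart_12[of "iota \<theta>", OF iota_nz nz(1)]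
      id12 rel(2) rel(5)
    using trace_identity[OF iota_nz iota_nz iota_nz iota_nz prod] by (simp only: add.assoc)
  have prod': "?B * ?G * ?O = iota \<theta> P2 * iota \<theta> P3 * iota \<theta> P1 * iota \<theta> Pinf"
    using prod by (simp add: mult_ac)
  show "trace (N P2 ** N P3) = trace (M P2 ** M P3)"
    unfolding N_def M_def chart.simps trace_chart_23[of "iota (w2 \<theta>)", OF iota_nz nz'] trace_chart_23[of "iota \<theta>", OF iota_nz nz(1)]
      id23 rel(3) rel(6)
    using trace_identity[OF iota_nz iota_nz iota_nz iota_nz prod'] by (simp only: add.assoc)
  have prod'': "?G * ?O * ?B = iota \<theta> P1 * iota \<theta> P3 * iota \<theta> P2 * iota \<theta> Pinf"
    using prod by (simp add: mult_ac)
  show "trace (N P1 ** N P3) = trace (M P1 ** M P3)"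
    unfolding N_def M_def chart.simps trace_chart_13[of "iota (w2 \<theta>)", OF iota_nz nz'] trace_chart_13[of "iota \<theta>", OF iota_nz nz(1)]
      id31 rel(4) rel(7)
    using trace_identity[OF iota_nz iota_nz iota_nz iota_nz prod''] by (simp only: add.assoc mult.commute[of ?O ?G])
qed

text \<open>The product a_1 a_4 consists of \<iota>_1\<iota>_4, its inverse and two quotients.
  \<open>w2\<close> keeps the quotients and trades the pair \<iota>_1\<iota>_4 and its inverse for
  \<iota>_2\<iota>_3 and its inverse, which belong to a_2 a_3; so their sum is fixed. The other two
  sums behave alike, and the last datum follows by expansion.\<close>

lemma omega_w2:
  assumes M: "\<And>k. trace (M k) = iota \<theta> k + 1 / iota \<theta> k"
    and N: "\<And>k. trace (N k) = iota (w2 \<theta>) k + 1 / iota (w2 \<theta>) k"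
  shows "omega N l = omega M l"
proof -
  define e where "e k = exp (complex_of_real pi * \<i> * \<theta> k / 2)" for k
  have e: "e k \<noteq> 0" for k by (simp add: e_def)
  note iotas = iota_w2[of \<theta>, folded e_def]
  define u where "u k = e k * e k" for k
  have u: "u k \<noteq> 0" for k by (simp add: u_def e)
  have p14: "trace (N P1) * trace (N Pinf) = u P2 * u P3 + 1 / (u P2 * u P3) + u P1 / u Pinf + u Pinf / u P1"
    unfolding N iotas u_def using e by (simp add: field_simps)
  have p23: "trace (N P2) * trace (N P3) = u P1 * u Pinf + 1 / (u P1 * u Pinf) + u P2 / u P3 + u P3 / u P2"
    unfolding N iotas u_def using e by (simp add: field_simps)
  have p24: "trace (N P2) * trace (N Pinf) = u P1 * u P3 + 1 / (u P1 * u P3) + u P2 / u Pinf + u Pinf / u P2"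
    unfolding N iotas u_def using e by (simp add: field_simps)
  have p13: "trace (N P1) * trace (N P3) = u P2 * u Pinf + 1 / (u P2 * u Pinf) + u P1 / u P3 + u P3 / u P1"
    unfolding N iotas u_def using e by (simp add: field_simps)
  have p34: "trace (N P3) * trace (N Pinf) = u P1 * u P2 + 1 / (u P1 * u P2) + u P3 / u Pinf + u Pinf / u P3"
    unfolding N iotas u_def using e by (simp add: field_simps)
  have p12: "trace (N P1) * trace (N P2) = u P3 * u Pinf + 1 / (u P3 * u Pinf) + u P1 / u P2 + u P2 / u P1"
    unfolding N iotas u_def using e by (simp add: field_simps)
  have q: "(trace (N P1))\<^sup>2 = u P1 / (u P2 * u P3 * u Pinf) + u P2 * u P3 * u Pinf / u P1 + 2"
    "(trace (N P2))\<^sup>2 = u P2 / (u P1 * u P3 * u Pinf) + u P1 * u P3 * u Pinf / u P2 + 2"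
    "(trace (N P3))\<^sup>2 = u P3 / (u P1 * u P2 * u Pinf) + u P1 * u P2 * u Pinf / u P3 + 2"
    "(trace (N Pinf))\<^sup>2 = u Pinf / (u P1 * u P2 * u P3) + u P1 * u P2 * u P3 / u Pinf + 2"
    unfolding N iotas u_def using e by (simp_all add: field_simps power2_eq_square)
  have M': "trace (M k) = u k + 1 / u k" for k unfolding M iotas u_def ..
  \<comment> \<open>A single trace of \<open>N\<close> involves the square roots \<open>e\<close>,
    but a product of two involves only \<open>u\<close>; hence the fourfold product is grouped in
    pairs.\<close>
  have "trace (N P1) * trace (N P2) * trace (N P3) * trace (N Pinf) = (trace (N P1) * trace (N Pinf)) * (trace (N P2) * trace (N P3))"
    by (simp add: mult_ac)
  note p1234 = this[unfolded p14 p23]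
  show ?thesis
  proof (cases l)
    case P1
    show ?thesis unfolding P1 omega.simps p14 p23 M' using u by (simp add: field_simps)
  next
    case P2
    show ?thesis unfolding P2 omega.simps p24 p13 M' using u by (simp add: field_simps)
  next
    case P3
    show ?thesis unfolding P3 omega.simps p34 p12 M' using u by (simp add: field_simps)
  next
    case Pinf
    show ?thesis unfolding Pinf omega.simps p1234 q M' using u by (simp add: field_simps power2_eq_square)
  qed
qed

text \<open>Gives "rational map" its content: the points where the lift is defined are dense in the
  chart.\<close>

lemma coord_torus_dense: "coord_torus \<iota> \<subseteq> closure (coord_torus \<iota> \<inter> Ztilde_domain)"
proof
  fix Z assume Z: "Z \<in> coord_torus \<iota>"
  define K where "K = Z Orange * Z Blue * Z Green"
  have nz: "Z c \<noteq> 0" for c using Z by (simp add: coord_torus_def)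
  then have K: "K \<noteq> 0" "Z Green = K / (Z Orange * Z Blue)" by (simp_all add: K_def)
  txt \<open>Only \<open>Z\<^sub>O\<close> is moved, and \<open>Z\<^sub>G\<close> with it; each of the three polynomials then vanishes for at
    most one value of \<open>Z\<^sub>O\<close>.\<close>
  define W where "W t = case_colour t (Z Blue) (K / (t * Z Blue))" for t
  have "W (Z Orange) c = Z c" for c by (cases c) (simp_all add: W_def K)
  then have W0: "W (Z Orange) = Z" by blast
  have "continuous_on (- {0}) W"
  proof (rule continuous_on_coordinatewise_then_product)
    show "continuous_on (- {0}) (\<lambda>t. W t c)" for c
      using nz by (cases c) (auto simp: W_def intro!: continuous_on_divide continuous_on_mult continuous_on_id continuous_on_const)
  qed
  then have "isCont W (Z Orange)"
    using nz[of Orange] by (simp add: continuous_on_eq_continuous_at open_Compl)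
  then have lim: "(W \<longlongrightarrow> Z) (at (Z Orange))"
    by (simp add: isCont_def W0)
  have away: "\<forall>\<^sub>F t in at (Z Orange). t \<noteq> a" for a by (rule eventually_neq_at_within)
  \<comment> \<open>The value 0 is the pole of \<open>W\<close>, the others are the roots in t of
    the three polynomials. If a denominator here vanishes, the quotient is 0 by convention and the
    corresponding polynomial has no root t \<noteq> 0.\<close>
  have "\<forall>\<^sub>F t in at (Z Orange). W t \<in> coord_torus \<iota> \<inter> Ztilde_domain"
    using away[of 0] away[of "- 1 / (1 + Z Blue)"] away[of "- K / (1 + Z Blue)"] away[of "- K / (Z Blue + K)"]
  proof eventually_elim
    case (elim t)
    have 1: "1 + t + t * Z Blue \<noteq> 0"
    proof
      assume "1 + t + t * Z Blue = 0"
      then have eq: "t * (1 + Z Blue) = - 1" by (simp add: algebra_simps add_eq_0_iff)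
      then have "1 + Z Blue \<noteq> 0" by auto
      then have "t = - 1 / (1 + Z Blue)" using eq by (simp add: field_simps)
      with elim(2) show False by blast
    qed
    have 2: "1 + Z Blue + Z Blue * (K / (t * Z Blue)) \<noteq> 0"
    proof
      assume "1 + Z Blue + Z Blue * (K / (t * Z Blue)) = 0"
      then have eq: "t * (1 + Z Blue) = - K" using nz elim(1) by (simp add: field_simps add_eq_0_iff)
      then have "1 + Z Blue \<noteq> 0" using K(1) by auto
      then have "t = - K / (1 + Z Blue)" using eq by (simp add: field_simps)
      with elim(3) show False by blast
    qed
    have 3: "1 + K / (t * Z Blue) + t * (K / (t * Z Blue)) \<noteq> 0"
    proof
      assume "1 + K / (t * Z Blue) + t * (K / (t * Z Blue)) = 0"
      then have eq: "t * (Z Blue + K) = - K" using nz elim(1) by (simp add: field_simps add_eq_0_iff)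
      then have "Z Blue + K \<noteq> 0" using K(1) by auto
      then have "t = - K / (Z Blue + K)" using eq by (simp add: field_simps)
      with elim(4) show False by blast
    qed
    have "W t \<in> Ztilde_domain \<longleftrightarrow> (\<forall>c. W t c \<noteq> 0)"
      using 1 2 3 by (simp only: Ztilde_domain_def mem_Collect_eq W_def colour.case) blast
    moreover have "W t c \<noteq> 0" for c using elim(1) nz K(1) by (cases c) (simp_all add: W_def)
    moreover have "W t Orange * W t Blue * W t Green = K" using elim(1) nz by (simp add: W_def)
    ultimately show ?case
      using Z by (simp add: coord_torus_def K_def)
  qed
  then have "\<forall>\<^sub>F t in at (Z Orange). W t \<in> closure (coord_torus \<iota> \<inter> Ztilde_domain)"
    by (rule eventually_mono) (rule subsetD[OF closure_subset])
  from Lim_in_closed_set[OF closed_closure this _ lim]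
  show "Z \<in> closure (coord_torus \<iota> \<inter> Ztilde_domain)" by simp
qed


section \<open>Cluster mutations\<close>

text \<open>For pairwise distinct \<open>\<alpha>\<close>, \<open>\<beta>\<close>, \<open>\<gamma>\<close>: the numbers \<open>p\<close>, \<open>q\<close>, \<open>r\<close> count the arrows
  \<open>\<alpha> \<rightarrow> \<beta>\<close>, \<open>\<beta> \<rightarrow> \<gamma>\<close>, \<open>\<gamma> \<rightarrow> \<alpha>\<close>.\<close>

definition seed_values ::
  "colour \<Rightarrow> colour \<Rightarrow> colour \<Rightarrow> int \<Rightarrow> int \<Rightarrow> int \<Rightarrow> 'a::field \<Rightarrow> 'a \<Rightarrow> 'a \<Rightarrow> 'a seed \<Rightarrow> bool" where
  "seed_values \<alpha> \<beta> \<gamma> p q r a b c s \<longleftrightarrow>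
     fst s \<alpha> \<beta> = p \<and> fst s \<beta> \<alpha> = - p \<and> fst s \<beta> \<gamma> = q \<and> fst s \<gamma> \<beta> = - q
     \<and> fst s \<gamma> \<alpha> = r \<and> fst s \<alpha> \<gamma> = - r \<and> snd s \<alpha> = a \<and> snd s \<beta> = b \<and> snd s \<gamma> = c"

text \<open>The multiplier of X_i under mutation at k, with e = \<epsilon> i k and x = X_k. Only e =
  -1, 0, 1 occur along the word.\<close>

definition factor :: "int \<Rightarrow> 'a::field \<Rightarrow> 'a" where
  "factor e x = (1 + x powi (- sgn e)) powi (- e)"

lemma factor_0 [simp]: "factor 0 x = 1"
  by (simp add: factor_def)

lemma factor_minus_1 [simp]: "factor (- 1) x = 1 + x"
  by (simp add: factor_def)

lemma factor_1: "x \<noteq> 0 \<Longrightarrow> 1 + x \<noteq> 0 \<Longrightarrow> factor 1 x = x / (1 + x)"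
  by (simp add: factor_def power_int_minus field_simps)

text \<open>Allows mutation to be computed at the first listed colour only.\<close>

lemma seed_values_rotate: "seed_values \<alpha> \<beta> \<gamma> p q r a b c s \<longleftrightarrow> seed_values \<beta> \<gamma> \<alpha> q r p b c a s"
  by (auto simp: seed_values_def)

text \<open>The two products of maxima count the paths \<beta> \<rightarrow> \<alpha> \<rightarrow>
  \<gamma> and \<gamma> \<rightarrow> \<alpha> \<rightarrow> \<beta>; the arguments - p and r of
  \<open>factor\<close> are the arrow numbers into \<alpha>.\<close>

lemma seed_values_mutate:
  assumes "seed_values \<alpha> \<beta> \<gamma> p q r a b c s" "\<alpha> \<noteq> \<beta>" "\<beta> \<noteq> \<gamma>" "\<gamma> \<noteq> \<alpha>"
  shows "seed_values \<alpha> \<beta> \<gamma> (- p) (q + max 0 (- p) * max 0 (- r) - max 0 r * max 0 p) (- r)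
     (inverse a) (b * factor (- p) a) (c * factor r a) (mutate \<alpha> s)"
  using assms by (auto simp: seed_values_def mutate_def mutate_quiver_def mutate_coords_def factor_def)

text \<open>For a \<noteq> 0 the conditions 1 + a \<noteq> 0 and 1 + 1/a \<noteq> 0 agree, so the
  direction of an arrow at \<alpha> does not matter as long as there is one.\<close>

lemma mutations_defined_Cons:
  assumes "seed_values \<alpha> \<beta> \<gamma> p q r a b c (foldr mutate w s)" "\<alpha> \<noteq> \<beta>" "\<beta> \<noteq> \<gamma>" "\<gamma> \<noteq> \<alpha>"
    "p \<in> {0, 1, -1}" "r \<in> {0, 1, -1}" "p \<noteq> 0 \<or> r \<noteq> 0" "{\<alpha>, \<beta>, \<gamma>} = (UNIV :: colour set)"
  shows "mutations_defined (\<alpha> # w) s \<longleftrightarrow> mutations_defined w s \<and> a \<noteq> 0 \<and> 1 + a \<noteq> 0"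
proof -
  let ?\<epsilon> = "fst (foldr mutate w s)"
  have inv: "1 + a \<noteq> 0 \<longleftrightarrow> 1 + inverse a \<noteq> 0" if "a \<noteq> 0"
    using that by (simp add: field_simps add_eq_0_iff)
  have "(\<forall>i. i \<noteq> \<alpha> \<and> ?\<epsilon> i \<alpha> \<noteq> 0 \<longrightarrow> 1 + a powi (- sgn (?\<epsilon> i \<alpha>)) \<noteq> 0)
     \<longleftrightarrow> (\<forall>i\<in>{\<alpha>, \<beta>, \<gamma>}. i \<noteq> \<alpha> \<and> ?\<epsilon> i \<alpha> \<noteq> 0 \<longrightarrow> 1 + a powi (- sgn (?\<epsilon> i \<alpha>)) \<noteq> 0)"
    unfolding assms(8) by simp
  also have "\<dots> \<longleftrightarrow> 1 + a \<noteq> 0" if "a \<noteq> 0"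
    using assms(1-7) inv[OF that] by (auto simp: seed_values_def power_int_minus)
  finally show ?thesis
    using assms(1) by (auto simp: Let_def seed_values_def)
qed

text \<open>The quiver leaves the oriented triangle, passes through three linear quivers of type
  A_3, and returns to the triangle with the opposite orientation.\<close>

lemma cycle_mutations:
  assumes seed: "seed_values \<alpha> \<beta> \<gamma> (- 1) (- 1) (- 1) a b c s"
    and distinct: "\<alpha> \<noteq> \<beta>" "\<beta> \<noteq> \<gamma>" "\<gamma> \<noteq> \<alpha>" and labelling: "{\<alpha>, \<beta>, \<gamma>} = UNIV"
    and nz: "a \<noteq> 0" "b \<noteq> 0" "c \<noteq> 0" "1 + a \<noteq> 0"
      "1 + a + a * b \<noteq> 0" "1 + b + b * c \<noteq> 0" "1 + c + a * c \<noteq> 0"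
  shows "seed_values \<alpha> \<beta> \<gamma> 1 1 1 ((1 + a + a * b) / (b * (1 + c + a * c)))
      ((1 + c + a * c) / (a * (1 + b + b * c))) ((1 + b + b * c) / (c * (1 + a + a * b)))
      (foldr mutate [\<alpha>, \<gamma>, \<beta>, \<alpha>] s)"
    and "mutations_defined [\<alpha>, \<gamma>, \<beta>, \<alpha>] s"
proof -
  note rot = seed_values_rotate[THEN iffD1]
  have labellings: "{\<beta>, \<gamma>, \<alpha>} = UNIV" "{\<gamma>, \<alpha>, \<beta>} = UNIV" using labelling by auto
  have f1: "factor 1 a = a / (1 + a)" using nz by (simp add: factor_1)
  define s1 where "s1 = mutate \<alpha> s"
  define b1 where "b1 = a * b / (1 + a)"
  have "seed_values \<alpha> \<beta> \<gamma> 1 0 1 (1 / a) b1 (c * (1 + a)) s1"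
    using seed_values_mutate[OF seed distinct] by (simp add: s1_def b1_def f1 inverse_eq_divide mult.commute)
  then have seed1: "seed_values \<beta> \<gamma> \<alpha> 0 1 1 b1 (c * (1 + a)) (1 / a) s1" by (rule rot)
  \<comment> \<open>The sums 1 + b1, 1 + c(1 + a) and 1 + a3 bring in the three polynomials one
    after another; the factors 1 + a cancel by the end.\<close>
  have b1: "b1 \<noteq> 0" "1 + b1 = (1 + a + a * b) / (1 + a)" using nz by (simp_all add: b1_def field_simps)
  then have b1': "1 + b1 \<noteq> 0" using nz by simp
  define s2 where "s2 = mutate \<beta> s1"
  have "1 / a * factor 1 b1 = b / (1 + a + a * b)"
    unfolding factor_1[OF b1(1) b1'] unfolding b1(2) using nz by (simp add: b1_def)
  moreover have "inverse b1 = (1 + a) / (a * b)" by (simp add: b1_def)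
  ultimately have "seed_values \<beta> \<gamma> \<alpha> 0 1 (- 1) ((1 + a) / (a * b)) (c * (1 + a)) (b / (1 + a + a * b)) s2"
    using seed_values_mutate[OF seed1 distinct(2,3,1)] by (simp add: s2_def)
  then have seed2: "seed_values \<gamma> \<alpha> \<beta> 1 (- 1) 0 (c * (1 + a)) (b / (1 + a + a * b)) ((1 + a) / (a * b)) s2"
    by (rule rot)
  define s3 where "s3 = mutate \<gamma> s2"
  define a3 where "a3 = b * (1 + c + a * c) / (1 + a + a * b)"
  have c3: "1 + c * (1 + a) \<noteq> 0" "1 + c * (1 + a) = 1 + c + a * c" using nz by (simp_all add: algebra_simps)
  have "seed_values \<gamma> \<alpha> \<beta> (- 1) (- 1) 0 (1 / (c * (1 + a))) a3 ((1 + a) / (a * b)) s3"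
    using seed_values_mutate[OF seed2 distinct(3,1,2)]
    unfolding s3_def a3_def c3(2)[symmetric] by (simp add: inverse_eq_divide)
  then have seed3: "seed_values \<alpha> \<beta> \<gamma> (- 1) 0 (- 1) a3 ((1 + a) / (a * b)) (1 / (c * (1 + a))) s3"
    by (rule rot)
  have a3: "a3 \<noteq> 0" "1 + a3 = (1 + a) * (1 + b + b * c) / (1 + a + a * b)"
    using nz by (simp add: a3_def, simp add: a3_def add_divide_eq_iff divide_add_eq_iff algebra_simps)
  then have a3': "1 + a3 \<noteq> 0" using nz by simp
  have "(1 + a) / (a * b) * factor 1 a3 = (1 + c + a * c) / (a * (1 + b + b * c))"
    unfolding factor_1[OF a3(1) a3'] unfolding a3(2) using nz by (simp add: a3_def)
  moreover have "1 / (c * (1 + a)) * (1 + a3) = (1 + b + b * c) / (c * (1 + a + a * b))"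
    unfolding a3(2) using nz by simp
  moreover have "inverse a3 = (1 + a + a * b) / (b * (1 + c + a * c))" by (simp add: a3_def)
  ultimately show "seed_values \<alpha> \<beta> \<gamma> 1 1 1 ((1 + a + a * b) / (b * (1 + c + a * c)))
      ((1 + c + a * c) / (a * (1 + b + b * c))) ((1 + b + b * c) / (c * (1 + a + a * b)))
      (foldr mutate [\<alpha>, \<gamma>, \<beta>, \<alpha>] s)"
    using seed_values_mutate[OF seed3 distinct] by (simp add: s1_def s2_def s3_def)
  show "mutations_defined [\<alpha>, \<gamma>, \<beta>, \<alpha>] s"
    using mutations_defined_Cons[OF _ distinct _ _ _ labelling, of _ _ _ _ _ _ "[]" s] seed
      mutations_defined_Cons[OF _ distinct(2,3,1) _ _ _ labellings(1), of _ _ _ _ _ _ "[\<alpha>]" s] seed1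
      mutations_defined_Cons[OF _ distinct(3,1,2) _ _ _ labellings(2), of _ _ _ _ _ _ "[\<beta>, \<alpha>]" s] seed2
      mutations_defined_Cons[OF _ distinct _ _ _ labelling, of _ _ _ _ _ _ "[\<gamma>, \<beta>, \<alpha>]" s] seed3
      nz b1(1) b1' c3 a3(1) a3'
    by (simp add: s1_def s2_def s3_def del: mutations_defined.simps(2))
qed

text \<open>The five coordinates mutated in turn are x, y(1 + x), (1 + y + xy)/x, (1 + y)/(xy) and
  1/y. Adding 1 to each yields only the factors 1 + x, 1 + y and 1 + y + xy up to monomials, whence
  the three conditions.\<close>

lemma pentagon_mutations:
  assumes seed: "seed_values \<alpha> \<beta> \<gamma> 1 1 1 a x y s"
    and distinct: "\<alpha> \<noteq> \<beta>" "\<beta> \<noteq> \<gamma>" "\<gamma> \<noteq> \<alpha>" and labelling: "{\<alpha>, \<beta>, \<gamma>} = UNIV"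
    and nz: "x \<noteq> 0" "y \<noteq> 0"
  shows "mutations_defined [\<beta>, \<gamma>, \<beta>, \<gamma>, \<beta>] s \<longleftrightarrow> 1 + x \<noteq> 0 \<and> 1 + y \<noteq> 0 \<and> 1 + y + x * y \<noteq> 0" (is "?def \<longleftrightarrow> ?nz")
    and "1 + x \<noteq> 0 \<Longrightarrow> 1 + y \<noteq> 0 \<Longrightarrow> 1 + y + x * y \<noteq> 0 \<Longrightarrow> seed_values \<alpha> \<beta> \<gamma> (- 1) (- 1) (- 1) a y x (foldr mutate [\<beta>, \<gamma>, \<beta>, \<gamma>, \<beta>] s)"
proof -
  note rot = seed_values_rotate[THEN iffD1]
  have labellings: "{\<beta>, \<gamma>, \<alpha>} = UNIV" "{\<gamma>, \<alpha>, \<beta>} = UNIV" using labelling by auto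
  note mutate_\<beta> = seed_values_mutate[OF _ distinct(2,3,1)] and mutate_\<gamma> = seed_values_mutate[OF _ distinct(3,1,2)]
  note defined_\<beta> = mutations_defined_Cons[OF _ distinct(2,3,1) _ _ _ labellings(1)]
    and defined_\<gamma> = mutations_defined_Cons[OF _ distinct(3,1,2) _ _ _ labellings(2)]
  have seed0: "seed_values \<beta> \<gamma> \<alpha> 1 1 1 x y a s" using seed by (rule rot)
  have D1: "mutations_defined [\<beta>] s \<longleftrightarrow> 1 + x \<noteq> 0"
    using defined_\<beta>[of _ _ _ _ _ _ "[]" s] seed0 nz by (simp del: mutations_defined.simps(2))
  \<comment> \<open>The value after a mutation is meaningful only if that mutation was defined, so
    the conditions are peeled off one at a time, each under the previous ones.\<close>
  have main: "(?def \<longleftrightarrow> 1 + y \<noteq> 0 \<and> 1 + y + x * y \<noteq> 0) \<and>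
      (1 + y \<noteq> 0 \<longrightarrow> 1 + y + x * y \<noteq> 0 \<longrightarrow>
        seed_values \<alpha> \<beta> \<gamma> (- 1) (- 1) (- 1) a y x (foldr mutate [\<beta>, \<gamma>, \<beta>, \<gamma>, \<beta>] s))"
    if x: "1 + x \<noteq> 0"
  proof -
    define s1 where "s1 = mutate \<beta> s"
    define y1 where "y1 = y * (1 + x)"
    have seed1: "seed_values \<gamma> \<alpha> \<beta> 0 (- 1) (- 1) y1 (a * (x / (1 + x))) (1 / x) s1"
      using rot[OF mutate_\<beta>[OF seed0]] factor_1[OF nz(1) x] by (simp add: s1_def y1_def inverse_eq_divide)
    have y1: "y1 \<noteq> 0" "1 + y1 = 1 + y + x * y" using nz x by (simp add: y1_def, simp add: y1_def algebra_simps)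
    have D2: "mutations_defined [\<gamma>, \<beta>] s \<longleftrightarrow> 1 + y + x * y \<noteq> 0"
      unfolding y1(2)[symmetric]
      using defined_\<gamma>[of _ _ _ _ _ _ "[\<beta>]" s] seed1 y1(1) D1 x by (simp add: s1_def del: mutations_defined.simps(2))
    define s2 where "s2 = mutate \<gamma> s1"
    define x2 where "x2 = (1 + y + x * y) / x"
    have seed2: "seed_values \<beta> \<gamma> \<alpha> 1 0 (- 1) x2 (1 / y1) (a * (x / (1 + x))) s2"
      using rot[OF rot[OF mutate_\<gamma>[OF seed1]]] unfolding s2_def x2_def y1(2)[symmetric]
      by (simp add: inverse_eq_divide)
    have x2: "1 + x2 = (1 + x) * (1 + y) / x"
      using nz by (simp add: x2_def add_divide_eq_iff divide_add_eq_iff algebra_simps)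
    have main: "(?def \<longleftrightarrow> 1 + y \<noteq> 0) \<and>
        (1 + y \<noteq> 0 \<longrightarrow> seed_values \<alpha> \<beta> \<gamma> (- 1) (- 1) (- 1) a y x (foldr mutate [\<beta>, \<gamma>, \<beta>, \<gamma>, \<beta>] s))"
      if xy: "1 + y + x * y \<noteq> 0"
    proof -
      have "x2 \<noteq> 0" using xy nz by (simp add: x2_def)
      have "1 + x2 \<noteq> 0 \<longleftrightarrow> 1 + y \<noteq> 0" unfolding x2 using x nz by simp
      then have D3: "mutations_defined [\<beta>, \<gamma>, \<beta>] s \<longleftrightarrow> 1 + y \<noteq> 0"
        using defined_\<beta>[of _ _ _ _ _ _ "[\<gamma>, \<beta>]" s] seed2 \<open>x2 \<noteq> 0\<close> D2 xy
        by (simp add: s1_def s2_def del: mutations_defined.simps(2))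
      define s3 where "s3 = mutate \<beta> s2"
      define y3 where "y3 = (1 + y) / (x * y)"
      have "1 / y1 * (1 + x2) = y3" "a * (x / (1 + x)) * (1 + x2) = a * (1 + y)"
        unfolding x2 y1_def y3_def using nz x by (simp_all add: mult.commute)
      then have seed3: "seed_values \<gamma> \<alpha> \<beta> 0 1 (- 1) y3 (a * (1 + y)) (inverse x2) s3"
        using rot[OF mutate_\<beta>[OF seed2]] by (simp add: s3_def)
      have y3: "1 + y3 = (1 + y + x * y) / (x * y)"
        using nz by (simp add: y3_def add_divide_eq_iff divide_add_eq_iff algebra_simps)
      define s4 where "s4 = mutate \<gamma> s3"
      have "inverse x2 * (1 + y3) = 1 / y"
        unfolding x2_def y3 using nz xy by simp
      then have seed4: "seed_values \<beta> \<gamma> \<alpha> 1 0 1 (1 / y) (inverse y3) (a * (1 + y)) s4"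
        using rot[OF rot[OF mutate_\<gamma>[OF seed3]]] by (simp add: s4_def)
      have D5: "mutations_defined [\<beta>, \<gamma>, \<beta>, \<gamma>, \<beta>] s \<and>
          seed_values \<alpha> \<beta> \<gamma> (- 1) (- 1) (- 1) a y x (foldr mutate [\<beta>, \<gamma>, \<beta>, \<gamma>, \<beta>] s)" if y: "1 + y \<noteq> 0"
      proof -
        have nz': "y3 \<noteq> 0" "1 + y3 \<noteq> 0" "1 / y \<noteq> 0" "1 + 1 / y = (1 + y) / y" "1 + 1 / y \<noteq> 0"
          unfolding y3 using nz xy y by (simp_all add: y3_def add_divide_eq_iff divide_add_eq_iff add.commute)
        have "mutations_defined [\<gamma>, \<beta>, \<gamma>, \<beta>] s"
          using defined_\<gamma>[of _ _ _ _ _ _ "[\<beta>, \<gamma>, \<beta>]" s] seed3 D3 y nz'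
          by (simp add: s1_def s2_def s3_def del: mutations_defined.simps(2))
        then have "mutations_defined [\<beta>, \<gamma>, \<beta>, \<gamma>, \<beta>] s"
          using defined_\<beta>[of _ _ _ _ _ _ "[\<gamma>, \<beta>, \<gamma>, \<beta>]" s] seed4 nz'
          by (simp add: s1_def s2_def s3_def s4_def del: mutations_defined.simps(2))
        moreover have vals: "inverse y3 * (1 + 1 / y) = x" "a * (1 + y) * factor 1 (1 / y) = a"
          unfolding factor_1[OF nz'(3,5)] unfolding nz'(4) y3_def using nz y by simp_all
        have "seed_values \<beta> \<gamma> \<alpha> (- 1) (- 1) (- 1) y x a (mutate \<beta> s4)"
          using mutate_\<beta>[OF seed4] unfolding factor_minus_1 vals by simp
        then have "seed_values \<alpha> \<beta> \<gamma> (- 1) (- 1) (- 1) a y x (mutate \<beta> s4)"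
          by (rule rot[OF rot])
        ultimately show ?thesis by (simp add: s1_def s2_def s3_def s4_def)
      qed
      have "?def \<Longrightarrow> mutations_defined [\<beta>, \<gamma>, \<beta>] s" by simp
      with D3 D5 show ?thesis by blast
    qed
    have "?def \<Longrightarrow> mutations_defined [\<gamma>, \<beta>] s" by simp
    with D2 main show ?thesis by blast
  qed
  have "?def \<Longrightarrow> mutations_defined [\<beta>] s" by simp
  with D1 main show "?def \<longleftrightarrow> ?nz" by blast
  show "1 + x \<noteq> 0 \<Longrightarrow> 1 + y \<noteq> 0 \<Longrightarrow> 1 + y + x * y \<noteq> 0 \<Longrightarrow> seed_values \<alpha> \<beta> \<gamma> (- 1) (- 1) (- 1) a y x (foldr mutate [\<beta>, \<gamma>, \<beta>, \<gamma>, \<beta>] s)"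
    using main by blast
qed

text \<open>Reversing all arrows and inverting all coordinates commutes with mutation; this reduces the
  labellings of the opposite orientation to those covered above.\<close>

definition dual_seed :: "'a::field seed \<Rightarrow> 'a seed" where
  "dual_seed s = (\<lambda>i j. - fst s i j, \<lambda>i. inverse (snd s i))"

definition antisymmetric :: "'a seed \<Rightarrow> bool" where
  "antisymmetric s \<longleftrightarrow> (\<forall>i j. fst s i j = - fst s j i)"

lemma antisymmetric_mutate:
  assumes "antisymmetric s"
  shows "antisymmetric (mutate k s)"
  unfolding antisymmetric_def
proof (intro allI)
  fix i j
  have "fst s i j = - fst s j i" using assms unfolding antisymmetric_def by blast
  then show "fst (mutate k s) i j = - fst (mutate k s) j i"
    by (simp add: mutate_def mutate_quiver_def)
qed

lemma antisymmetric_foldr_mutate: "antisymmetric s \<Longrightarrow> antisymmetric (foldr mutate w s)"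
  by (induction w) (simp_all add: antisymmetric_mutate)

text \<open>Inverting X_k and reversing \<epsilon> cancel inside the base of the power, while the
  sign of the outer exponent changes. Antisymmetry turns the path counts of the reversed quiver into
  each other.\<close>

lemma mutate_dual_seed:
  assumes "antisymmetric s"
  shows "mutate k (dual_seed s) = dual_seed (mutate k s)"
proof -
  have anti: "- fst s i j = fst s j i" for i j
    using assms unfolding antisymmetric_def by metis
  have "mutate_quiver k (fst (dual_seed s)) i j = - mutate_quiver k (fst s) i j" for i j
    by (simp add: mutate_quiver_def dual_seed_def anti)
  moreover have "mutate_coords k (fst (dual_seed s)) (snd (dual_seed s)) i = inverse (mutate_coords k (fst s) (snd s) i)" for i
    by (simp add: mutate_coords_def dual_seed_def power_int_minus power_int_inverse)
  ultimately show ?thesis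
    by (simp add: mutate_def dual_seed_def fun_eq_iff)
qed

lemma foldr_mutate_dual_seed: "antisymmetric s \<Longrightarrow> foldr mutate w (dual_seed s) = dual_seed (foldr mutate w s)"
  by (induction w) (simp_all add: mutate_dual_seed antisymmetric_foldr_mutate)

lemma mutations_defined_dual_seed:
  assumes "antisymmetric s"
  shows "mutations_defined w (dual_seed s) \<longleftrightarrow> mutations_defined w s"
proof (induction w)
  case (Cons k w)
  then show ?case
    by (simp add: foldr_mutate_dual_seed assms Let_def) (simp add: dual_seed_def power_int_minus power_int_inverse)
qed simp

lemma mutations_defined_append:
  "mutations_defined (u @ w) s \<longleftrightarrow> mutations_defined w s \<and> mutations_defined u (foldr mutate w s)"
  by (induction u) (auto simp: Let_def)

lemma w2_word_append: "w2_word \<alpha> \<beta> \<gamma> = [\<beta>, \<gamma>, \<beta>, \<gamma>, \<beta>] @ [\<alpha>, \<gamma>, \<beta>, \<alpha>]"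
  by (simp add: w2_word_def)

text \<open>The first four mutations need 1 + a \<noteq> 0. On their output the pentagon conditions
  factor into 1 + c, 1 + b and polynomials already nonzero, which makes the final condition
  symmetric in the colours.\<close>

lemma w2_word_mutations:
  assumes seed: "seed_values \<alpha> \<beta> \<gamma> (- 1) (- 1) (- 1) a b c s"
    and labelling: "{\<alpha>, \<beta>, \<gamma>} = UNIV" "\<alpha> \<noteq> \<beta>" "\<beta> \<noteq> \<gamma>" "\<gamma> \<noteq> \<alpha>"
    and nz: "a \<noteq> 0" "b \<noteq> 0" "c \<noteq> 0" "1 + a + a * b \<noteq> 0" "1 + b + b * c \<noteq> 0" "1 + c + a * c \<noteq> 0"
  shows "mutations_defined (w2_word \<alpha> \<beta> \<gamma>) s \<longleftrightarrow> 1 + a \<noteq> 0 \<and> 1 + b \<noteq> 0 \<and> 1 + c \<noteq> 0"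
    and "mutations_defined (w2_word \<alpha> \<beta> \<gamma>) s \<Longrightarrow> seed_values \<alpha> \<beta> \<gamma> (- 1) (- 1) (- 1)
      ((1 + a + a * b) / (b * (1 + c + a * c))) ((1 + b + b * c) / (c * (1 + a + a * b)))
      ((1 + c + a * c) / (a * (1 + b + b * c))) (foldr mutate (w2_word \<alpha> \<beta> \<gamma>) s)"
proof -
  let ?x = "(1 + c + a * c) / (a * (1 + b + b * c))" and ?y = "(1 + b + b * c) / (c * (1 + a + a * b))"
  let ?s = "foldr mutate [\<alpha>, \<gamma>, \<beta>, \<alpha>] s"
  have xy: "?x \<noteq> 0" "?y \<noteq> 0" using nz by simp_all
  have x1: "1 + ?x = (1 + c) * (1 + a + a * b) / (a * (1 + b + b * c))"
    and y1: "1 + ?y = (1 + b) * (1 + c + a * c) / (c * (1 + a + a * b))"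
    using nz by (simp_all add: add_divide_eq_iff divide_add_eq_iff) (simp_all add: algebra_simps)
  have "?x * ?y = (1 + c + a * c) / (a * c * (1 + a + a * b))"
    using nz by simp
  then have "1 + ?y + ?x * ?y = (1 + c + a * c) / (a * c)"
    unfolding y1 using nz by (simp add: frac_eq_eq add_frac_eq) (simp add: algebra_simps)
  with nz have xy1: "1 + ?y + ?x * ?y \<noteq> 0" by simp
  \<comment> \<open>The first mutation performed already forces 1 + a \<noteq> 0, which
    \<open>cycle_mutations\<close> presupposes.\<close>
  have first: "1 + a \<noteq> 0" if "mutations_defined (w2_word \<alpha> \<beta> \<gamma>) s"
  proof -
    from that have "mutations_defined [\<alpha>] s" by (simp add: w2_word_def)
    then show ?thesis
      using mutations_defined_Cons[OF _ labelling(2-4) _ _ _ labelling(1), of _ _ _ _ _ _ "[]" s] seed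
      by (simp del: mutations_defined.simps(2))
  qed
  have main: "(mutations_defined (w2_word \<alpha> \<beta> \<gamma>) s \<longleftrightarrow> 1 + b \<noteq> 0 \<and> 1 + c \<noteq> 0)
     \<and> (mutations_defined (w2_word \<alpha> \<beta> \<gamma>) s \<longrightarrow> seed_values \<alpha> \<beta> \<gamma> (- 1) (- 1) (- 1)
      ((1 + a + a * b) / (b * (1 + c + a * c))) ?y ?x (foldr mutate (w2_word \<alpha> \<beta> \<gamma>) s))"
    if a: "1 + a \<noteq> 0"
  proof -
    note cycle = cycle_mutations[OF seed labelling(2-4,1) nz(1-3) a nz(4-6)]
    note pentagon = pentagon_mutations[OF cycle(1) labelling(2-4,1) xy]
    have "1 + ?x \<noteq> 0 \<longleftrightarrow> 1 + c \<noteq> 0" "1 + ?y \<noteq> 0 \<longleftrightarrow> 1 + b \<noteq> 0"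
      unfolding x1 y1 using nz by simp_all
    with pentagon cycle(2) xy1 show ?thesis
      unfolding w2_word_append mutations_defined_append foldr_append comp_apply by blast
  qed
  with first show "mutations_defined (w2_word \<alpha> \<beta> \<gamma>) s \<longleftrightarrow> 1 + a \<noteq> 0 \<and> 1 + b \<noteq> 0 \<and> 1 + c \<noteq> 0"
    and "mutations_defined (w2_word \<alpha> \<beta> \<gamma>) s \<Longrightarrow> seed_values \<alpha> \<beta> \<gamma> (- 1) (- 1) (- 1)
      ((1 + a + a * b) / (b * (1 + c + a * c))) ((1 + b + b * c) / (c * (1 + a + a * b)))
      ((1 + c + a * c) / (a * (1 + b + b * c))) (foldr mutate (w2_word \<alpha> \<beta> \<gamma>) s)"
    by blast+
qed

lemma w2_word_mutations_dual:
  assumes seed: "seed_values \<alpha> \<beta> \<gamma> 1 1 1 p q r s" and anti: "antisymmetric s"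
    and labelling: "{\<alpha>, \<beta>, \<gamma>} = UNIV" "\<alpha> \<noteq> \<beta>" "\<beta> \<noteq> \<gamma>" "\<gamma> \<noteq> \<alpha>"
    and nz: "p \<noteq> 0" "q \<noteq> 0" "r \<noteq> 0" "1 + q + p * q \<noteq> 0" "1 + r + q * r \<noteq> 0" "1 + p + p * r \<noteq> 0"
  shows "mutations_defined (w2_word \<alpha> \<beta> \<gamma>) s \<longleftrightarrow> 1 + p \<noteq> 0 \<and> 1 + q \<noteq> 0 \<and> 1 + r \<noteq> 0"
    and "mutations_defined (w2_word \<alpha> \<beta> \<gamma>) s \<Longrightarrow> seed_values \<alpha> \<beta> \<gamma> 1 1 1
      ((1 + p + p * r) / (r * (1 + q + p * q))) ((1 + q + p * q) / (p * (1 + r + q * r)))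
      ((1 + r + q * r) / (q * (1 + p + p * r))) (foldr mutate (w2_word \<alpha> \<beta> \<gamma>) s)"
proof -
  have seed': "seed_values \<alpha> \<beta> \<gamma> (- 1) (- 1) (- 1) (inverse p) (inverse q) (inverse r) (dual_seed s)"
    using seed by (simp add: seed_values_def dual_seed_def)
  \<comment> \<open>Inverting the variables turns the three polynomials into those of the opposite
    cyclic order, up to monomials.\<close>
  have inv: "1 + inverse p + inverse p * inverse q = (1 + q + p * q) / (p * q)"
    "1 + inverse q + inverse q * inverse r = (1 + r + q * r) / (q * r)"
    "1 + inverse r + inverse p * inverse r = (1 + p + p * r) / (p * r)"
    using nz by (simp_all add: field_simps)
  have inv': "1 + inverse p = (1 + p) / p" "1 + inverse q = (1 + q) / q" "1 + inverse r = (1 + r) / r"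
    using nz by (simp_all add: field_simps)
  have inv_nz: "inverse p \<noteq> 0" "inverse q \<noteq> 0" "inverse r \<noteq> 0" using nz by simp_all
  have inv_nz': "1 + inverse p + inverse p * inverse q \<noteq> 0"
    "1 + inverse q + inverse q * inverse r \<noteq> 0" "1 + inverse r + inverse p * inverse r \<noteq> 0"
    unfolding inv using nz by simp_all
  note word = w2_word_mutations[OF seed' labelling inv_nz inv_nz', unfolded inv
      mutations_defined_dual_seed[OF anti] foldr_mutate_dual_seed[OF anti]]
  show "mutations_defined (w2_word \<alpha> \<beta> \<gamma>) s \<longleftrightarrow> 1 + p \<noteq> 0 \<and> 1 + q \<noteq> 0 \<and> 1 + r \<noteq> 0"
    unfolding word(1) inv' using nz by simp
  show "seed_values \<alpha> \<beta> \<gamma> 1 1 1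
      ((1 + p + p * r) / (r * (1 + q + p * q))) ((1 + q + p * q) / (p * (1 + r + q * r)))
      ((1 + r + q * r) / (q * (1 + p + p * r))) (foldr mutate (w2_word \<alpha> \<beta> \<gamma>) s)"
    if "mutations_defined (w2_word \<alpha> \<beta> \<gamma>) s"
  proof -
    have vals: "(1 + q + p * q) / (p * q) / (inverse q * ((1 + p + p * r) / (p * r)))
        = inverse ((1 + p + p * r) / (r * (1 + q + p * q)))"
      "(1 + r + q * r) / (q * r) / (inverse r * ((1 + q + p * q) / (p * q)))
        = inverse ((1 + q + p * q) / (p * (1 + r + q * r)))"
      "(1 + p + p * r) / (p * r) / (inverse p * ((1 + r + q * r) / (q * r)))
        = inverse ((1 + r + q * r) / (q * (1 + p + p * r)))"
      using nz by (simp_all add: divide_simps)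
    show ?thesis
      using word(2)[OF that, unfolded vals]
      by (simp only: seed_values_def dual_seed_def fst_conv snd_conv inverse_eq_iff_eq neg_equal_iff_equal)
  qed
qed

lemma antisymmetric_initial: "antisymmetric (initial_quiver, X)"
  by (simp add: antisymmetric_def initial_quiver_def)

text \<open>\<open>Ztilde_domain\<close> over an arbitrary field, so that one computation serves
  complex points and indeterminates alike.\<close>

definition generic_point :: "(colour \<Rightarrow> 'a::field) \<Rightarrow> bool" where
  "generic_point X \<longleftrightarrow> (\<forall>c. X c \<noteq> 0) \<and> 1 + X Orange + X Orange * X Blue \<noteq> 0
     \<and> 1 + X Blue + X Blue * X Green \<noteq> 0 \<and> 1 + X Green + X Orange * X Green \<noteq> 0"

lemma w2_mutations:
  fixes X :: "colour \<Rightarrow> 'a::field"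
  assumes labelling: "{\<alpha>, \<beta>, \<gamma>} = (UNIV :: colour set)" and generic: "generic_point X"
  shows "mutations_defined (w2_word \<alpha> \<beta> \<gamma>) (initial_quiver, X) \<longleftrightarrow> (\<forall>c. 1 + X c \<noteq> 0)"
    and "mutations_defined (w2_word \<alpha> \<beta> \<gamma>) (initial_quiver, X) \<Longrightarrow>
      snd (foldr mutate (w2_word \<alpha> \<beta> \<gamma>) (initial_quiver, X)) = Ztilde X"
proof -
  let ?s = "(initial_quiver, X)"
  have all: "(\<forall>c. P c) \<longleftrightarrow> P Orange \<and> P Blue \<and> P Green" for P
    by (metis colour.exhaust)
  note nz = generic[unfolded generic_point_def all]
  have distinct: "\<alpha> \<noteq> \<beta>" "\<beta> \<noteq> \<gamma>" "\<gamma> \<noteq> \<alpha>"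
    using labelling unfolding UNIV_colour by (cases \<alpha>; cases \<beta>; cases \<gamma>; auto)+
  have quiver: "initial_quiver Blue Orange = 1" "initial_quiver Orange Blue = - 1"
    "initial_quiver Orange Green = 1" "initial_quiver Green Orange = - 1"
    "initial_quiver Green Blue = 1" "initial_quiver Blue Green = - 1"
    by (simp_all add: initial_quiver_def initial_arrows_def)
  \<comment> \<open>The first three labellings give the initial quiver the arrows \<gamma>
    \<rightarrow> \<beta> \<rightarrow> \<alpha> \<rightarrow> \<gamma>; the other three reverse
    them.\<close>
  consider "(\<alpha>, \<beta>, \<gamma>) \<in> {(Orange, Blue, Green), (Blue, Green, Orange), (Green, Orange, Blue)}"
    | "(\<alpha>, \<beta>, \<gamma>) \<in> {(Orange, Green, Blue), (Green, Blue, Orange), (Blue, Orange, Green)}"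
    using distinct by (cases \<alpha>; cases \<beta>; cases \<gamma>) auto
  then have "(mutations_defined (w2_word \<alpha> \<beta> \<gamma>) ?s \<longleftrightarrow> (\<forall>c. 1 + X c \<noteq> 0))
    \<and> (mutations_defined (w2_word \<alpha> \<beta> \<gamma>) ?s \<longrightarrow> snd (foldr mutate (w2_word \<alpha> \<beta> \<gamma>) ?s) = Ztilde X)"
  proof cases
    case 1
    then have "seed_values \<alpha> \<beta> \<gamma> (- 1) (- 1) (- 1) (X \<alpha>) (X \<beta>) (X \<gamma>) ?s"
      by (auto simp: seed_values_def quiver)
    note word = w2_word_mutations[OF this labelling distinct]
    from 1 show ?thesis
      using word nz by (elim insertE emptyE)
        (simp_all add: seed_values_def all fun_eq_iff mult.commute conj_comms add.commute)
  next
    case 2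
    then have "seed_values \<alpha> \<beta> \<gamma> 1 1 1 (X \<alpha>) (X \<beta>) (X \<gamma>) ?s"
      by (auto simp: seed_values_def quiver)
    note word = w2_word_mutations_dual[OF this antisymmetric_initial labelling distinct]
    from 2 show ?thesis
      using word nz by (elim insertE emptyE)
        (simp_all add: seed_values_def all fun_eq_iff mult.commute conj_comms add.commute)
  qed
  then show "mutations_defined (w2_word \<alpha> \<beta> \<gamma>) (initial_quiver, X) \<longleftrightarrow> (\<forall>c. 1 + X c \<noteq> 0)"
    and "mutations_defined (w2_word \<alpha> \<beta> \<gamma>) (initial_quiver, X) \<Longrightarrow>
      snd (foldr mutate (w2_word \<alpha> \<beta> \<gamma>) (initial_quiver, X)) = Ztilde X"
    by blast+
qed

text \<open>All expressions are images of polynomials under the injective \<open>to_fract\<close>,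
  so it suffices that these polynomials are nonzero.\<close>

lemma indet_generic: "generic_point indet" "1 + indet c \<noteq> 0"
proof -
  show "1 + indet c \<noteq> 0"
    by (cases c) (simp_all add: one_pCons flip: to_fract_1 to_fract_add to_fract_0)
  have "indet c \<noteq> 0" for c by (cases c) simp_all
  then show "generic_point indet"
    unfolding generic_point_def
    by (simp add: one_pCons flip: to_fract_1 to_fract_add to_fract_mult)
qed


section \<open>Triangulations of the hexagon\<close>

type_synonym chord = "nat \<times> nat"

definition ends :: "chord \<Rightarrow> nat set" where
  "ends d = {fst d, snd d}"

text \<open>Only the counterclockwise directions are listed, since these have the hexagon on their
  left; a chord is used in both directions.\<close>

definition sides :: "chord list" where
  "sides = [(1, 2), (2, 3), (3, 4), (4, 5), (5, 6), (6, 1)]"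

definition adjacent :: "chord list \<Rightarrow> nat \<Rightarrow> nat \<Rightarrow> bool" where
  "adjacent ds u v \<longleftrightarrow> (u, v) \<in> set (sides @ ds) \<or> (v, u) \<in> set (sides @ ds)"

definition rotations :: "nat \<times> nat \<times> nat \<Rightarrow> (nat \<times> nat \<times> nat) list" where
  "rotations = (\<lambda>(u, v, w). [(u, v, w), (v, w, u), (w, u, v)])"

definition increasing_triples :: "(nat \<times> nat \<times> nat) list" where
  "increasing_triples =
    [(1, 2, 3), (1, 2, 4), (1, 2, 5), (1, 2, 6), (1, 3, 4), (1, 3, 5), (1, 3, 6), (1, 4, 5),
     (1, 4, 6), (1, 5, 6), (2, 3, 4), (2, 3, 5), (2, 3, 6), (2, 4, 5), (2, 4, 6), (2, 5, 6),
     (3, 4, 5), (3, 4, 6), (3, 5, 6), (4, 5, 6)]"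

text \<open>Every triangle is listed from all three starting points, so that each of its sides,
  directed with the triangle on the left, is an initial pair.\<close>

definition triangles :: "chord list \<Rightarrow> (nat \<times> nat \<times> nat) list" where
  "triangles ds = concat (map rotations
     (filter (\<lambda>(u, v, w). adjacent ds u v \<and> adjacent ds v w \<and> adjacent ds w u) increasing_triples))"

text \<open>The 14 triangulations of the hexagon.\<close>

definition shapes :: "chord list list" where
  "shapes =
    [[(2, 4), (4, 6), (2, 6)], [(1, 3), (3, 5), (1, 5)],
     [(1, 3), (1, 4), (1, 5)], [(2, 4), (2, 5), (2, 6)], [(1, 3), (3, 5), (3, 6)],
     [(2, 4), (4, 6), (1, 4)], [(3, 5), (1, 5), (2, 5)], [(4, 6), (2, 6), (3, 6)],
     [(1, 3), (1, 4), (4, 6)], [(2, 4), (2, 5), (1, 5)], [(3, 5), (3, 6), (2, 6)],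
     [(2, 4), (1, 4), (1, 5)], [(3, 5), (2, 5), (2, 6)], [(4, 6), (3, 6), (1, 3)]]"

definition all_shapes :: "(chord list \<Rightarrow> (nat \<times> nat \<times> nat) list \<Rightarrow> bool) \<Rightarrow> bool" where
  "all_shapes P \<longleftrightarrow> list_all (\<lambda>ds. P ds (triangles ds)) shapes"

lemma hexverts_set: "hexverts = {1, 2, 3, 4, 5, 6}"
  by (auto simp: hexverts_def)

lemma set_sides: "(u, v) \<in> set sides \<longleftrightarrow> u \<in> hexverts \<and> v = hexsucc u"
  by (auto simp: sides_def hexverts_set hexsucc_def)

lemma in_hexsides: "{u, v} \<in> hexsides \<longleftrightarrow> (u, v) \<in> set sides \<or> (v, u) \<in> set sides"
  unfolding hexsides_def set_sides by (auto simp: doubleton_eq_iff)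

lemma in_ends: "{u, v} \<in> ends ` set ds \<longleftrightarrow> (u, v) \<in> set ds \<or> (v, u) \<in> set ds"
  by (force simp: ends_def image_iff doubleton_eq_iff)

lemma ccw_distinct: "ccw u v w \<Longrightarrow> u \<noteq> v \<and> v \<noteq> w \<and> w \<noteq> u"
  by (auto simp: ccw_def)

lemma adjacent_iff:
  assumes "range T = ends ` set ds"
  shows "adjacent ds u v \<longleftrightarrow> {u, v} \<in> hexsides \<union> range T"
  unfolding assms adjacent_def by (auto simp: in_ends in_hexsides)

lemma increasing_triplesI:
  assumes "u < v" "v < w" "{u, v, w} \<subseteq> hexverts"
  shows "(u, v, w) \<in> set increasing_triples"
proof -
  have "u \<in> {1, 2, 3, 4, 5, 6}" "v \<in> {1, 2, 3, 4, 5, 6}" "w \<in> {1, 2, 3, 4, 5, 6}"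
    using assms by (auto simp: hexverts_set)
  then show ?thesis
    using assms(1,2) unfolding increasing_triples_def
    by (elim insertE emptyE) (simp_all only:, simp_all)
qed
text \<open>Replaces the order conditions of \<open>ccw\<close> by an enumeration over 20
  triples.\<close>

lemma ccw_increasing: "ccw u v w \<longleftrightarrow> (\<exists>t\<in>set increasing_triples. (u, v, w) \<in> set (rotations t))"
proof
  assume "ccw u v w"
  then have "\<exists>t. t \<in> {(u, v, w), (v, w, u), (w, u, v)} \<and> t \<in> set increasing_triples"
    unfolding ccw_def using increasing_triplesI[of u v w] increasing_triplesI[of v w u]
      increasing_triplesI[of w u v] by (auto simp: insert_commute)
  then show "\<exists>t\<in>set increasing_triples. (u, v, w) \<in> set (rotations t)"
    by (auto simp: rotations_def)
next
  have "\<forall>t\<in>set increasing_triples. \<forall>(u, v, w)\<in>set (rotations t).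
     {u, v, w} \<subseteq> set [1, 2, 3, 4, 5, 6] \<and> (u < v \<and> v < w \<or> v < w \<and> w < u \<or> w < u \<and> u < v)"
    by code_simp
  then show "\<exists>t\<in>set increasing_triples. (u, v, w) \<in> set (rotations t) \<Longrightarrow> ccw u v w"
    unfolding ccw_def hexverts_set by fastforce
qed

text \<open>The bridge from the list to the geometric triangles. Adjacency is symmetric, so it may
  be tested on the increasing arrangement of a triple.\<close>

lemma set_triangles:
  assumes "range T = ends ` set ds"
  shows "(u, v, w) \<in> set (triangles ds) \<longleftrightarrow> ccw u v w \<and> triangle T {u, v, w}"
proof -
  have adj: "triangle T {u, v, w} \<longleftrightarrow> adjacent ds u v \<and> adjacent ds v w \<and> adjacent ds w u"
    if "ccw u v w" for u v w
  proof -
    from that have "u \<in> hexverts" "v \<in> hexverts" "w \<in> hexverts" "u \<noteq> v" "v \<noteq> w" "w \<noteq> u"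
      using ccw_distinct by (auto simp: ccw_def)
    then show ?thesis
      unfolding triangle_def adjacent_iff[OF assms] by (auto simp: insert_commute)
  qed
  have "(u, v, w) \<in> set (triangles ds) \<longleftrightarrow> (\<exists>t\<in>set increasing_triples. (u, v, w) \<in> set (rotations t)
     \<and> (case t of (u, v, w) \<Rightarrow> adjacent ds u v \<and> adjacent ds v w \<and> adjacent ds w u))"
    by (auto simp: triangles_def)
  also have "\<dots> \<longleftrightarrow> (\<exists>t\<in>set increasing_triples. (u, v, w) \<in> set (rotations t)) \<and>
      adjacent ds u v \<and> adjacent ds v w \<and> adjacent ds w u"
    by (fastforce simp: rotations_def split: prod.splits)
  finally show ?thesis unfolding ccw_increasing[symmetric] using adj by blast
qed

definition apex :: "(nat \<times> nat \<times> nat) list \<Rightarrow> nat \<Rightarrow> nat \<Rightarrow> nat" where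
  "apex ts u v = the (map_of (map (\<lambda>(u, v, w). ((u, v), w)) ts) (u, v))"

definition halves_of :: "(nat \<times> nat \<times> nat) list \<Rightarrow> (nat \<times> nat) list" where
  "halves_of ts = map (\<lambda>(u, v, w). (u, v)) ts"

text \<open>The cyclic-order part of \<open>ccw a b a'\<close> and \<open>ccw a' b' a\<close> in the
  definition of \<open>crossing\<close>.\<close>

definition interleaved :: "chord \<Rightarrow> chord \<Rightarrow> bool" where
  "interleaved = (\<lambda>(a, a') (b, b'). (a < b \<and> b < a' \<or> b < a' \<and> a' < a \<or> a' < a \<and> a < b) \<and>
     (a' < b' \<and> b' < a \<or> b' < a \<and> a < a' \<or> a < a' \<and> a' < b'))"

definition crossing_chords :: "chord \<Rightarrow> chord \<Rightarrow> bool" where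
  "crossing_chords d e \<longleftrightarrow> (\<exists>x\<in>set [d, prod.swap d]. \<exists>y\<in>set [e, prod.swap e]. interleaved x y)"

text \<open>The order of the two entries makes the pair canonical: proper chords with equal ends are
  equal.\<close>

definition proper_chord :: "chord \<Rightarrow> bool" where
  "proper_chord d \<longleftrightarrow> fst d < snd d \<and> fst d \<in> set [1, 2, 3, 4, 5, 6] \<and> snd d \<in> set [1, 2, 3, 4, 5, 6]
     \<and> d \<notin> set sides \<and> prod.swap d \<notin> set sides"

definition non_crossing :: "chord \<times> chord \<Rightarrow> bool" where
  "non_crossing = (\<lambda>(d, e). \<not> crossing_chords d e)"

text \<open>Distinctness of the half-edges together with their exact set says that the triangles
  tile the hexagon: one lies to the left of each side, and one on either side of each chord.\<close>

definition proper_shape :: "chord list \<Rightarrow> (nat \<times> nat \<times> nat) list \<Rightarrow> bool" where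
  "proper_shape ds ts \<longleftrightarrow> distinct (halves_of ts)
     \<and> set (halves_of ts) = set (sides @ ds @ map prod.swap ds)
     \<and> list_all proper_chord ds \<and> list_all non_crossing (List.product ds ds)"

definition opposite :: "(nat \<times> nat \<times> nat) list \<Rightarrow> chord \<Rightarrow> chord" where
  "opposite ts d = (let r = apex ts (fst d) (snd d); s = apex ts (snd d) (fst d) in (min r s, max r s))"

definition replace :: "'a \<Rightarrow> 'a \<Rightarrow> 'a \<Rightarrow> 'a" where
  "replace d e x = (if x = d then e else x)"

definition num_arrows :: "(nat \<times> nat \<times> nat) list \<Rightarrow> chord \<Rightarrow> chord \<Rightarrow> nat" where
  "num_arrows ts d e = length (filter (\<lambda>(u, v, w). (u, v) \<in> set [d, prod.swap d] \<and> (v, w) \<in> set [e, prod.swap e]) ts)"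

definition arrow_number :: "(nat \<times> nat \<times> nat) list \<Rightarrow> chord \<Rightarrow> chord \<Rightarrow> int" where
  "arrow_number ts d e = int (num_arrows ts d e) - int (num_arrows ts e d)"

definition meets_both :: "chord \<Rightarrow> nat \<times> nat \<times> nat \<Rightarrow> bool" where
  "meets_both d = (\<lambda>(u, v, w). fst d \<in> set [u, v, w] \<and> snd d \<in> set [u, v, w])"

text \<open>For d = (p, q) with apex r on its left and s on its right, the quadrilateral is p, s, q,
  r counterclockwise. The other diagonal cuts it into (s, q, r) and (r, p, s).\<close>

definition flipped_triangles :: "(nat \<times> nat \<times> nat) list \<Rightarrow> chord \<Rightarrow> nat \<Rightarrow> nat \<Rightarrow> (nat \<times> nat \<times> nat) list" where
  "flipped_triangles ts d r s = filter (Not \<circ> meets_both d) ts @ rotations (s, snd d, r) @ rotations (r, fst d, s)"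

text \<open>\<open>mutate_quiver\<close> indexed by chords instead of colours, so that it can be
  checked on uncoloured shapes.\<close>

definition mutated_number :: "(chord \<Rightarrow> chord \<Rightarrow> int) \<Rightarrow> chord \<Rightarrow> chord \<Rightarrow> chord \<Rightarrow> int" where
  "mutated_number ar d x y = (if x = d \<or> y = d then - ar x y
     else ar x y + max 0 (ar x d) * max 0 (ar d y) - max 0 (ar y d) * max 0 (ar d x))"

definition flip_arrow :: "(nat \<times> nat \<times> nat) list \<Rightarrow> (nat \<times> nat \<times> nat) list \<Rightarrow> chord \<Rightarrow> chord \<Rightarrow> chord \<times> chord \<Rightarrow> bool" where
  "flip_arrow ts ts' d e = (\<lambda>(x, y). arrow_number ts' (replace d e x) (replace d e y)
     = mutated_number (arrow_number ts) d x y)"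

text \<open>Each auxiliary value is passed as an argument of a named function, never bound by \<open>let\<close> or an
  abstraction: the simplifier would otherwise evaluate the body with the value left symbolic.\<close>

definition flip_agrees where
  "flip_agrees ds ts d e ds' ts' \<longleftrightarrow> e \<notin> set ds \<and> set ds' \<in> set (map set shapes)
     \<and> set ts' = set (flipped_triangles ts d (apex ts (fst d) (snd d)) (apex ts (snd d) (fst d)))
     \<and> list_all (flip_arrow ts ts' d e) (List.product ds ds)"

definition flip_agrees_chords where
  "flip_agrees_chords ds ts d e ds' = flip_agrees ds ts d e ds' (triangles ds')"
definition flip_agrees_at where
  "flip_agrees_at ds ts d e = flip_agrees_chords ds ts d e (map (replace d e) ds)"
definition proper_flip where
  "proper_flip ds ts d = flip_agrees_at ds ts d (opposite ts d)"

definition proper_flips :: "chord list \<Rightarrow> (nat \<times> nat \<times> nat) list \<Rightarrow> bool" where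
  "proper_flips ds ts \<longleftrightarrow> list_all (proper_flip ds ts) ds"

lemma shapes_proper: "all_shapes proper_shape"
  by code_simp

lemma shapes_proper_flips: "all_shapes proper_flips"
  by code_simp

section \<open>From uncoloured shapes back to coloured triangulations\<close>

definition triangles_of :: "(colour \<Rightarrow> chord) \<Rightarrow> (nat \<times> nat \<times> nat) list" where
  "triangles_of \<kappa> = triangles [\<kappa> Orange, \<kappa> Blue, \<kappa> Green]"

text \<open>The invariant of the flip sequence: reference triangulations have a listed shape and
  flips preserve this, so the finite checks apply at every stage.\<close>

definition chord_colouring :: "(colour \<Rightarrow> chord) \<Rightarrow> bool" where
  "chord_colouring \<kappa> \<longleftrightarrow> inj \<kappa> \<and> range \<kappa> \<in> set ` set shapes"

definition flip_colouring :: "colour \<Rightarrow> (colour \<Rightarrow> chord) \<Rightarrow> colour \<Rightarrow> chord" where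
  "flip_colouring \<alpha> \<kappa> = \<kappa>(\<alpha> := opposite (triangles_of \<kappa>) (\<kappa> \<alpha>))"

text \<open>Since only the set of chords matters, one check per shape covers all its colourings and
  every order of its chords.\<close>

lemma triangles_cong: "set ds = set ds' \<Longrightarrow> triangles ds = triangles ds'"
  by (simp add: triangles_def adjacent_def)

lemma triangles_of_eq: "range \<kappa> = set ds \<Longrightarrow> triangles_of \<kappa> = triangles ds"
  unfolding triangles_of_def by (rule triangles_cong) (auto simp: UNIV_colour)

lemma chord_colouring_shape:
  assumes "chord_colouring \<kappa>"
  obtains ds where "range \<kappa> = set ds" "triangles_of \<kappa> = triangles ds"
    "proper_shape ds (triangles ds)" "proper_flips ds (triangles ds)"
proof -
  from assms obtain ds where ds: "range \<kappa> = set ds" "ds \<in> set shapes"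
    by (auto simp: chord_colouring_def)
  with that[of ds] show thesis
    using shapes_proper shapes_proper_flips triangles_of_eq[OF ds(1)]
    by (auto simp: all_shapes_def list_all_iff)
qed

lemma triangles_of_iff:
  "(u, v, w) \<in> set (triangles_of \<kappa>) \<longleftrightarrow> ccw u v w \<and> triangle (ends \<circ> \<kappa>) {u, v, w}"
  unfolding triangles_of_def by (rule set_triangles) (auto simp: UNIV_colour)

lemma triangles_of_rotate: "(u, v, w) \<in> set (triangles_of \<kappa>) \<Longrightarrow> (v, w, u) \<in> set (triangles_of \<kappa>)"
  unfolding triangles_of_iff by (auto simp: ccw_def insert_commute)

lemma apex_eq:
  assumes "chord_colouring \<kappa>" "(u, v, w) \<in> set (triangles_of \<kappa>)"
  shows "apex (triangles_of \<kappa>) u v = w"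
proof -
  let ?ps = "map (\<lambda>(u, v, w). ((u, v), w)) (triangles_of \<kappa>)"
  obtain ds where "range \<kappa> = set ds" "triangles_of \<kappa> = triangles ds" "proper_shape ds (triangles ds)"
    using chord_colouring_shape[OF assms(1)] by metis
  then have "distinct (halves_of (triangles_of \<kappa>))"
    by (simp add: proper_shape_def)
  moreover have "halves_of (triangles_of \<kappa>) = map fst ?ps"
    by (auto simp: halves_of_def)
  ultimately have "map_of ?ps (u, v) = Some w"
    using assms(2) by (intro map_of_is_SomeI) force+
  then show ?thesis by (simp add: apex_def)
qed

lemma half_edge_iff:
  assumes "chord_colouring \<kappa>"
  shows "(\<exists>w. (u, v, w) \<in> set (triangles_of \<kappa>)) \<longleftrightarrow> (u, v) \<in> set sides \<or> (\<exists>c. {u, v} = ends (\<kappa> c))"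
proof -
  obtain ds where ds: "range \<kappa> = set ds" "triangles_of \<kappa> = triangles ds" "proper_shape ds (triangles ds)"
    using chord_colouring_shape[OF assms(1)] by metis
  have "(\<exists>w. (u, v, w) \<in> set (triangles_of \<kappa>)) \<longleftrightarrow> (u, v) \<in> set (halves_of (triangles_of \<kappa>))"
    by (force simp: halves_of_def)
  also have "\<dots> \<longleftrightarrow> (u, v) \<in> set sides \<or> {u, v} \<in> ends ` set ds"
    using ds(2,3) unfolding in_ends by (auto simp: proper_shape_def)
  finally show ?thesis by (auto simp flip: ds(1))
qed

lemma proper_chords:
  assumes "chord_colouring \<kappa>"
  shows "proper_chord (\<kappa> c)" "\<not> crossing_chords (\<kappa> c) (\<kappa> c')"
proof -
  obtain ds where ds: "range \<kappa> = set ds" "proper_shape ds (triangles ds)"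
    using chord_colouring_shape[OF assms(1)] by metis
  have "\<kappa> c \<in> set ds" for c using ds(1) by auto
  with ds(2) show "proper_chord (\<kappa> c)" "\<not> crossing_chords (\<kappa> c) (\<kappa> c')"
    unfolding proper_shape_def list_all_iff by (simp_all add: non_crossing_def)
qed

lemma chord_not_side:
  assumes "chord_colouring \<kappa>" "{u, v} = ends (\<kappa> c)"
  shows "(u, v) \<notin> set sides"
  using proper_chords(1)[OF assms(1), of c] assms(2)
  by (cases "\<kappa> c") (auto simp: proper_chord_def ends_def doubleton_eq_iff)

lemma inj_ends:
  assumes "chord_colouring \<kappa>"
  shows "inj (ends \<circ> \<kappa>)"
proof -
  have "fst (\<kappa> c) < snd (\<kappa> c)" for c
    using proper_chords(1)[OF assms] by (simp add: proper_chord_def)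
  then have "\<kappa> c = \<kappa> c'" if "ends (\<kappa> c) = ends (\<kappa> c')" for c c'
    using that by (metis doubleton_eq_iff ends_def order.asym prod.expand)
  then show ?thesis using assms by (auto simp: chord_colouring_def inj_def)
qed

lemma ends_eq_iff: "ends d = {u, v} \<longleftrightarrow> (u, v) \<in> set [d, prod.swap d]"
  by (cases d) (auto simp: ends_def doubleton_eq_iff)

lemma crossing_imp_crossing_chords:
  assumes "crossing (ends d) (ends e)"
  shows "crossing_chords d e"
proof -
  from assms obtain a b a' b' where ab: "ends d = {a, a'}" "ends e = {b, b'}" "ccw a b a'" "ccw a' b' a"
    unfolding crossing_def by blast
  then have "(a, a') \<in> set [d, prod.swap d]" "(b, b') \<in> set [e, prod.swap e]"
    by (simp_all add: ends_eq_iff)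
  moreover have "interleaved (a, a') (b, b')"
    using ab(3,4) by (simp add: ccw_def interleaved_def)
  ultimately show ?thesis
    unfolding crossing_chords_def by blast
qed

lemma coloured_triangulation:
  assumes "chord_colouring \<kappa>"
  shows "coloured_triangulation (ends \<circ> \<kappa>)"
proof -
  have "ends (\<kappa> c) \<in> diagonals" for c
  proof -
    obtain a b where ab: "\<kappa> c = (a, b)" by force
    then have "a < b" "a \<in> hexverts" "b \<in> hexverts" "(a, b) \<notin> set sides" "(b, a) \<notin> set sides"
      using proper_chords(1)[OF assms, of c] by (simp_all add: proper_chord_def hexverts_set)
    moreover from this have "{a, b} \<notin> hexsides" by (simp add: in_hexsides)
    ultimately show ?thesis
      unfolding diagonals_def ab ends_def by auto
  qed
  moreover have "\<not> crossing (ends (\<kappa> c)) (ends (\<kappa> c'))" for c c'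
    using proper_chords(2)[OF assms] crossing_imp_crossing_chords by blast
  ultimately show ?thesis
    unfolding coloured_triangulation_def using inj_ends[OF assms] by auto
qed

lemma chord_apexes:
  fixes \<alpha> :: colour
  assumes "chord_colouring \<kappa>"
  defines "p \<equiv> fst (\<kappa> \<alpha>)" and "q \<equiv> snd (\<kappa> \<alpha>)"
  defines "r \<equiv> apex (triangles_of \<kappa>) p q" and "s \<equiv> apex (triangles_of \<kappa>) q p"
  shows "(p, q, r) \<in> set (triangles_of \<kappa>)" "(q, p, s) \<in> set (triangles_of \<kappa>)"
proof -
  have "{p, q} = ends (\<kappa> \<alpha>)" "{q, p} = ends (\<kappa> \<alpha>)" by (auto simp: p_def q_def ends_def)
  then obtain r' s' where "(p, q, r') \<in> set (triangles_of \<kappa>)" "(q, p, s') \<in> set (triangles_of \<kappa>)"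
    using half_edge_iff[OF assms(1)] by metis
  then show "(p, q, r) \<in> set (triangles_of \<kappa>)" "(q, p, s) \<in> set (triangles_of \<kappa>)"
    unfolding r_def s_def using apex_eq[OF assms(1)] by auto
qed

lemma ends_opposite: "ends (opposite ts d) = {apex ts (fst d) (snd d), apex ts (snd d) (fst d)}"
  by (auto simp: opposite_def ends_def Let_def min_def max_def)

lemma flip_eq:
  assumes "chord_colouring \<kappa>"
  shows "flip \<alpha> (ends \<circ> \<kappa>) = ends \<circ> flip_colouring \<alpha> \<kappa>"
proof -
  obtain p q where pq: "\<kappa> \<alpha> = (p, q)" by force
  define r where "r = apex (triangles_of \<kappa>) p q"
  define s where "s = apex (triangles_of \<kappa>) q p"
  have rs: "(p, q, r) \<in> set (triangles_of \<kappa>)" "(q, p, s) \<in> set (triangles_of \<kappa>)"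
    using chord_apexes[OF assms, of \<alpha>] by (simp_all add: pq r_def s_def)
  have "{x. x \<notin> {p, q} \<and> triangle (ends \<circ> \<kappa>) (insert x {p, q})} = {r, s}"
  proof (intro equalityI subsetI)
    fix x assume "x \<in> {x. x \<notin> {p, q} \<and> triangle (ends \<circ> \<kappa>) (insert x {p, q})}"
    then have x: "x \<notin> {p, q}" "triangle (ends \<circ> \<kappa>) {p, q, x}" "triangle (ends \<circ> \<kappa>) {q, p, x}"
      by (auto simp: insert_commute)
    moreover have "p \<noteq> q" using rs by (auto simp: triangles_of_iff ccw_def)
    moreover have "{p, q, x} \<subseteq> hexverts" using x(2) by (simp only: triangle_def)
    \<comment> \<open>A third vertex lies to the left of (p, q) or of (q, p), and on each side the
      apex is unique.\<close>
    ultimately have "ccw p q x \<or> ccw q p x"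
      by (simp add: ccw_def) arith
    with x have "(p, q, x) \<in> set (triangles_of \<kappa>) \<or> (q, p, x) \<in> set (triangles_of \<kappa>)"
      unfolding triangles_of_iff by blast
    then show "x \<in> {r, s}"
      using apex_eq[OF assms] by (auto simp: r_def s_def)
  next
    fix x assume "x \<in> {r, s}"
    with rs show "x \<in> {x. x \<notin> {p, q} \<and> triangle (ends \<circ> \<kappa>) (insert x {p, q})}"
      by (auto simp: triangles_of_iff insert_commute dest: ccw_distinct)
  qed
  then have "flip \<alpha> (ends \<circ> \<kappa>) = (ends \<circ> \<kappa>)(\<alpha> := {r, s})"
    by (simp add: flip_def pq ends_def)
  also have "{r, s} = ends (opposite (triangles_of \<kappa>) (p, q))"
    by (simp add: ends_opposite r_def s_def)
  finally show ?thesis unfolding flip_colouring_def pq fun_upd_comp .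
qed

lemma flip_colouring_replace:
  assumes "chord_colouring \<kappa>"
  shows "flip_colouring \<alpha> \<kappa> = replace (\<kappa> \<alpha>) (opposite (triangles_of \<kappa>) (\<kappa> \<alpha>)) \<circ> \<kappa>"
  using assms by (auto simp: flip_colouring_def replace_def fun_eq_iff chord_colouring_def inj_eq)

lemma flip_colouring_shape:
  fixes \<alpha> :: colour
  assumes "chord_colouring \<kappa>"
  defines "d \<equiv> \<kappa> \<alpha>" and "ts \<equiv> triangles_of \<kappa>" and "\<kappa>' \<equiv> flip_colouring \<alpha> \<kappa>"
  shows "chord_colouring \<kappa>'"
    "set (triangles_of \<kappa>') = set (flipped_triangles ts d (apex ts (fst d) (snd d)) (apex ts (snd d) (fst d)))"
    "arrow_number (triangles_of \<kappa>') (\<kappa>' i) (\<kappa>' j) = mutated_number (arrow_number ts) d (\<kappa> i) (\<kappa> j)"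
proof -
  obtain ds where ds: "range \<kappa> = set ds" "ts = triangles ds" "proper_flips ds (triangles ds)"
    using chord_colouring_shape[OF assms(1)] unfolding ts_def by metis
  let ?e = "opposite ts d"
  let ?ds = "map (replace d ?e) ds"
  have mem: "\<kappa> c \<in> set ds" for c using ds(1) by auto
  have chi': "\<kappa>' = replace d ?e \<circ> \<kappa>"
    using flip_colouring_replace[OF assms(1)] by (simp add: \<kappa>'_def d_def ts_def)
  have range: "range \<kappa>' = set ?ds"
    unfolding chi' by (simp add: ds(1) flip: image_image)
  then have ts': "triangles_of \<kappa>' = triangles ?ds"
    by (rule triangles_of_eq)
  have flip: "flip_agrees ds ts d ?e ?ds (triangles ?ds)"
    using ds(3) mem[of \<alpha>]
    by (simp add: proper_flips_def list_all_iff proper_flip_def flip_agrees_at_def flip_agrees_chords_def d_def ds(2))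
  \<comment> \<open>A flip produces a chord that was not there before; otherwise two colours would
    share a chord.\<close>
  have "?e \<notin> range \<kappa>" using flip by (simp add: flip_agrees_def ds(1))
  moreover have "inj \<kappa>" using assms(1) by (simp add: chord_colouring_def)
  ultimately have "inj \<kappa>'"
    unfolding \<kappa>'_def flip_colouring_def d_def[symmetric] ts_def[symmetric]
    by (auto simp: inj_def) (metis rangeI)+
  then show "chord_colouring \<kappa>'"
    using flip unfolding flip_agrees_def chord_colouring_def range by auto
  show "set (triangles_of \<kappa>') = set (flipped_triangles ts d (apex ts (fst d) (snd d)) (apex ts (snd d) (fst d)))"
    using flip unfolding flip_agrees_def ts' by auto
  show "arrow_number (triangles_of \<kappa>') (\<kappa>' i) (\<kappa>' j) = mutated_number (arrow_number ts) d (\<kappa> i) (\<kappa> j)"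
    using flip mem unfolding flip_agrees_def ts'[unfolded chi'] chi' by (auto simp: list_all_iff flip_arrow_def)
qed

text \<open>Arrows are counted by cardinality on the geometric side and by list length on the other;
  the two agree because no triple is listed twice.\<close>

lemma triangulation_quiver_eq:
  assumes "chord_colouring \<kappa>"
  shows "triangulation_quiver (ends \<circ> \<kappa>) i j = arrow_number (triangles_of \<kappa>) (\<kappa> i) (\<kappa> j)"
proof -
  have "distinct (triangles_of \<kappa>)"
  proof -
    obtain ds where "triangles_of \<kappa> = triangles ds" "proper_shape ds (triangles ds)"
      using chord_colouring_shape[OF assms(1)] by metis
    then show ?thesis
      by (auto simp: proper_shape_def halves_of_def distinct_map)
  qed
  then have "card (triangulation_arrows (ends \<circ> \<kappa>) i j) = num_arrows (triangles_of \<kappa>) (\<kappa> i) (\<kappa> j)" for i j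
  proof -
    have "triangulation_arrows (ends \<circ> \<kappa>) i j = set (filter (\<lambda>(u, v, w).
       (u, v) \<in> set [\<kappa> i, prod.swap (\<kappa> i)] \<and> (v, w) \<in> set [\<kappa> j, prod.swap (\<kappa> j)]) (triangles_of \<kappa>))"
      unfolding triangulation_arrows_def ends_eq_iff[symmetric] by (auto simp: triangles_of_iff)
    with \<open>distinct (triangles_of \<kappa>)\<close> show ?thesis
      unfolding num_arrows_def by (simp only: distinct_card distinct_filter)
  qed
  then show ?thesis by (simp add: triangulation_quiver_def arrow_number_def)
qed

lemma triangulation_quiver_flip:
  assumes "chord_colouring \<kappa>"
  shows "triangulation_quiver (ends \<circ> flip_colouring \<alpha> \<kappa>) = mutate_quiver \<alpha> (triangulation_quiver (ends \<circ> \<kappa>))"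
proof (intro ext)
  fix i j
  \<comment> \<open>Injectivity turns the tests for equal chords in \<open>mutated_number\<close>
    into the tests for equal colours in \<open>mutate_quiver\<close>.\<close>
  have "inj \<kappa>" using assms by (simp add: chord_colouring_def)
  then show "triangulation_quiver (ends \<circ> flip_colouring \<alpha> \<kappa>) i j = mutate_quiver \<alpha> (triangulation_quiver (ends \<circ> \<kappa>)) i j"
    by (simp add: triangulation_quiver_eq flip_colouring_shape assms mutate_quiver_def mutated_number_def inj_eq)
qed


section \<open>Isotopy of spines\<close>

definition spine_iso :: "('h \<Rightarrow> 'k) \<Rightarrow> 'h fatgraph \<Rightarrow> 'k fatgraph \<Rightarrow> bool" where
  "spine_iso f \<Gamma> \<Delta> \<longleftrightarrow> bij_betw f (halves \<Gamma>) (halves \<Delta>)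
     \<and> (\<forall>h\<in>halves \<Gamma>. f (nxt \<Gamma> h) = nxt \<Delta> (f h) \<and> f (opp \<Gamma> h) = opp \<Delta> (f h)
          \<and> label \<Delta> (f h) = label \<Gamma> h \<and> face \<Delta> (f h) = face \<Gamma> h)"

lemma same_spine_iff: "same_spine \<Gamma> \<Delta> \<longleftrightarrow> (\<exists>f. spine_iso f \<Gamma> \<Delta>)"
  by (simp add: same_spine_def spine_iso_def)

lemma same_spine_refl: "same_spine \<Gamma> \<Gamma>"
  unfolding same_spine_def by (rule exI[of _ id]) auto

lemma same_spine_trans:
  assumes "same_spine \<Gamma> \<Delta>" "same_spine \<Delta> \<Theta>"
  shows "same_spine \<Gamma> \<Theta>"
proof -
  obtain f g where fg: "spine_iso f \<Gamma> \<Delta>" "spine_iso g \<Delta> \<Theta>"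
    using assms by (auto simp: same_spine_iff)
  moreover from fg have "f h \<in> halves \<Delta>" if "h \<in> halves \<Gamma>" for h
    using that by (auto simp: spine_iso_def bij_betw_def)
  ultimately have "spine_iso (g \<circ> f) \<Gamma> \<Theta>"
    unfolding spine_iso_def by (auto intro: bij_betw_trans)
  then show ?thesis by (auto simp: same_spine_iff)
qed

text \<open>\<open>nxt\<close> and \<open>opp\<close> are total functions, whereas an isomorphism is
  controlled on half-edges only; closure keeps their iterates within its reach.\<close>

definition closed_spine :: "'h fatgraph \<Rightarrow> bool" where
  "closed_spine \<Gamma> \<longleftrightarrow> (\<forall>h\<in>halves \<Gamma>. nxt \<Gamma> h \<in> halves \<Gamma> \<and> opp \<Gamma> h \<in> halves \<Gamma>)"

lemma halves_flip_fg [simp]: "halves (flip_fg \<alpha> \<Gamma>) = halves \<Gamma>"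
  and opp_flip_fg [simp]: "opp (flip_fg \<alpha> \<Gamma>) = opp \<Gamma>"
  and label_flip_fg [simp]: "label (flip_fg \<alpha> \<Gamma>) = label \<Gamma>"
  by (simp_all add: flip_fg_def)

lemma closed_spine_flip_fg: "closed_spine \<Gamma> \<Longrightarrow> closed_spine (flip_fg \<alpha> \<Gamma>)"
  by (auto simp: closed_spine_def flip_fg_def)

text \<open>The flip is expressed through \<open>nxt\<close>, \<open>opp\<close>,
  \<open>label\<close> and \<open>face\<close> alone, all of which an isomorphism respects.\<close>

lemma same_spine_flip_fg:
  assumes "same_spine \<Gamma> \<Delta>" "closed_spine \<Gamma>"
  shows "same_spine (flip_fg \<alpha> \<Gamma>) (flip_fg \<alpha> \<Delta>)"
proof -
  obtain f where "spine_iso f \<Gamma> \<Delta>" using assms by (auto simp: same_spine_iff)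
  then have f: "bij_betw f (halves \<Gamma>) (halves \<Delta>)"
    and com: "\<And>h. h \<in> halves \<Gamma> \<Longrightarrow> nxt \<Delta> (f h) = f (nxt \<Gamma> h)"
      "\<And>h. h \<in> halves \<Gamma> \<Longrightarrow> opp \<Delta> (f h) = f (opp \<Gamma> h)"
      "\<And>h. h \<in> halves \<Gamma> \<Longrightarrow> label \<Delta> (f h) = label \<Gamma> h"
      "\<And>h. h \<in> halves \<Gamma> \<Longrightarrow> face \<Delta> (f h) = face \<Gamma> h"
    by (auto simp: spine_iso_def)
  have closed: "\<And>h. h \<in> halves \<Gamma> \<Longrightarrow> nxt \<Gamma> h \<in> halves \<Gamma>" "\<And>h. h \<in> halves \<Gamma> \<Longrightarrow> opp \<Gamma> h \<in> halves \<Gamma>"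
    using assms(2) by (auto simp: closed_spine_def)
  have "spine_iso f (flip_fg \<alpha> \<Gamma>) (flip_fg \<alpha> \<Delta>)"
    using f unfolding spine_iso_def by (simp add: flip_fg_def com closed)
  then show ?thesis by (auto simp: same_spine_iff)
qed

lemma fg_quiver_same_spine:
  assumes "same_spine \<Gamma> \<Delta>" "closed_spine \<Gamma>"
  shows "fg_quiver \<Gamma> = fg_quiver \<Delta>"
proof -
  obtain f where f: "spine_iso f \<Gamma> \<Delta>" using assms by (auto simp: same_spine_iff)
  have "card (fg_arrows \<Gamma> i j) = card (fg_arrows \<Delta> i j)" for i j
  proof (rule bij_betw_same_card)
    have "f ` fg_arrows \<Gamma> i j = fg_arrows \<Delta> i j"
    proof (intro equalityI subsetI)
      fix k assume k: "k \<in> fg_arrows \<Delta> i j"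
      then have "k \<in> f ` halves \<Gamma>"
        using f by (simp add: fg_arrows_def spine_iso_def bij_betw_def)
      then obtain h where "h \<in> halves \<Gamma>" "k = f h" by blast
      with k f assms(2) show "k \<in> f ` fg_arrows \<Gamma> i j"
        by (auto simp: fg_arrows_def spine_iso_def closed_spine_def) (metis (mono_tags, lifting) image_eqI mem_Collect_eq)
    next
      fix k assume "k \<in> f ` fg_arrows \<Gamma> i j"
      with f assms(2) show "k \<in> fg_arrows \<Delta> i j"
        by (auto simp: fg_arrows_def spine_iso_def closed_spine_def bij_betw_def) (metis (mono_tags, lifting))
    qed
    moreover have "inj_on f (fg_arrows \<Gamma> i j)"
      using f by (auto simp: spine_iso_def bij_betw_def fg_arrows_def intro: inj_on_subset)
    ultimately show "bij_betw f (fg_arrows \<Gamma> i j) (fg_arrows \<Delta> i j)"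
      by (simp add: bij_betw_def)
  qed
  then show ?thesis by (simp add: fg_quiver_def fun_eq_iff)
qed

lemma spine_of_sphere_same_spine:
  assumes "spine_of_sphere \<Delta>" "same_spine \<Gamma> \<Delta>" "closed_spine \<Gamma>"
  shows "spine_of_sphere \<Gamma>"
proof -
  obtain f where "spine_iso f \<Gamma> \<Delta>" using assms by (auto simp: same_spine_iff)
  then have inj: "inj_on f (halves \<Gamma>)" and im: "f ` halves \<Gamma> = halves \<Delta>"
    and com: "\<And>h. h \<in> halves \<Gamma> \<Longrightarrow> nxt \<Delta> (f h) = f (nxt \<Gamma> h)"
      "\<And>h. h \<in> halves \<Gamma> \<Longrightarrow> opp \<Delta> (f h) = f (opp \<Gamma> h)"
      "\<And>h. h \<in> halves \<Gamma> \<Longrightarrow> face \<Delta> (f h) = face \<Gamma> h"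
    by (auto simp: spine_iso_def bij_betw_def)
  have closed: "\<And>h. h \<in> halves \<Gamma> \<Longrightarrow> nxt \<Gamma> h \<in> halves \<Gamma>" "\<And>h. h \<in> halves \<Gamma> \<Longrightarrow> opp \<Gamma> h \<in> halves \<Gamma>"
    using assms(3) by (auto simp: closed_spine_def)
  have mem: "h \<in> halves \<Gamma> \<Longrightarrow> f h \<in> halves \<Delta>" for h using im by auto
  have eq: "h \<in> halves \<Gamma> \<Longrightarrow> k \<in> halves \<Gamma> \<Longrightarrow> f h = f k \<longleftrightarrow> h = k" for h k
    using inj by (auto simp: inj_on_def)
  have \<Delta>: "finite (halves \<Delta>)" "halves \<Delta> \<noteq> {}"
    "\<forall>h\<in>halves \<Delta>. nxt \<Delta> h \<in> halves \<Delta> \<and> nxt \<Delta> h \<noteq> h \<and> nxt \<Delta> (nxt \<Delta> (nxt \<Delta> h)) = h"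
    "\<forall>h\<in>halves \<Delta>. opp \<Delta> h \<in> halves \<Delta> \<and> opp \<Delta> h \<noteq> h \<and> opp \<Delta> (opp \<Delta> h) = h"
    "\<forall>h\<in>halves \<Delta>. \<forall>h'\<in>halves \<Delta>.
       (h, h') \<in> {(x, y). x \<in> halves \<Delta> \<and> (y = nxt \<Delta> x \<or> y = opp \<Delta> x)}\<^sup>*"
    "face \<Delta> ` halves \<Delta> = hexpuncture ` hexverts"
    "\<forall>h\<in>halves \<Delta>. \<forall>h'\<in>halves \<Delta>.
       face \<Delta> h = face \<Delta> h' \<longleftrightarrow> (\<exists>n. ((nxt \<Delta> \<circ> opp \<Delta>) ^^ n) h = h')"
    "int (card (fg_vertices \<Delta>)) - int (card (fg_edges \<Delta>)) + 4 = 2"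
    using assms(1) unfolding spine_of_sphere_def by - (elim conjE, assumption)+
  \<comment> \<open>Path lifting: a path of the target starting at an image point is the image of a
    path of the source.\<close>
  have reach: "\<exists>h'\<in>halves \<Gamma>. k = f h' \<and> (h, h') \<in> {(x, y). x \<in> halves \<Gamma> \<and> (y = nxt \<Gamma> x \<or> y = opp \<Gamma> x)}\<^sup>*"
    if "(f h, k) \<in> {(x, y). x \<in> halves \<Delta> \<and> (y = nxt \<Delta> x \<or> y = opp \<Delta> x)}\<^sup>*" "h \<in> halves \<Gamma>" for h k
    using that(1)
  proof (induction rule: rtrancl_induct)
    case base
    then show ?case using that(2) by auto
  next
    case (step y z)
    then obtain h' where h': "h' \<in> halves \<Gamma>" "y = f h'"
      "(h, h') \<in> {(x, y). x \<in> halves \<Gamma> \<and> (y = nxt \<Gamma> x \<or> y = opp \<Gamma> x)}\<^sup>*" by blast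
    with step(2) have "z = f (nxt \<Gamma> h') \<or> z = f (opp \<Gamma> h')" by (auto simp: com)
    with h' closed show ?case
      by (auto intro: rtrancl_into_rtrancl)
  qed
  have pow: "((nxt \<Gamma> \<circ> opp \<Gamma>) ^^ n) h \<in> halves \<Gamma> \<and>
      f (((nxt \<Gamma> \<circ> opp \<Gamma>) ^^ n) h) = ((nxt \<Delta> \<circ> opp \<Delta>) ^^ n) (f h)" if "h \<in> halves \<Gamma>" for n h
    by (induction n) (use that in \<open>simp_all add: closed flip: com\<close>)
  have "fg_vertices \<Delta> = (`) f ` fg_vertices \<Gamma>" "fg_edges \<Delta> = (`) f ` fg_edges \<Gamma>"
    unfolding fg_vertices_def fg_edges_def im[symmetric] image_image by (auto simp: com closed)
  moreover have "inj_on ((`) f) (fg_vertices \<Gamma>)" "inj_on ((`) f) (fg_edges \<Gamma>)"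
    by (rule inj_on_subset[OF inj_on_image_Pow[OF inj]]; auto simp: fg_vertices_def fg_edges_def closed)+
  ultimately have "card (fg_vertices \<Delta>) = card (fg_vertices \<Gamma>)" "card (fg_edges \<Delta>) = card (fg_edges \<Gamma>)"
    by (simp_all add: card_image)
  moreover have "finite (halves \<Gamma>)" "halves \<Gamma> \<noteq> {}"
    using \<Delta>(1,2) finite_imageD[OF _ inj] unfolding im[symmetric] by auto
  moreover have "nxt \<Gamma> h \<noteq> h" "nxt \<Gamma> (nxt \<Gamma> (nxt \<Gamma> h)) = h" "opp \<Gamma> h \<noteq> h" "opp \<Gamma> (opp \<Gamma> h) = h"
    if "h \<in> halves \<Gamma>" for h
    using bspec[OF \<Delta>(3) mem[OF that]] bspec[OF \<Delta>(4) mem[OF that]] that by (auto simp: com closed eq)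
  moreover have "face \<Gamma> ` halves \<Gamma> = hexpuncture ` hexverts"
    unfolding \<Delta>(6)[symmetric] im[symmetric] image_image by (simp add: com)
  moreover have "(h, h') \<in> {(x, y). x \<in> halves \<Gamma> \<and> (y = nxt \<Gamma> x \<or> y = opp \<Gamma> x)}\<^sup>*"
    if h: "h \<in> halves \<Gamma>" "h' \<in> halves \<Gamma>" for h h'
  proof -
    have "(f h, f h') \<in> {(x, y). x \<in> halves \<Delta> \<and> (y = nxt \<Delta> x \<or> y = opp \<Delta> x)}\<^sup>*"
      using \<Delta>(5) mem[OF h(1)] mem[OF h(2)] by blast
    from reach[OF this h(1)] h eq show ?thesis by blast
  qed
  moreover have "face \<Gamma> h = face \<Gamma> h' \<longleftrightarrow> (\<exists>n. ((nxt \<Gamma> \<circ> opp \<Gamma>) ^^ n) h = h')"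
    if h: "h \<in> halves \<Gamma>" "h' \<in> halves \<Gamma>" for h h'
  proof -
    have "face \<Gamma> h = face \<Gamma> h' \<longleftrightarrow> (\<exists>n. ((nxt \<Delta> \<circ> opp \<Delta>) ^^ n) (f h) = f h')"
      using bspec[OF bspec[OF \<Delta>(7) mem[OF h(1)]] mem[OF h(2)]] by (simp only: com(3) h)
    also have "\<dots> \<longleftrightarrow> (\<exists>n. ((nxt \<Gamma> \<circ> opp \<Gamma>) ^^ n) h = h')"
      using pow[OF h(1)] by (metis eq h(2))
    finally show ?thesis .
  qed
  ultimately show ?thesis
    using \<Delta>(8) closed unfolding spine_of_sphere_def by (intro conjI ballI; simp)
qed


section \<open>The dual spine\<close>

definition nxt_half :: "(nat \<times> nat \<times> nat) list \<Rightarrow> nat \<times> nat \<Rightarrow> nat \<times> nat" where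
  "nxt_half ts h = (snd h, apex ts (fst h) (snd h))"

definition opp_half :: "nat \<times> nat \<Rightarrow> nat \<times> nat" where
  "opp_half h = (if snd h = hexsucc (fst h) then glued_side h else prod.swap h)"

definition vertex_half :: "(nat \<times> nat \<times> nat) list \<Rightarrow> nat \<times> nat \<Rightarrow> (nat \<times> nat) list" where
  "vertex_half ts h = [h, nxt_half ts h, nxt_half ts (nxt_half ts h)]"

text \<open>A search that crosses chords only: the dual graph of the triangles inside the hexagon is
  already a tree. It has four vertices, so three rounds reach all of them from any starting
  triangle.\<close>

definition grow_half :: "(nat \<times> nat \<times> nat) list \<Rightarrow> (nat \<times> nat) list \<Rightarrow> nat \<times> nat \<Rightarrow> (nat \<times> nat) list" where
  "grow_half ts hs h = (if h \<in> set sides \<or> prod.swap h \<in> set hs then [] else vertex_half ts (prod.swap h))"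

definition grow :: "(nat \<times> nat \<times> nat) list \<Rightarrow> (nat \<times> nat) list \<Rightarrow> (nat \<times> nat) list" where
  "grow ts hs = hs @ concat (map (grow_half ts hs) hs)"

text \<open>The list serves as a counter. Taking the list of all half-edges bounds the length of
  every face cycle.\<close>

fun orbit :: "('a \<Rightarrow> 'a) \<Rightarrow> 'b list \<Rightarrow> 'a \<Rightarrow> 'a list" where
  "orbit f [] x = []"
| "orbit f (y # ys) x = x # orbit f ys (f x)"

definition walk :: "(nat \<times> nat \<times> nat) list \<Rightarrow> nat \<times> nat \<Rightarrow> nat \<times> nat" where
  "walk ts h = nxt_half ts (opp_half h)"

definition same_puncture :: "nat \<times> nat \<Rightarrow> nat \<times> nat \<Rightarrow> bool" where
  "same_puncture h k \<longleftrightarrow> hexpuncture (fst h) = hexpuncture (fst k)"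

text \<open>The face walk stays at its puncture and meets every half-edge there, so the cycles
  correspond to the punctures.\<close>

definition proper_face :: "(nat \<times> nat \<times> nat) list \<Rightarrow> (nat \<times> nat) list \<Rightarrow> nat \<times> nat \<Rightarrow> bool" where
  "proper_face ts hs h \<longleftrightarrow> same_puncture h (walk ts h)
     \<and> set (filter (same_puncture h) hs) \<subseteq> set (orbit (walk ts) hs h)"

definition edge_half :: "nat \<times> nat \<Rightarrow> (nat \<times> nat) list" where
  "edge_half h = [h, opp_half h]"

text \<open>The counts are those of four triangles and of three chords plus three glued pairs; with
  four faces the Euler characteristic is 4 - 6 + 4 = 2.\<close>

definition proper_spine_half where
  "proper_spine_half ts hs \<longleftrightarrow> list_all (proper_face ts hs) hs
     \<and> set hs \<subseteq> set (grow ts (grow ts (grow ts (vertex_half ts (hd hs)))))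
     \<and> length (remdups (map (set \<circ> vertex_half ts) hs)) = 4
     \<and> length (remdups (map (set \<circ> edge_half) hs)) = 6"

definition proper_spine :: "chord list \<Rightarrow> (nat \<times> nat \<times> nat) list \<Rightarrow> bool" where
  "proper_spine ds ts \<longleftrightarrow> proper_spine_half ts (halves_of ts)"

lemma shapes_proper_spine: "all_shapes proper_spine"
  by code_simp

lemma left_apex_eq:
  assumes "chord_colouring \<kappa>" "(u, v, w) \<in> set (triangles_of \<kappa>)"
  shows "left_apex (ends \<circ> \<kappa>) u v = w"
  unfolding left_apex_def
proof (rule the_equality)
  show "ccw u v w \<and> triangle (ends \<circ> \<kappa>) {u, v, w}"
    using assms(2) by (simp add: triangles_of_iff)
  fix w' assume "ccw u v w' \<and> triangle (ends \<circ> \<kappa>) {u, v, w'}"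
  then have "(u, v, w') \<in> set (triangles_of \<kappa>)" by (simp add: triangles_of_iff)
  then show "w' = w" using apex_eq[OF assms(1)] assms(2) by metis
qed

lemma in_halves_of: "(u, v) \<in> set (halves_of ts) \<longleftrightarrow> (\<exists>w. (u, v, w) \<in> set ts)"
  by (force simp: halves_of_def)

lemma halves_dual_spine: "halves (dual_spine (ends \<circ> \<kappa>)) = set (halves_of (triangles_of \<kappa>))"
  by (auto simp: dual_spine_def in_halves_of triangles_of_iff)

lemma opp_dual_spine: "opp (dual_spine T) = opp_half"
  by (auto simp: dual_spine_def opp_half_def fun_eq_iff)

lemma face_dual_spine: "face (dual_spine T) h = hexpuncture (fst h)"
  by (simp add: dual_spine_def split: prod.splits)

lemma nxt_dual_spine:
  assumes "chord_colouring \<kappa>" "(u, v, w) \<in> set (triangles_of \<kappa>)"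
  shows "nxt (dual_spine (ends \<circ> \<kappa>)) (u, v) = (v, w)"
  using left_apex_eq[OF assms] by (simp add: dual_spine_def)

lemma nxt_dual_spine_half:
  assumes "chord_colouring \<kappa>" "h \<in> set (halves_of (triangles_of \<kappa>))"
  shows "nxt (dual_spine (ends \<circ> \<kappa>)) h = nxt_half (triangles_of \<kappa>) h"
proof -
  obtain u v w where "h = (u, v)" "(u, v, w) \<in> set (triangles_of \<kappa>)"
    using assms(2) by (metis in_halves_of surj_pair)
  then show ?thesis
    using nxt_dual_spine[OF assms(1)] apex_eq[OF assms(1)] by (simp add: nxt_half_def)
qed

text \<open>\<open>opp\<close> and \<open>label\<close> of the dual spine recognize a side by v =
  hexsucc u, a test that no chord may pass.\<close>

lemma chord_not_hexsucc:
  assumes "chord_colouring \<kappa>" "{u, v} = ends (\<kappa> c)"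
  shows "v \<noteq> hexsucc u"
proof -
  obtain w where "(u, v, w) \<in> set (triangles_of \<kappa>)"
    using half_edge_iff[OF assms(1)] assms(2) by metis
  then have "u \<in> hexverts" by (simp add: triangles_of_iff ccw_def)
  with chord_not_side[OF assms] show ?thesis by (auto simp: set_sides)
qed

lemma label_side: "(u, v) \<in> set sides \<Longrightarrow> label (dual_spine T) (u, v) = Side u"
  by (simp add: dual_spine_def set_sides)

lemma label_chord:
  assumes "chord_colouring \<kappa>" "{u, v} = ends (\<kappa> c)"
  shows "label (dual_spine (ends \<circ> \<kappa>)) (u, v) = Chord c"
proof -
  have "(THE c. ends (\<kappa> c) = {u, v}) = c"
    using inj_ends[OF assms(1)] assms(2) by (intro the_equality) (auto simp: inj_def)
  with chord_not_hexsucc[OF assms] show ?thesis by (simp add: dual_spine_def)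
qed

lemma half_edge_cases:
  assumes "chord_colouring \<kappa>" "(u, v, w) \<in> set (triangles_of \<kappa>)"
  obtains "(u, v) \<in> set sides" | c where "{u, v} = ends (\<kappa> c)"
  using half_edge_iff[OF assms(1)] assms(2) by metis

lemma label_eq_Chord_iff:
  assumes "chord_colouring \<kappa>" "(u, v, w) \<in> set (triangles_of \<kappa>)"
  shows "label (dual_spine (ends \<circ> \<kappa>)) (u, v) = Chord c \<longleftrightarrow> {u, v} = ends (\<kappa> c)"
  using assms
proof (cases rule: half_edge_cases)
  case 1
  then show ?thesis using label_side chord_not_side[OF assms(1)] by auto
next
  case (2 c')
  then show ?thesis
    using label_chord[OF assms(1) 2] label_chord[OF assms(1), of u v c] by auto
qed

text \<open>An arrow is a corner of a triangle between two chords. The half-edge (u, v) determines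
  the apex w, so forgetting w is a bijection between the two sets of arrows.\<close>

lemma fg_quiver_dual_spine:
  assumes "chord_colouring \<kappa>"
  shows "fg_quiver (dual_spine (ends \<circ> \<kappa>)) = triangulation_quiver (ends \<circ> \<kappa>)"
proof -
  have "card (fg_arrows (dual_spine (ends \<circ> \<kappa>)) i j) = card (triangulation_arrows (ends \<circ> \<kappa>) i j)" for i j
  proof -
    let ?A = "triangulation_arrows (ends \<circ> \<kappa>) i j"
    have A: "(u, v, w) \<in> ?A \<longleftrightarrow> (u, v, w) \<in> set (triangles_of \<kappa>) \<and> {u, v} = ends (\<kappa> i) \<and> {v, w} = ends (\<kappa> j)" for u v w
      by (auto simp: triangulation_arrows_def triangles_of_iff)
    have B: "(u, v) \<in> fg_arrows (dual_spine (ends \<circ> \<kappa>)) i j \<longleftrightarrow> {u, v} = ends (\<kappa> i) \<and> {v, w} = ends (\<kappa> j)"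
      if "(u, v, w) \<in> set (triangles_of \<kappa>)" for u v w
      using that label_eq_Chord_iff[OF assms that] nxt_dual_spine[OF assms that]
        label_eq_Chord_iff[OF assms triangles_of_rotate[OF that]]
      by (auto simp: fg_arrows_def halves_dual_spine in_halves_of)
    have "fg_arrows (dual_spine (ends \<circ> \<kappa>)) i j = (\<lambda>(u, v, w). (u, v)) ` ?A"
    proof (intro equalityI subsetI)
      fix h assume h: "h \<in> fg_arrows (dual_spine (ends \<circ> \<kappa>)) i j"
      then obtain u v w where uvw: "h = (u, v)" "(u, v, w) \<in> set (triangles_of \<kappa>)"
        by (cases h) (auto simp: fg_arrows_def halves_dual_spine in_halves_of)
      with h B have "(u, v, w) \<in> ?A" by (simp add: A)
      with uvw(1) show "h \<in> (\<lambda>(u, v, w). (u, v)) ` ?A" by force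
    qed (use A B in auto)
    moreover have "inj_on (\<lambda>(u, v, w). (u, v)) ?A"
    proof (rule inj_onI)
      fix s t assume "s \<in> ?A" "t \<in> ?A" "(case s of (u, v, w) \<Rightarrow> (u, v)) = (case t of (u, v, w) \<Rightarrow> (u, v))"
      then show "s = t"
        by (cases s; cases t) (simp add: A, metis apex_eq[OF assms])
    qed
    ultimately show ?thesis by (simp add: card_image)
  qed
  then show ?thesis by (simp add: fg_quiver_def triangulation_quiver_def fun_eq_iff)
qed

lemma triangle_distinct: "(u, v, w) \<in> set (triangles_of \<kappa>) \<Longrightarrow> u \<noteq> v \<and> v \<noteq> w \<and> w \<noteq> u"
  using ccw_distinct by (auto simp: triangles_of_iff)

lemma glued_side: "h \<in> set sides \<Longrightarrow> glued_side h \<in> set sides \<and> glued_side h \<noteq> h \<and> glued_side (glued_side h) = h"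
  by (auto simp: sides_def glued_side_def hexsucc_def)

lemma opp_half_side: "h \<in> set sides \<Longrightarrow> opp_half h = glued_side h"
  by (cases h) (simp add: opp_half_def set_sides)

lemma opp_half_chord:
  assumes "chord_colouring \<kappa>" "{u, v} = ends (\<kappa> c)"
  shows "opp_half (u, v) = (v, u)"
  using chord_not_hexsucc[OF assms] by (simp add: opp_half_def)

lemma opp_half_closed:
  assumes "chord_colouring \<kappa>" "h \<in> set (halves_of (triangles_of \<kappa>))"
  shows "opp_half h \<in> set (halves_of (triangles_of \<kappa>))" "opp_half h \<noteq> h" "opp_half (opp_half h) = h"
proof -
  obtain u v w where h: "h = (u, v)" "(u, v, w) \<in> set (triangles_of \<kappa>)"
    using assms(2) by (metis in_halves_of surj_pair)
  have "opp_half h \<in> set (halves_of (triangles_of \<kappa>)) \<and> opp_half h \<noteq> h \<and> opp_half (opp_half h) = h"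
    using assms(1) h(2)
  proof (cases rule: half_edge_cases)
    case 1
    with h(1) have "h \<in> set sides" by simp
    then show ?thesis
      using glued_side[of h] half_edge_iff[OF assms(1)] by (cases "glued_side h") (auto simp: opp_half_side in_halves_of)
  next
    case (2 c)
    then have "{v, u} = ends (\<kappa> c)" by (simp add: insert_commute)
    with 2 h triangle_distinct show ?thesis
      using half_edge_iff[OF assms(1), of v u] by (auto simp: opp_half_chord[OF assms(1)] in_halves_of)
  qed
  then show "opp_half h \<in> set (halves_of (triangles_of \<kappa>))" "opp_half h \<noteq> h" "opp_half (opp_half h) = h"
    by auto
qed

lemma nxt_half_closed:
  assumes "chord_colouring \<kappa>" "h \<in> set (halves_of (triangles_of \<kappa>))"
  shows "nxt_half (triangles_of \<kappa>) h \<in> set (halves_of (triangles_of \<kappa>))" "nxt_half (triangles_of \<kappa>) h \<noteq> h"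
    "nxt_half (triangles_of \<kappa>) (nxt_half (triangles_of \<kappa>) (nxt_half (triangles_of \<kappa>) h)) = h"
proof -
  obtain u v w where h: "h = (u, v)" "(u, v, w) \<in> set (triangles_of \<kappa>)"
    using assms(2) by (metis in_halves_of surj_pair)
  then show "nxt_half (triangles_of \<kappa>) h \<in> set (halves_of (triangles_of \<kappa>))" "nxt_half (triangles_of \<kappa>) h \<noteq> h"
    "nxt_half (triangles_of \<kappa>) (nxt_half (triangles_of \<kappa>) (nxt_half (triangles_of \<kappa>) h)) = h"
    using triangles_of_rotate[OF h(2)] triangles_of_rotate[OF triangles_of_rotate[OF h(2)]] triangle_distinct[OF h(2)]
    by (auto simp: nxt_half_def apex_eq[OF assms(1)] in_halves_of)
qed

lemma closed_dual_spine: "chord_colouring \<kappa> \<Longrightarrow> closed_spine (dual_spine (ends \<circ> \<kappa>))"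
  by (auto simp: closed_spine_def halves_dual_spine nxt_dual_spine_half opp_dual_spine nxt_half_closed opp_half_closed)

lemma orbit_funpow: "y \<in> set (orbit f xs x) \<Longrightarrow> \<exists>n. y = (f ^^ n) x"
proof (induction xs arbitrary: x)
  case (Cons a xs)
  then consider "y = x" | n where "y = (f ^^ n) (f x)" by auto
  then show ?case
  proof cases
    case 1
    then show ?thesis by (intro exI[of _ 0]) simp
  next
    case 2
    then show ?thesis by (intro exI[of _ "Suc n"]) (simp add: funpow_swap1)
  qed
qed simp

lemma rtrancl_symI:
  assumes "\<And>x y. (x, y) \<in> R \<Longrightarrow> (y, x) \<in> R\<^sup>*" "(x, y) \<in> R\<^sup>*"
  shows "(y, x) \<in> R\<^sup>*"
  using assms(2) by (induction rule: rtrancl_induct) (auto intro: rtrancl_trans assms(1))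

lemma spine_of_sphere_dual_spine:
  assumes "chord_colouring \<kappa>"
  shows "spine_of_sphere (dual_spine (ends \<circ> \<kappa>))"
proof -
  let ?ts = "triangles_of \<kappa>" and ?D = "dual_spine (ends \<circ> \<kappa>)"
  let ?H = "set (halves_of ?ts)"
  obtain ds where "range \<kappa> = set ds" "ds \<in> set shapes" using assms by (auto simp: chord_colouring_def)
  then have spine: "proper_spine_half ?ts (halves_of ?ts)"
    using shapes_proper_spine triangles_of_eq[of \<kappa> ds] by (simp add: all_shapes_def list_all_iff proper_spine_def)
  have walk: "walk ?ts h \<in> ?H" if "h \<in> ?H" for h
    using that by (simp add: walk_def nxt_half_closed opp_half_closed assms)
  have pow: "((nxt ?D \<circ> opp ?D) ^^ n) h = (walk ?ts ^^ n) h \<and> (walk ?ts ^^ n) h \<in> ?H" if "h \<in> ?H" for n h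
    using that by (induction n)
      (simp_all add: opp_dual_spine nxt_dual_spine_half opp_half_closed assms walk walk_def[symmetric])
  have face: "proper_face ?ts (halves_of ?ts) h" if "h \<in> ?H" for h
    using spine that by (simp add: proper_spine_half_def list_all_iff)
  have face_pow: "hexpuncture (fst ((walk ?ts ^^ n) h)) = hexpuncture (fst h)" if "h \<in> ?H" for n h
  proof (induction n)
    case (Suc n)
    have "same_puncture ((walk ?ts ^^ n) h) (walk ?ts ((walk ?ts ^^ n) h))"
      using face[of "(walk ?ts ^^ n) h"] pow[OF that] by (simp add: proper_face_def)
    with Suc show ?case by (simp add: same_puncture_def)
  qed simp
  define R where "R = {(x, y). x \<in> halves ?D \<and> (y = nxt ?D x \<or> y = opp ?D x)}"
  have R: "(x, y) \<in> R \<longleftrightarrow> x \<in> ?H \<and> (y = nxt_half ?ts x \<or> y = opp_half x)" for x y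
    by (simp add: R_def halves_dual_spine opp_dual_spine nxt_dual_spine_half[OF assms] cong: conj_cong)
  \<comment> \<open>\<open>nxt\<close> has order three and \<open>opp\<close> has order two on
    half-edges, so each step can be undone by further steps. It then suffices to reach everything
    from one half-edge.\<close>
  have sym: "(y, x) \<in> R\<^sup>*" if "(x, y) \<in> R" for x y
  proof -
    from that have x: "x \<in> ?H" and y: "y = nxt_half ?ts x \<or> y = opp_half x" using R by blast+
    from y show ?thesis
    proof
      assume y: "y = nxt_half ?ts x"
      have "(y, nxt_half ?ts y) \<in> R" "(nxt_half ?ts y, nxt_half ?ts (nxt_half ?ts y)) \<in> R"
        unfolding R y using nxt_half_closed[OF assms] x by blast+
      moreover have "nxt_half ?ts (nxt_half ?ts y) = x"
        using nxt_half_closed(3)[OF assms x] y by simp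
      ultimately show ?thesis by (metis (no_types, lifting) r_into_rtrancl rtrancl_into_rtrancl)
    next
      assume y: "y = opp_half x"
      then have "(y, x) \<in> R" unfolding R using opp_half_closed[OF assms x] by simp
      then show ?thesis by blast
    qed
  qed
  have vertex: "k \<in> ?H \<and> (h0, k) \<in> R\<^sup>*" if "h \<in> ?H" "(h0, h) \<in> R\<^sup>*" "k \<in> set (vertex_half ?ts h)" for h0 h k
  proof -
    have step: "nxt_half ?ts x \<in> ?H \<and> (h0, nxt_half ?ts x) \<in> R\<^sup>*" if "x \<in> ?H \<and> (h0, x) \<in> R\<^sup>*" for x
    proof -
      from that have "(x, nxt_half ?ts x) \<in> R" by (simp add: R)
      with that show ?thesis
        using nxt_half_closed(1)[OF assms] by (blast intro: rtrancl_into_rtrancl)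
    qed
    from that(1,2) have "h \<in> ?H \<and> (h0, h) \<in> R\<^sup>*" by blast
    with that(3) show ?thesis
      using step[of h] step[of "nxt_half ?ts h"] unfolding vertex_half_def by auto
  qed
  have grow: "\<forall>k\<in>set (grow ?ts hs). k \<in> ?H \<and> (h0, k) \<in> R\<^sup>*" if hs: "\<forall>k\<in>set hs. k \<in> ?H \<and> (h0, k) \<in> R\<^sup>*" for h0 hs
  proof
    fix k assume "k \<in> set (grow ?ts hs)"
    then consider "k \<in> set hs" | h where "h \<in> set hs" "h \<notin> set sides" "k \<in> set (vertex_half ?ts (prod.swap h))"
      by (auto simp: grow_def grow_half_def split: if_splits)
    then show "k \<in> ?H \<and> (h0, k) \<in> R\<^sup>*"
    proof cases
      case 2
      then have h: "h \<in> ?H" "(h0, h) \<in> R\<^sup>*" using hs by auto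
      then obtain u v w where uvw: "h = (u, v)" "(u, v, w) \<in> set ?ts"
        by (metis in_halves_of surj_pair)
      from assms uvw(2) have "opp_half h = prod.swap h"
        by (cases rule: half_edge_cases) (use 2 uvw(1) opp_half_chord[OF assms] in auto)
      then have "(h, prod.swap h) \<in> R" "prod.swap h \<in> ?H"
        using h R opp_half_closed[OF assms h(1)] by auto
      then show ?thesis
        using vertex[OF _ _ 2(3)] h(2) by (meson rtrancl_into_rtrancl)
    qed (use hs in auto)
  qed
  have "halves_of ?ts \<noteq> []"
    using half_edge_iff[OF assms, of 1 2] by (force simp: sides_def simp flip: in_halves_of)
  then have h0: "hd (halves_of ?ts) \<in> ?H" by simp
  have "\<forall>k\<in>set (grow ?ts (grow ?ts (grow ?ts (vertex_half ?ts (hd (halves_of ?ts)))))).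
      k \<in> ?H \<and> (hd (halves_of ?ts), k) \<in> R\<^sup>*"
    by (intro grow ballI vertex[OF h0 rtrancl.rtrancl_refl])
  then have conn0: "(hd (halves_of ?ts), k) \<in> R\<^sup>*" if "k \<in> ?H" for k
    using spine that unfolding proper_spine_half_def by blast
  have conn: "(h, k) \<in> R\<^sup>*" if "h \<in> ?H" "k \<in> ?H" for h k
    using rtrancl_symI[OF sym conn0[OF that(1)]] conn0[OF that(2)] by (rule rtrancl_trans)
  have nx: "nxt ?D h = nxt_half ?ts h" "nxt_half ?ts h \<in> ?H" "nxt_half ?ts (nxt_half ?ts (nxt_half ?ts h)) = h" "nxt_half ?ts h \<noteq> h"
     "opp_half h \<in> ?H" "opp_half h \<noteq> h" "opp_half (opp_half h) = h"
    if "h \<in> ?H" for h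
    using nxt_half_closed[OF assms that] opp_half_closed[OF assms that] nxt_dual_spine_half[OF assms that]
    by simp_all
  have "fg_vertices ?D = set (map (set \<circ> vertex_half ?ts) (halves_of ?ts))"
    unfolding fg_vertices_def halves_dual_spine by (auto simp: nx vertex_half_def)
  then have V: "card (fg_vertices ?D) = 4"
    using spine unfolding proper_spine_half_def length_remdups_card_conv by metis
  have "fg_edges ?D = set (map (set \<circ> edge_half) (halves_of ?ts))"
    unfolding fg_edges_def halves_dual_spine opp_dual_spine by (auto simp: edge_half_def)
  then have E: "card (fg_edges ?D) = 6"
    using spine unfolding proper_spine_half_def length_remdups_card_conv by metis
  have "fst ` ?H = hexverts"
  proof (intro equalityI subsetI)
    fix u assume "u \<in> fst ` ?H"
    then obtain v w where "(u, v, w) \<in> set ?ts" by (auto simp: in_halves_of)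
    then show "u \<in> hexverts" by (simp add: triangles_of_iff ccw_def)
  next
    fix u assume "u \<in> hexverts"
    then have "(u, hexsucc u) \<in> ?H" using half_edge_iff[OF assms, of u] by (auto simp: in_halves_of set_sides)
    then show "u \<in> fst ` ?H" by force
  qed
  then have F: "face ?D ` halves ?D = hexpuncture ` hexverts"
    unfolding halves_dual_spine by (auto simp: face_dual_spine simp flip: image_image)
  have P: "face ?D h = face ?D k \<longleftrightarrow> (\<exists>n. ((nxt ?D \<circ> opp ?D) ^^ n) h = k)" if h: "h \<in> ?H" "k \<in> ?H" for h k
  proof
    assume "face ?D h = face ?D k"
    then have "k \<in> set (filter (same_puncture h) (halves_of ?ts))"
      using h by (simp add: face_dual_spine same_puncture_def)
    then have "k \<in> set (orbit (walk ?ts) (halves_of ?ts) h)"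
      using face[OF h(1)] unfolding proper_face_def by blast
    then obtain n where "k = (walk ?ts ^^ n) h" using orbit_funpow by metis
    then show "\<exists>n. ((nxt ?D \<circ> opp ?D) ^^ n) h = k" using pow[OF h(1)] by metis
  next
    assume "\<exists>n. ((nxt ?D \<circ> opp ?D) ^^ n) h = k"
    then obtain n where "((nxt ?D \<circ> opp ?D) ^^ n) h = k" ..
    then have "k = (walk ?ts ^^ n) h" using pow[OF h(1)] by simp
    then show "face ?D h = face ?D k" using face_pow[OF h(1)] by (simp add: face_dual_spine)
  qed
  have 1: "finite (halves ?D)" "halves ?D \<noteq> {}"
    using h0 by (auto simp: halves_dual_spine)
  have 2: "\<forall>h\<in>halves ?D. nxt ?D h \<in> halves ?D \<and> nxt ?D h \<noteq> h \<and> nxt ?D (nxt ?D (nxt ?D h)) = h"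
    "\<forall>h\<in>halves ?D. opp ?D h \<in> halves ?D \<and> opp ?D h \<noteq> h \<and> opp ?D (opp ?D h) = h"
    unfolding halves_dual_spine opp_dual_spine using nx by simp_all
  have 3: "\<forall>h\<in>halves ?D. \<forall>h'\<in>halves ?D. (h, h') \<in> {(x, y). x \<in> halves ?D \<and> (y = nxt ?D x \<or> y = opp ?D x)}\<^sup>*"
    using conn unfolding R_def halves_dual_spine[symmetric] by blast
  have 4: "\<forall>h\<in>halves ?D. \<forall>h'\<in>halves ?D. face ?D h = face ?D h' \<longleftrightarrow> (\<exists>n. ((nxt ?D \<circ> opp ?D) ^^ n) h = h')"
    using P unfolding halves_dual_spine[symmetric] by blast
  have 5: "int (card (fg_vertices ?D)) - int (card (fg_edges ?D)) + 4 = 2"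
    by (simp add: V E)
  show ?thesis
    unfolding spine_of_sphere_def by (intro conjI 1 2 3 4 5 F)
qed

lemma same_spine_flip_dual_spine:
  assumes "chord_colouring \<kappa>"
  shows "same_spine (flip_fg \<alpha> (dual_spine (ends \<circ> \<kappa>))) (dual_spine (ends \<circ> flip_colouring \<alpha> \<kappa>))"
proof -
  define \<kappa>' where "\<kappa>' = flip_colouring \<alpha> \<kappa>"
  have \<kappa>': "chord_colouring \<kappa>'"
    unfolding \<kappa>'_def by (rule flip_colouring_shape(1)[OF assms])
  let ?D = "dual_spine (ends \<circ> \<kappa>)" and ?D' = "dual_spine (ends \<circ> \<kappa>')"
  let ?ts = "triangles_of \<kappa>" and ?ts' = "triangles_of \<kappa>'"
  obtain p q where pq: "\<kappa> \<alpha> = (p, q)" by force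
  define r where "r = apex ?ts p q"
  define s where "s = apex ?ts q p"
  have T: "(p, q, r) \<in> set ?ts" "(q, p, s) \<in> set ?ts"
    using chord_apexes[OF assms, of \<alpha>] by (simp_all add: pq r_def s_def)
  note T = T T[THEN triangles_of_rotate] T[THEN triangles_of_rotate, THEN triangles_of_rotate]
  have apart: "p \<noteq> q" "r \<noteq> p" "r \<noteq> q" "s \<noteq> p" "s \<noteq> q" using T triangle_distinct by blast+
  have E: "ends (\<kappa> \<alpha>) = {p, q}" by (simp add: pq ends_def)
  have E': "ends (\<kappa>' \<alpha>) = {r, s}"
    using ends_opposite[of ?ts "\<kappa> \<alpha>"] by (simp add: \<kappa>'_def flip_colouring_def pq r_def s_def)
  have chords: "{p, q} = ends (\<kappa> \<alpha>)" "{q, p} = ends (\<kappa> \<alpha>)"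
    "{r, s} = ends (\<kappa>' \<alpha>)" "{s, r} = ends (\<kappa>' \<alpha>)"
    by (auto simp: E E')
  note not_side = chord_not_side[OF assms chords(1)] chord_not_side[OF assms chords(2)]
    chord_not_side[OF \<kappa>' chords(3)] chord_not_side[OF \<kappa>' chords(4)]
  note opp_chord = opp_half_chord[OF assms chords(1)] opp_half_chord[OF assms chords(2)]
    opp_half_chord[OF \<kappa>' chords(3)] opp_half_chord[OF \<kappa>' chords(4)]
  note label_flipped = label_chord[OF assms chords(1)] label_chord[OF assms chords(2)]
    label_chord[OF \<kappa>' chords(3)] label_chord[OF \<kappa>' chords(4)]
  have other: "\<kappa>' c = \<kappa> c" if "c \<noteq> \<alpha>" for c
    using that by (simp add: \<kappa>'_def flip_colouring_def)
  have ts': "set ?ts' = set (flipped_triangles ?ts (p, q) r s)"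
    using flip_colouring_shape(2)[OF assms, of \<alpha>] by (simp add: \<kappa>'_def pq r_def s_def)
  then have T': "(s, q, r) \<in> set ?ts'" "(q, r, s) \<in> set ?ts'" "(r, s, q) \<in> set ?ts'"
    "(r, p, s) \<in> set ?ts'" "(p, s, r) \<in> set ?ts'" "(s, r, p) \<in> set ?ts'"
    by (simp_all add: flipped_triangles_def rotations_def)
  have kept: "(u, v, w) \<in> set ?ts'" if "(u, v, w) \<in> set ?ts" "\<not> (p \<in> {u, v, w} \<and> q \<in> {u, v, w})" for u v w
    unfolding ts' flipped_triangles_def using that by (auto simp: meets_both_def)
  have "r \<noteq> s" using T' triangle_distinct by blast
  txt \<open>A counterclockwise quarter turn of the chord inside its quadrilateral \<open>p, s, q, r\<close>.\<close>
  define f where "f h = (if h = (p, q) then (s, r) else if h = (q, p) then (r, s) else h)" for h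
  have H: "(u, v) \<in> halves ?D \<longleftrightarrow> (u, v) \<in> set sides \<or> (\<exists>c. {u, v} = ends (\<kappa> c))" for u v
    unfolding halves_dual_spine in_halves_of half_edge_iff[OF assms] ..
  have H': "(u, v) \<in> halves ?D' \<longleftrightarrow> (u, v) \<in> set sides \<or> (\<exists>c. {u, v} = ends (\<kappa>' c))" for u v
    unfolding halves_dual_spine in_halves_of half_edge_iff[OF \<kappa>'] ..
  \<comment> \<open>Otherwise the new chord would already carry a colour c \<noteq> \<alpha>, and
    after the flip two colours would have the same chord.\<close>
  have new: "h \<notin> {(r, s), (s, r)}" if "h \<in> halves ?D" for h
  proof
    assume h: "h \<in> {(r, s), (s, r)}"
    then have side: "h \<notin> set sides"
      using not_side by auto
    obtain u v where uv: "h = (u, v)" by force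
    with h E' have "ends (\<kappa>' \<alpha>) = {u, v}" by auto
    moreover from that side uv H obtain c where "{u, v} = ends (\<kappa> c)" by auto
    ultimately have c: "ends (\<kappa>' \<alpha>) = ends (\<kappa> c)" by simp
    show False
    proof (cases "c = \<alpha>")
      case True
      then show False using c E E' apart by (auto simp: doubleton_eq_iff)
    next
      case False
      then have "(ends \<circ> \<kappa>') \<alpha> = (ends \<circ> \<kappa>') c" using c other by simp
      with False injD[OF inj_ends[OF \<kappa>'], of \<alpha> c] show False by auto
    qed
  qed
  have stay: "h \<in> halves ?D' \<and> h \<notin> {(r, s), (s, r)} \<and> label ?D' h = label ?D h \<and> opp_half h \<notin> {(p, q), (q, p)}"
    if h: "h \<in> halves ?D" "h \<notin> {(p, q), (q, p)}" for h
  proof -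
    obtain u v where uv: "h = (u, v)" by force
    from h(1) uv H consider "h \<in> set sides" | c where "{u, v} = ends (\<kappa> c)" by auto
    then show ?thesis
    proof cases
      case 1
      then have "opp_half h \<notin> {(p, q), (q, p)}"
        using glued_side[OF 1] not_side by (auto simp: opp_half_side)
      with 1 uv H' new[OF h(1)] show ?thesis by (auto simp: label_side)
    next
      case (2 c)
      then have "c \<noteq> \<alpha>" using h(2) uv E by (auto simp: doubleton_eq_iff)
      with 2 have eq': "{u, v} = ends (\<kappa>' c)" by (simp add: other)
      moreover have "opp_half h \<notin> {(p, q), (q, p)}"
        using h(2) uv opp_half_chord[OF assms 2] by auto
      ultimately show ?thesis
        using uv new[OF h(1)] label_chord[OF assms 2] label_chord[OF \<kappa>' eq'] H' by auto
    qed
  qed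
  have "bij_betw f (halves ?D) (halves ?D')"
    unfolding bij_betw_def
  proof
    show "inj_on f (halves ?D)"
    proof (rule inj_onI)
      fix h k assume hk: "h \<in> halves ?D" "k \<in> halves ?D" "f h = f k"
      then show "h = k"
        using new[OF hk(1)] new[OF hk(2)] \<open>r \<noteq> s\<close> apart(1) by (auto simp: f_def split: if_splits)
    qed
    show "f ` halves ?D = halves ?D'"
    proof (intro equalityI subsetI)
      fix k assume "k \<in> f ` halves ?D"
      then obtain h where h: "h \<in> halves ?D" "k = f h" by blast
      have "(s, r) \<in> halves ?D'" "(r, s) \<in> halves ?D'"
        using H' E' by (auto simp: insert_commute)
      then show "k \<in> halves ?D'"
        using stay[OF h(1)] h(2) by (auto simp: f_def)
    next
      fix k assume k: "k \<in> halves ?D'"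
      have pq: "(p, q) \<in> halves ?D" "(q, p) \<in> halves ?D"
        using H E by (auto simp: insert_commute)
      obtain u v where uv: "k = (u, v)" by force
      from k uv H' consider "k \<in> set sides" | c where "{u, v} = ends (\<kappa>' c)" by auto
      then consider "k \<in> {(s, r), (r, s)}" | "k \<in> halves ?D" "k \<notin> {(p, q), (q, p)}"
      proof cases
        case 1
        then have "k \<in> halves ?D" using H uv by auto
        moreover have "k \<notin> {(p, q), (q, p)}"
          using 1 not_side by auto
        ultimately show thesis by (rule that(2))
      next
        case (2 c)
        show thesis
        proof (cases "c = \<alpha>")
          case True
          with 2 uv E' have "k \<in> {(s, r), (r, s)}" by (auto simp: doubleton_eq_iff)
          then show thesis by (rule that(1))
        next
          case False
          with 2 have c: "{u, v} = ends (\<kappa> c)" by (simp add: other)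
          then have "k \<in> halves ?D" using H uv by auto
          moreover have "{u, v} \<noteq> {p, q}"
            using c E False injD[OF inj_ends[OF assms], of c \<alpha>] by auto
          then have "k \<notin> {(p, q), (q, p)}" using uv by auto
          ultimately show thesis by (rule that(2))
        qed
      qed
      then show "k \<in> f ` halves ?D"
      proof cases
        case 1
        then have "k = f (p, q) \<or> k = f (q, p)" using apart(1) by (auto simp: f_def)
        then show ?thesis using pq by blast
      next
        case 2
        then have "k = f k" by (auto simp: f_def)
        with 2 show ?thesis by blast
      qed
    qed
  qed
  moreover have "f (opp ?D h) = opp ?D' (f h)" if "h \<in> halves ?D" for h
  proof (cases "h \<in> {(p, q), (q, p)}")
    case True
    with apart(1) show ?thesis by (auto simp: opp_dual_spine f_def opp_chord)
  next
    case False
    with stay[OF that] show ?thesis by (auto simp: opp_dual_spine f_def)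
  qed
  moreover have "label ?D' (f h) = label ?D h" if "h \<in> halves ?D" for h
  proof (cases "h \<in> {(p, q), (q, p)}")
    case True
    with apart(1) show ?thesis by (auto simp: f_def label_flipped)
  next
    case False
    with stay[OF that] show ?thesis by (auto simp: f_def)
  qed
  moreover have "f (nxt (flip_fg \<alpha> ?D) h) = nxt ?D' (f h) \<and> face ?D' (f h) = face (flip_fg \<alpha> ?D) h"
    if h: "h \<in> halves ?D" for h
  proof -
    obtain u v w where uvw: "h = (u, v)" "(u, v, w) \<in> set ?ts"
      using h by (metis halves_dual_spine in_halves_of surj_pair)
    note rot = uvw(2) triangles_of_rotate[OF uvw(2)] triangles_of_rotate[OF triangles_of_rotate[OF uvw(2)]]
    have lab: "label ?D (x, y) = Chord \<alpha> \<longleftrightarrow> (x, y) = (p, q) \<or> (x, y) = (q, p)" if "(x, y, z) \<in> set ?ts" for x y z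
      unfolding label_eq_Chord_iff[OF assms that] E by (auto simp: doubleton_eq_iff)
    note nx = nxt_dual_spine[OF assms] and nx' = nxt_dual_spine[OF \<kappa>']
    have opp: "opp ?D (p, q) = (q, p)" "opp ?D (q, p) = (p, q)"
      by (simp_all add: opp_dual_spine opp_chord)
    note ev = nx[OF T(1)] nx[OF T(2)] nx[OF T(3)] nx[OF T(4)] nx[OF T(5)] nx[OF T(6)]
       nx'[OF T'(1)] nx'[OF T'(2)] nx'[OF T'(3)] nx'[OF T'(4)] nx'[OF T'(5)] nx'[OF T'(6)]
       lab[OF T(1)] lab[OF T(2)] lab[OF T(3)] lab[OF T(4)] lab[OF T(5)] lab[OF T(6)] opp
    have ap: "c = apex ?ts a b" if "(a, b, c) \<in> set ?ts" for a b c using apex_eq[OF assms that] by simp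
    have uniq: "c = c'" if "(a, b, c) \<in> set ?ts" "(a, b, c') \<in> set ?ts" for a b c c'
      using ap[OF that(1)] ap[OF that(2)] by simp
    have third: "z = r" if "(p, q, z) \<in> set ?ts" for z using uniq[OF that T(1)] .
    have third': "z = s" if "(q, p, z) \<in> set ?ts" for z using uniq[OF that T(2)] .
    \<comment> \<open>Either the half-edge belongs to one of the two triangles at the flipped chord,
      which leaves six cases to evaluate, or its triangle survives and the flip changes nothing
      there.\<close>
    consider "(u, v, w) \<in> {(p, q, r), (q, r, p), (r, p, q), (q, p, s), (p, s, q), (s, q, p)}"
      | "\<not> (p \<in> {u, v, w} \<and> q \<in> {u, v, w})"
    proof (cases "p \<in> {u, v, w} \<and> q \<in> {u, v, w}")
      case True
      with apart(1) consider "u = p" "v = q" | "u = q" "v = p" | "v = p" "w = q" | "v = q" "w = p"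
        | "w = p" "u = q" | "w = q" "u = p" by auto
      then have "(u, v, w) \<in> {(p, q, r), (q, r, p), (r, p, q), (q, p, s), (p, s, q), (s, q, p)}"
      proof cases
          case 1
          then show ?thesis using third[of w] rot(1) by simp
        next
          case 2
          then show ?thesis using third'[of w] rot(1) by simp
        next
          case 3
          then show ?thesis using third[of u] rot(2) by simp
        next
          case 4
          then show ?thesis using third'[of u] rot(2) by simp
        next
          case 5
          then show ?thesis using third[of v] rot(3) by simp
        next
          case 6
          then show ?thesis using third'[of v] rot(3) by simp
        qed
      then show thesis by (rule that(1))
    qed (rule that(2))
    then show ?thesis
    proof cases
      case 1
      then show ?thesis
        using apart \<open>r \<noteq> s\<close>
        by (elim insertE emptyE) (simp_all add: uvw(1) flip_fg_def f_def ev face_dual_spine)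
    next
      case 2
      then have no: "(u, v) \<noteq> (p, q)" "(u, v) \<noteq> (q, p)" "(v, w) \<noteq> (p, q)" "(v, w) \<noteq> (q, p)"
        "(w, u) \<noteq> (p, q)" "(w, u) \<noteq> (q, p)" by auto
      then have "f (u, v) = (u, v)" "f (v, w) = (v, w)" by (simp_all only: f_def if_False)
      moreover have "nxt ?D' (u, v) = (v, w)" using nx'[OF kept[OF uvw(2) 2]] .
      moreover have "label ?D (u, v) \<noteq> Chord \<alpha>" "label ?D (v, w) \<noteq> Chord \<alpha>" "label ?D (w, u) \<noteq> Chord \<alpha>"
        unfolding lab[OF rot(1)] lab[OF rot(2)] lab[OF rot(3)] using no by (simp_all only: simp_thms)
      ultimately show ?thesis
        by (simp add: uvw(1) flip_fg_def nx[OF rot(1)] nx[OF rot(2)] nx[OF rot(3)] face_dual_spine)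
    qed
  qed
  ultimately have "spine_iso f (flip_fg \<alpha> ?D) ?D'"
    unfolding spine_iso_def by simp
  then show ?thesis unfolding same_spine_iff \<kappa>'_def by blast
qed


section \<open>The flip sequence\<close>

lemma foldr_step: "foldr f (x # xs) a = f x (foldr f xs a)"
  by simp

lemma fst_foldr_mutate: "fst (foldr mutate w (\<epsilon>, X)) = foldr mutate_quiver w \<epsilon>"
  by (induction w) (simp_all add: mutate_def)

lemma foldr_flip:
  assumes "chord_colouring \<kappa>"
  shows "foldr flip w (ends \<circ> \<kappa>) = ends \<circ> foldr flip_colouring w \<kappa>"
    and "chord_colouring (foldr flip_colouring w \<kappa>)"
    and "triangulation_quiver (ends \<circ> foldr flip_colouring w \<kappa>)
           = foldr mutate_quiver w (triangulation_quiver (ends \<circ> \<kappa>))"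
  by (induction w) (simp_all add: assms flip_eq flip_colouring_shape(1) triangulation_quiver_flip)

text \<open>Flipped spines agree with dual spines only up to isotopy, and transporting an isotopy
  through the next flip requires closure; hence the joint induction.\<close>

lemma foldr_flip_fg:
  assumes "chord_colouring \<kappa>"
  shows "closed_spine (foldr flip_fg w (dual_spine (ends \<circ> \<kappa>)))"
    and "same_spine (foldr flip_fg w (dual_spine (ends \<circ> \<kappa>))) (dual_spine (ends \<circ> foldr flip_colouring w \<kappa>))"
proof (induction w)
  case (Cons c w)
  show "closed_spine (foldr flip_fg (c # w) (dual_spine (ends \<circ> \<kappa>)))"
    unfolding foldr_step by (rule closed_spine_flip_fg[OF Cons(1)])
  show "same_spine (foldr flip_fg (c # w) (dual_spine (ends \<circ> \<kappa>)))
     (dual_spine (ends \<circ> foldr flip_colouring (c # w) \<kappa>))"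
    unfolding foldr_step
    by (rule same_spine_trans[OF same_spine_flip_fg[OF Cons(2,1)] same_spine_flip_dual_spine[OF foldr_flip(2)[OF assms]]])
qed (simp_all add: closed_dual_spine[OF assms] same_spine_refl)

lemma foldr_flip_fg_spine:
  assumes "chord_colouring \<kappa>"
  shows "spine_of_sphere (foldr flip_fg w (dual_spine (ends \<circ> \<kappa>)))"
    and "fg_quiver (foldr flip_fg w (dual_spine (ends \<circ> \<kappa>))) = foldr mutate_quiver w (triangulation_quiver (ends \<circ> \<kappa>))"
  using spine_of_sphere_same_spine[OF spine_of_sphere_dual_spine[OF foldr_flip(2)[OF assms]] foldr_flip_fg(2,1)[OF assms]]
    fg_quiver_same_spine[OF foldr_flip_fg(2,1)[OF assms]] fg_quiver_dual_spine[OF foldr_flip(2)[OF assms]]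
  by (simp_all add: foldr_flip(3)[OF assms])

section \<open>Rotation of the equilateral triangulations by pi\<close>

fun flip_chord :: "colour \<Rightarrow> chord \<times> chord \<times> chord \<Rightarrow> chord \<times> chord \<times> chord" where
  "flip_chord Orange (x, y, z) = (opposite (triangles [x, y, z]) x, y, z)"
| "flip_chord Blue (x, y, z) = (x, opposite (triangles [x, y, z]) y, z)"
| "flip_chord Green (x, y, z) = (x, y, opposite (triangles [x, y, z]) z)"

definition chord_of :: "nat \<Rightarrow> nat \<Rightarrow> chord" where
  "chord_of u v = (min u v, max u v)"

definition rotate_chord :: "chord \<Rightarrow> chord" where
  "rotate_chord d = chord_of (rot_pi (fst d)) (rot_pi (snd d))"

text \<open>Evaluated for a single labelling but all six orderings of the chords, which is
  equivalent to all labellings.\<close>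

definition rotates :: "chord \<times> chord \<times> chord \<Rightarrow> bool" where
  "rotates t \<longleftrightarrow> foldr flip_chord (w2_word Orange Blue Green) t
     = map_prod rotate_chord (map_prod rotate_chord rotate_chord) t"

definition orderings :: "chord list \<Rightarrow> (chord \<times> chord \<times> chord) list" where
  "orderings ds = filter (\<lambda>(x, y, z). x \<noteq> y \<and> y \<noteq> z \<and> z \<noteq> x) (List.product ds (List.product ds ds))"

lemma equilateral_rotates:
  "list_all rotates (orderings [(2, 4), (4, 6), (2, 6)])" "list_all rotates (orderings [(1, 3), (3, 5), (1, 5)])"
  by code_simp+

definition triple :: "(colour \<Rightarrow> 'a) \<Rightarrow> 'a \<times> 'a \<times> 'a" where
  "triple f = (f Orange, f Blue, f Green)"

lemma triple_inject:
  assumes "triple f = triple g"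
  shows "f = g"
proof
  show "f c = g c" for c using assms by (cases c) (simp_all add: triple_def)
qed

lemma foldr_flip_chord: "foldr flip_chord w (triple \<kappa>) = triple (foldr flip_colouring w \<kappa>)"
proof (induction w)
  case (Cons c w)
  then show ?case
    by (cases c) (simp_all add: triple_def flip_colouring_def triangles_of_def)
qed simp

lemma triangles_of_cong: "range \<kappa> = range \<kappa>' \<Longrightarrow> triangles_of \<kappa> = triangles_of \<kappa>'"
  unfolding triangles_of_def by (rule triangles_cong) (simp add: UNIV_colour)

lemma flip_colouring_comp:
  assumes "bij \<pi>"
  shows "flip_colouring (\<pi> c) \<kappa> \<circ> \<pi> = flip_colouring c (\<kappa> \<circ> \<pi>)"
proof -
  have "range (\<kappa> \<circ> \<pi>) = range \<kappa>"
    unfolding image_comp[symmetric] bij_is_surj[OF assms] ..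
  then have "triangles_of (\<kappa> \<circ> \<pi>) = triangles_of \<kappa>" by (rule triangles_of_cong)
  moreover have "\<pi> x = \<pi> c \<longleftrightarrow> x = c" for x using assms by (simp add: bij_def inj_eq)
  ultimately show ?thesis by (simp add: flip_colouring_def fun_eq_iff)
qed

text \<open>Flips commute with renaming of colours, because triangles do not see the
  colours.\<close>

lemma foldr_flip_colouring_comp:
  assumes "bij \<pi>"
  shows "foldr flip_colouring (map \<pi> w) \<kappa> \<circ> \<pi> = foldr flip_colouring w (\<kappa> \<circ> \<pi>)"
proof (induction w)
  case (Cons c w)
  show ?case
    unfolding list.map foldr_step flip_colouring_comp[OF assms] Cons ..
qed simp

lemma rotates_colouring:
  assumes "inj \<kappa>" "range \<kappa> = set ds" "list_all rotates (orderings ds)" "{\<alpha>, \<beta>, \<gamma>} = (UNIV :: colour set)"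
  shows "foldr flip_colouring (w2_word \<alpha> \<beta> \<gamma>) \<kappa> = rotate_chord \<circ> \<kappa>"
proof -
  \<comment> \<open>The renaming that carries Orange, Blue, Green to \<alpha>, \<beta>, \<gamma>:
    for the colouring \<kappa> \<circ> \<pi> the given word becomes the one that was
    evaluated.\<close>
  define \<pi> where "\<pi> = case_colour \<alpha> \<beta> \<gamma>"
  have "range \<pi> = UNIV" unfolding UNIV_colour[THEN arg_cong[of _ _ "image \<pi>"]] using assms(4) by (simp add: \<pi>_def)
  moreover have "finite (UNIV :: colour set)" by (simp add: UNIV_colour)
  ultimately have "bij \<pi>" by (simp add: bij_def finite_UNIV_surj_inj)
  have "\<kappa> (\<pi> c) \<in> set ds" for c using assms(2) by blast
  moreover have "\<kappa> (\<pi> c) = \<kappa> (\<pi> c') \<longleftrightarrow> c = c'" for c c'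
    using assms(1) \<open>bij \<pi>\<close> by (simp add: bij_def inj_eq)
  ultimately have "triple (\<kappa> \<circ> \<pi>) \<in> set (orderings ds)"
    by (simp add: triple_def orderings_def)
  then have "rotates (triple (\<kappa> \<circ> \<pi>))"
    using assms(3) by (simp add: list_all_iff)
  then have "triple (foldr flip_colouring (w2_word Orange Blue Green) (\<kappa> \<circ> \<pi>)) = triple (rotate_chord \<circ> \<kappa> \<circ> \<pi>)"
    unfolding rotates_def foldr_flip_chord by (simp add: triple_def)
  then have "foldr flip_colouring (w2_word Orange Blue Green) (\<kappa> \<circ> \<pi>) = rotate_chord \<circ> \<kappa> \<circ> \<pi>"
    by (rule triple_inject)
  moreover have "w2_word \<alpha> \<beta> \<gamma> = map \<pi> (w2_word Orange Blue Green)"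
    by (simp add: w2_word_def \<pi>_def)
  ultimately have "foldr flip_colouring (w2_word \<alpha> \<beta> \<gamma>) \<kappa> \<circ> \<pi> = (rotate_chord \<circ> \<kappa>) \<circ> \<pi>"
    using foldr_flip_colouring_comp[OF \<open>bij \<pi>\<close>] by simp
  with \<open>range \<pi> = UNIV\<close> show ?thesis
    by (metis surj_fun_eq)
qed

lemma ends_chord_of: "ends (chord_of u v) = {u, v}"
  by (auto simp: ends_def chord_of_def min_def max_def)

lemma ends_rotate_chord: "ends \<circ> (rotate_chord \<circ> \<kappa>) = rotate_pi (ends \<circ> \<kappa>)"
proof
  show "(ends \<circ> (rotate_chord \<circ> \<kappa>)) c = rotate_pi (ends \<circ> \<kappa>) c" for c
    by (simp add: rotate_pi_def rotate_chord_def ends_chord_of) (simp add: ends_def)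
qed

section \<open>The reference triangulation and its star-shaped spine\<close>

definition side_or_equilateral :: "nat \<times> nat \<times> nat \<Rightarrow> bool" where
  "side_or_equilateral = (\<lambda>(u, v, w). list_ex (\<lambda>d. d \<in> set sides \<or> prod.swap d \<in> set sides) [(u, v), (v, w), (w, u)]
     \<or> (u, v, w) \<in> set (rotations (2, 4, 6) @ rotations (1, 3, 5)))"

text \<open>Locates the reference triangulation: its chords are diagonals, which excludes the first
  alternative and leaves the two inscribed equilateral triangles.\<close>

lemma chord_triangles: "list_all side_or_equilateral (concat (map rotations increasing_triples))"
  by code_simp

text \<open>\<open>case_colour\<close> takes Orange, Blue, Green, while the counterclockwise order
  is Orange, Green, Blue; so the last edge {w, u} comes second.\<close>

definition reference_colouring :: "nat \<times> nat \<times> nat \<Rightarrow> colour \<Rightarrow> chord" where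
  "reference_colouring = (\<lambda>(u, v, w). case_colour (chord_of u v) (chord_of w u) (chord_of v w))"

definition reference_quiver :: "nat \<times> nat \<times> nat \<Rightarrow> bool" where
  "reference_quiver t \<longleftrightarrow> list_all (\<lambda>(i, j).
     arrow_number (triangles_of (reference_colouring t)) (reference_colouring t i) (reference_colouring t j) = initial_quiver i j)
     (List.product [Orange, Blue, Green] [Orange, Blue, Green])"

lemma reference_quivers: "list_all reference_quiver (rotations (2, 4, 6) @ rotations (1, 3, 5))"
  by code_simp

lemma reference_ranges:
  "list_all (\<lambda>t. set (map (reference_colouring t) [Orange, Blue, Green]) = set [(2, 4), (4, 6), (2, 6)]) (rotations (2, 4, 6))"
  "list_all (\<lambda>t. set (map (reference_colouring t) [Orange, Blue, Green]) = set [(1, 3), (3, 5), (1, 5)]) (rotations (1, 3, 5))"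
  by code_simp+

lemma range_colour: "range f = set (map f [Orange, Blue, Green])"
  by (simp add: UNIV_colour)

lemma reference_triangulationE:
  assumes "reference_triangulation T"
  obtains \<kappa> where "T = ends \<circ> \<kappa>" "chord_colouring \<kappa>"
    "range \<kappa> = set [(2, 4), (4, 6), (2, 6)] \<or> range \<kappa> = set [(1, 3), (3, 5), (1, 5)]"
    "triangulation_quiver T = initial_quiver"
proof -
  obtain u v w where uvw: "ccw u v w" "T Orange = {u, v}" "T Green = {v, w}" "T Blue = {w, u}"
    and T: "coloured_triangulation T"
    using assms by (auto simp: reference_triangulation_def equilateral_def)
  define \<kappa> where "\<kappa> = reference_colouring (u, v, w)"
  have T_eq: "T = ends \<circ> \<kappa>"
  proof
    show "T c = (ends \<circ> \<kappa>) c" for c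
      using uvw(2-4) by (cases c) (simp_all add: \<kappa>_def reference_colouring_def ends_chord_of)
  qed
  have "{T Orange, T Green, T Blue} \<inter> hexsides = {}"
    using T unfolding coloured_triangulation_def diagonals_def by blast
  then have "\<not> list_ex (\<lambda>d. d \<in> set sides \<or> prod.swap d \<in> set sides) [(u, v), (v, w), (w, u)]"
    unfolding uvw(2-4) by (auto simp: in_hexsides)
  moreover have "side_or_equilateral (u, v, w)"
    using chord_triangles uvw(1) unfolding ccw_increasing list_all_iff set_concat set_map by blast
  ultimately have t: "(u, v, w) \<in> set (rotations (2, 4, 6) @ rotations (1, 3, 5))"
    unfolding side_or_equilateral_def prod.case by blast
  then have cases: "range \<kappa> = set [(2, 4), (4, 6), (2, 6)] \<or> range \<kappa> = set [(1, 3), (3, 5), (1, 5)]"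
    using reference_ranges unfolding \<kappa>_def range_colour list_all_iff set_append Un_iff by blast
  have "inj (ends \<circ> \<kappa>)" using T unfolding T_eq coloured_triangulation_def by blast
  then have "inj \<kappa>" by (rule inj_on_imageI2)
  moreover have "[(2, 4), (4, 6), (2, 6)] \<in> set shapes" "[(1, 3), (3, 5), (1, 5)] \<in> set shapes"
    unfolding shapes_def list.set by blast+
  then have "range \<kappa> \<in> set ` set shapes" using cases by (metis imageI)
  ultimately have \<kappa>: "chord_colouring \<kappa>" by (simp add: chord_colouring_def)
  have "triangulation_quiver T i j = initial_quiver i j" for i j
  proof -
    have "reference_quiver (u, v, w)"
      using reference_quivers t unfolding list_all_iff by blast
    then have "arrow_number (triangles_of \<kappa>) (\<kappa> i) (\<kappa> j) = initial_quiver i j"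
      unfolding reference_quiver_def \<kappa>_def[symmetric] by (cases i; cases j) simp_all
    then show ?thesis unfolding T_eq triangulation_quiver_eq[OF \<kappa>] .
  qed
  then have "triangulation_quiver T = initial_quiver" by blast
  with that[OF T_eq \<kappa> cases] show thesis .
qed

text \<open>Across each chord of the central triangle lies a corner triangle with odd tip. Its other
  two sides are glued together, and this is the loop at the end of an arm of the star.\<close>

lemma star_halves:
  "\<forall>h\<in>set [(2, 4), (4, 6), (6, 2)]. opp_half (nxt_half (triangles [(2, 4), (4, 6), (2, 6)]) (opp_half h))
     = nxt_half (triangles [(2, 4), (4, 6), (2, 6)]) (nxt_half (triangles [(2, 4), (4, 6), (2, 6)]) (opp_half h))"
  "(2, 4, 6) \<in> set (triangles [(2, 4), (4, 6), (2, 6)])"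
  by code_simp+

lemma star_shaped_dual_spine:
  assumes "chord_colouring \<kappa>" "range \<kappa> = set [(2, 4), (4, 6), (2, 6)]"
  shows "star_shaped (dual_spine (ends \<circ> \<kappa>))"
proof -
  let ?D = "dual_spine (ends \<circ> \<kappa>)" and ?ts = "triangles_of \<kappa>"
  have ts: "?ts = triangles [(2, 4), (4, 6), (2, 6)]"
    by (rule triangles_of_eq[OF assms(2)])
  have T: "(2, 4, 6) \<in> set ?ts" using star_halves(2) unfolding ts .
  note rot = T triangles_of_rotate[OF T] triangles_of_rotate[OF triangles_of_rotate[OF T]]
  note nx = nxt_dual_spine[OF assms(1)]
  have H: "(2, 4) \<in> set (halves_of ?ts)" "(4, 6) \<in> set (halves_of ?ts)" "(6, 2) \<in> set (halves_of ?ts)"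
    using rot by (auto simp: in_halves_of)
  have ends: "range (ends \<circ> \<kappa>) = {{2, 4}, {4, 6}, {2, 6}}"
    unfolding image_comp[symmetric] assms(2) by (simp add: ends_def)
  have star: "opp ?D (nxt ?D (opp ?D h)) = nxt ?D (nxt ?D (opp ?D h))" if "h \<in> {(2, 4), (4, 6), (6, 2)}" for h
  proof -
    have h: "h \<in> set (halves_of ?ts)" using that H by blast
    have "opp_half (nxt_half ?ts (opp_half h)) = nxt_half ?ts (nxt_half ?ts (opp_half h))"
      unfolding ts using star_halves(1) that by (metis list.set(1,2))
    with opp_half_closed(1)[OF assms(1) h] show ?thesis
      by (simp add: opp_dual_spine nxt_dual_spine_half[OF assms(1)] nxt_half_closed(1)[OF assms(1)])
  qed
  have "label ?D ` {(2, 4), (4, 6), (6, 2)} = range Chord"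
  proof (intro equalityI subsetI)
    fix l assume "l \<in> label ?D ` {(2, 4), (4, 6), (6, 2)}"
    then obtain u v where uv: "l = label ?D (u, v)" "(u, v) \<in> {(2, 4), (4, 6), (6, 2)}" by blast
    then have "{u, v} \<in> range (ends \<circ> \<kappa>)" unfolding ends by auto
    then obtain c where "{u, v} = ends (\<kappa> c)" by auto
    then show "l \<in> range Chord" using label_chord[OF assms(1)] uv(1) by auto
  next
    fix l assume "l \<in> range Chord"
    then obtain c where c: "l = Chord c" by blast
    have "ends (\<kappa> c) \<in> {{2, 4}, {4, 6}, {6, 2}}" using ends by (auto simp: insert_commute)
    then obtain u v where "(u, v) \<in> {(2, 4), (4, 6), (6, 2)}" "{u, v} = ends (\<kappa> c)" by blast
    then show "l \<in> label ?D ` {(2, 4), (4, 6), (6, 2)}"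
      using label_chord[OF assms(1)] c by (metis image_eqI)
  qed
  with star H(1) show ?thesis
    unfolding star_shaped_def halves_dual_spine
    by (intro bexI[of _ "(2, 4)"]) (simp_all add: nx[OF rot(1)] nx[OF rot(2)])
qed

text \<open>The gluing singles out the even vertices, so the spine is a star only for the central
  triangle v_2 v_4 v_6; this discards the other equilateral shape.\<close>

lemma range_reference_246:
  assumes "\<Union> (range (ends \<circ> \<kappa>)) = {2, 4, 6}"
  shows "range \<kappa> \<noteq> set [(1, 3), (3, 5), (1, 5)]"
proof
  assume "range \<kappa> = set [(1, 3), (3, 5), (1, 5)]"
  then have "(1, 3) \<in> range \<kappa>" by simp
  then obtain c where "\<kappa> c = (1, 3)" by (metis imageE)
  then have "1 \<in> (ends \<circ> \<kappa>) c" by (simp add: ends_def)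
  with assms have "(1 :: nat) \<in> {2, 4, 6}" by blast
  then show False by simp
qed

lemma w2_word_rotates:
  assumes "chord_colouring \<kappa>" "{\<alpha>, \<beta>, \<gamma>} = (UNIV :: colour set)"
    "range \<kappa> = set [(2, 4), (4, 6), (2, 6)] \<or> range \<kappa> = set [(1, 3), (3, 5), (1, 5)]"
  shows "ends \<circ> foldr flip_colouring (w2_word \<alpha> \<beta> \<gamma>) \<kappa> = rotate_pi (ends \<circ> \<kappa>)"
proof -
  have "inj \<kappa>" using assms(1) by (simp add: chord_colouring_def)
  then have "foldr flip_colouring (w2_word \<alpha> \<beta> \<gamma>) \<kappa> = rotate_chord \<circ> \<kappa>"
    using assms(2,3) rotates_colouring equilateral_rotates by metis
  then show ?thesis by (simp only: ends_rotate_chord)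
qed

lemma w2_word_triangulations:
  assumes "{\<alpha>, \<beta>, \<gamma>} = (UNIV :: colour set)" "reference_triangulation T0"
  shows "foldr flip (w2_word \<alpha> \<beta> \<gamma>) T0 = rotate_pi T0"
    and "coloured_triangulation (foldr flip w T0)"
    and "triangulation_quiver (foldr flip w T0) = fst (foldr mutate w (initial_quiver, X))"
proof -
  obtain \<kappa> where \<kappa>: "T0 = ends \<circ> \<kappa>" "chord_colouring \<kappa>"
    and range: "range \<kappa> = set [(2, 4), (4, 6), (2, 6)] \<or> range \<kappa> = set [(1, 3), (3, 5), (1, 5)]"
    and quiver: "triangulation_quiver T0 = initial_quiver"
    using reference_triangulationE[OF assms(2)] by metis
  show "foldr flip (w2_word \<alpha> \<beta> \<gamma>) T0 = rotate_pi T0"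
    unfolding \<kappa>(1) foldr_flip(1)[OF \<kappa>(2)] using w2_word_rotates[OF \<kappa>(2) assms(1)] range by blast
  show "coloured_triangulation (foldr flip w T0)"
    unfolding \<kappa>(1) foldr_flip(1)[OF \<kappa>(2)] by (rule coloured_triangulation[OF foldr_flip(2)[OF \<kappa>(2)]])
  show "triangulation_quiver (foldr flip w T0) = fst (foldr mutate w (initial_quiver, X))"
    unfolding fst_foldr_mutate quiver[symmetric] unfolding \<kappa>(1) foldr_flip(1)[OF \<kappa>(2)]
    by (rule foldr_flip(3)[OF \<kappa>(2)])
qed

lemma w2_word_spines:
  assumes "{\<alpha>, \<beta>, \<gamma>} = (UNIV :: colour set)" "reference_triangulation T0" "\<Union> (range T0) = {2, 4, 6}"
  shows "star_shaped (dual_spine T0)"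
    and "same_spine (foldr flip_fg (w2_word \<alpha> \<beta> \<gamma>) (dual_spine T0)) (dual_spine (rotate_pi T0))"
    and "spine_of_sphere (foldr flip_fg w (dual_spine T0))"
    and "same_spine (foldr flip_fg w (dual_spine T0)) (dual_spine (foldr flip w T0))"
    and "fg_quiver (foldr flip_fg w (dual_spine T0)) = fst (foldr mutate w (initial_quiver, X))"
proof -
  obtain \<kappa> where \<kappa>: "T0 = ends \<circ> \<kappa>" "chord_colouring \<kappa>"
    and "range \<kappa> = set [(2, 4), (4, 6), (2, 6)] \<or> range \<kappa> = set [(1, 3), (3, 5), (1, 5)]"
    and quiver: "triangulation_quiver T0 = initial_quiver"
    using reference_triangulationE[OF assms(2)] by metis
  with range_reference_246[of \<kappa>] assms(3) have range: "range \<kappa> = set [(2, 4), (4, 6), (2, 6)]"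
    by blast
  show "star_shaped (dual_spine T0)"
    unfolding \<kappa>(1) by (rule star_shaped_dual_spine[OF \<kappa>(2) range])
  show same: "same_spine (foldr flip_fg w (dual_spine T0)) (dual_spine (foldr flip w T0))" for w
    unfolding \<kappa>(1) foldr_flip(1)[OF \<kappa>(2)] by (rule foldr_flip_fg(2)[OF \<kappa>(2)])
  from same[of "w2_word \<alpha> \<beta> \<gamma>"]
  show "same_spine (foldr flip_fg (w2_word \<alpha> \<beta> \<gamma>) (dual_spine T0)) (dual_spine (rotate_pi T0))"
    unfolding w2_word_triangulations(1)[OF assms(1,2)] .
  show "spine_of_sphere (foldr flip_fg w (dual_spine T0))"
    unfolding \<kappa>(1) by (rule foldr_flip_fg_spine(1)[OF \<kappa>(2)])
  show "fg_quiver (foldr flip_fg w (dual_spine T0)) = fst (foldr mutate w (initial_quiver, X))"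
    unfolding fst_foldr_mutate quiver[symmetric] unfolding \<kappa>(1) by (rule foldr_flip_fg_spine(2)[OF \<kappa>(2)])
qed

section \<open>The lift of Okamoto's transformation\<close>

lemma same_monodromy_data_Ztilde:
  assumes Z: "Z \<in> coord_torus (iota \<theta>)" "Z \<in> Ztilde_domain"
  shows "same_monodromy_data (chart (iota \<theta>) Z) (chart (iota (w2 \<theta>)) (Ztilde Z))"
proof -
  let ?M = "chart (iota \<theta>) Z" and ?N = "chart (iota (w2 \<theta>)) (Ztilde Z)"
  have "trace (?N j ** ?N k) = trace (?M j ** ?M k)"
    if "j \<in> {P1, P2, P3}" "k \<in> {P1, P2, P3}" "j \<noteq> k" for j k
    using that traces_preserved[OF Z] trace_mul_sym[of "?N P2" "?N P1"] trace_mul_sym[of "?N P3" "?N P2"]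
      trace_mul_sym[of "?N P3" "?N P1"] trace_mul_sym[of "?M P2" "?M P1"] trace_mul_sym[of "?M P3" "?M P2"]
      trace_mul_sym[of "?M P3" "?M P1"]
    by (elim insertE emptyE) (simp_all del: chart.simps)
  moreover have "omega ?N l = omega ?M l" for l
    by (rule omega_w2; rule chart_in_rep_space(2)) (simp_all add: iota_nz Z(1) Ztilde_in_coord_torus[OF Z])
  ultimately show ?thesis by (simp add: same_monodromy_data_def del: chart.simps)
qed

lemma entrywise_action_chart:
  assumes "Z \<in> coord_torus (iota \<theta>)"
  shows "entrywise_action \<theta> s (chart (iota \<theta>) Z) = chart (iota (w2 \<theta>)) (s Z)"
  using inv_into_f_f[OF inj_on_chart[OF iota_nz] assms] by (simp add: entrywise_action_def)

lemma lifts_w2_Ztilde: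
  "lifts_w2 \<theta> (chart (iota \<theta>) ` (coord_torus (iota \<theta>) \<inter> Ztilde_domain)) (entrywise_action \<theta> Ztilde)"
  unfolding lifts_w2_def
proof (intro conjI subsetI ballI)
  fix M assume "M \<in> chart (iota \<theta>) ` (coord_torus (iota \<theta>) \<inter> Ztilde_domain)"
  then obtain Z where Z: "M = chart (iota \<theta>) Z" "Z \<in> coord_torus (iota \<theta>)" "Z \<in> Ztilde_domain" by blast
  show "M \<in> rep_space (iota \<theta>)"
    unfolding Z(1) by (rule chart_in_rep_space(1)[OF iota_nz Z(2)])
  show "same_monodromy_data M (entrywise_action \<theta> Ztilde M)"
    unfolding Z(1) entrywise_action_chart[OF Z(2)] by (rule same_monodromy_data_Ztilde[OF Z(2,3)])
next
  fix N assume "N \<in> entrywise_action \<theta> Ztilde ` chart (iota \<theta>) ` (coord_torus (iota \<theta>) \<inter> Ztilde_domain)"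
  then obtain Z where Z: "N = entrywise_action \<theta> Ztilde (chart (iota \<theta>) Z)"
    "Z \<in> coord_torus (iota \<theta>)" "Z \<in> Ztilde_domain" by blast
  show "N \<in> rep_space (iota (w2 \<theta>))"
    unfolding Z(1) entrywise_action_chart[OF Z(2)]
    by (rule chart_in_rep_space(1)[OF iota_nz Ztilde_in_coord_torus[OF Z(2,3)]])
qed

theorem theorem1p4:
  fixes \<theta> :: "puncture \<Rightarrow> complex" and \<alpha> \<beta> \<gamma> :: colour
  assumes labelling: "{\<alpha>, \<beta>, \<gamma>} = (UNIV :: colour set)"
  shows
    \<comment> \<open>the mutation sequence is the stated substitution, as rational functions and pointwise\<close>
    "(mutations_defined (w2_word \<alpha> \<beta> \<gamma>) (initial_quiver, indet)
        \<and> snd (foldr mutate (w2_word \<alpha> \<beta> \<gamma>) (initial_quiver, indet)) = Ztilde indet)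
     \<and> (\<forall>Z\<in>Ztilde_domain. mutations_defined (w2_word \<alpha> \<beta> \<gamma>) (initial_quiver, Z) \<longrightarrow>
          snd (foldr mutate (w2_word \<alpha> \<beta> \<gamma>) (initial_quiver, Z)) = Ztilde Z)
     \<comment> \<open>its entry-wise action is a rational map lifting Okamoto's transformation\<close>
     \<and> (inj_on (chart (iota \<theta>)) (coord_torus (iota \<theta>))
        \<and> coord_torus (iota \<theta>) \<subseteq> closure (coord_torus (iota \<theta>) \<inter> Ztilde_domain)
        \<and> lifts_w2 \<theta> (chart (iota \<theta>) ` (coord_torus (iota \<theta>) \<inter> Ztilde_domain))
            (entrywise_action \<theta> Ztilde))
     \<and> (\<forall>Z \<in> coord_torus (iota \<theta>) \<inter> Ztilde_domain.
          chart (iota \<theta>) Z \<in> rep_space (iota \<theta>)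
          \<and> entrywise_action \<theta> Ztilde (chart (iota \<theta>) Z) = chart (iota (w2 \<theta>)) (Ztilde Z)
          \<and> Ztilde Z \<in> coord_torus (iota (w2 \<theta>))
          \<and> chart (iota (w2 \<theta>)) (Ztilde Z) \<in> rep_space (iota (w2 \<theta>))
          \<and> (\<forall>j\<in>{P1, P2, P3}. \<forall>k\<in>{P1, P2, P3}. j \<noteq> k \<longrightarrow>
               trace (chart (iota (w2 \<theta>)) (Ztilde Z) j ** chart (iota (w2 \<theta>)) (Ztilde Z) k)
               = trace (chart (iota \<theta>) Z j ** chart (iota \<theta>) Z k))
          \<and> (\<forall>l. omega (chart (iota (w2 \<theta>)) (Ztilde Z)) l = omega (chart (iota \<theta>) Z) l))
     \<comment> \<open>(a): rotation by pi of coloured triangulations; at every stage the flipped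
        triangulation carries the mutated quiver\<close>
     \<and> (\<forall>T0. reference_triangulation T0 \<longrightarrow>
          foldr flip (w2_word \<alpha> \<beta> \<gamma>) T0 = rotate_pi T0
          \<and> (\<forall>n \<le> length (w2_word \<alpha> \<beta> \<gamma>).
               coloured_triangulation (foldr flip (drop n (w2_word \<alpha> \<beta> \<gamma>)) T0)
               \<and> triangulation_quiver (foldr flip (drop n (w2_word \<alpha> \<beta> \<gamma>)) T0)
                 = fst (foldr mutate (drop n (w2_word \<alpha> \<beta> \<gamma>)) (initial_quiver, indet))))
     \<comment> \<open>(b): inside-out of star-shaped fat graphs; at every stage the flipped spine is
        dual to the flipped triangulation and carries the mutated quiver\<close>
     \<and> (\<forall>T0. reference_triangulation T0 \<and> \<Union> (range T0) = {2, 4, 6} \<longrightarrow>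
          star_shaped (dual_spine T0)
          \<and> same_spine (foldr flip_fg (w2_word \<alpha> \<beta> \<gamma>) (dual_spine T0)) (dual_spine (rotate_pi T0))
          \<and> (\<forall>n \<le> length (w2_word \<alpha> \<beta> \<gamma>).
               spine_of_sphere (foldr flip_fg (drop n (w2_word \<alpha> \<beta> \<gamma>)) (dual_spine T0))
               \<and> same_spine (foldr flip_fg (drop n (w2_word \<alpha> \<beta> \<gamma>)) (dual_spine T0))
                    (dual_spine (foldr flip (drop n (w2_word \<alpha> \<beta> \<gamma>)) T0))
               \<and> fg_quiver (foldr flip_fg (drop n (w2_word \<alpha> \<beta> \<gamma>)) (dual_spine T0))
                 = fst (foldr mutate (drop n (w2_word \<alpha> \<beta> \<gamma>)) (initial_quiver, indet))))"
proof (intro conjI)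
  note word = w2_mutations[OF labelling]
  show defined: "mutations_defined (w2_word \<alpha> \<beta> \<gamma>) (initial_quiver, indet)"
    using word(1)[OF indet_generic(1)] indet_generic(2) by blast
  show "snd (foldr mutate (w2_word \<alpha> \<beta> \<gamma>) (initial_quiver, indet)) = Ztilde indet"
    by (rule word(2)[OF indet_generic(1) defined])
  show "\<forall>Z\<in>Ztilde_domain. mutations_defined (w2_word \<alpha> \<beta> \<gamma>) (initial_quiver, Z) \<longrightarrow>
      snd (foldr mutate (w2_word \<alpha> \<beta> \<gamma>) (initial_quiver, Z)) = Ztilde Z"
    by (intro ballI impI word(2)) (simp_all add: Ztilde_domain_def generic_point_def)
  show "inj_on (chart (iota \<theta>)) (coord_torus (iota \<theta>))"
    by (rule inj_on_chart[OF iota_nz])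
  show "coord_torus (iota \<theta>) \<subseteq> closure (coord_torus (iota \<theta>) \<inter> Ztilde_domain)"
    by (rule coord_torus_dense)
  show "lifts_w2 \<theta> (chart (iota \<theta>) ` (coord_torus (iota \<theta>) \<inter> Ztilde_domain)) (entrywise_action \<theta> Ztilde)"
    by (rule lifts_w2_Ztilde)
next
  show "\<forall>Z \<in> coord_torus (iota \<theta>) \<inter> Ztilde_domain.
          chart (iota \<theta>) Z \<in> rep_space (iota \<theta>)
          \<and> entrywise_action \<theta> Ztilde (chart (iota \<theta>) Z) = chart (iota (w2 \<theta>)) (Ztilde Z)
          \<and> Ztilde Z \<in> coord_torus (iota (w2 \<theta>))
          \<and> chart (iota (w2 \<theta>)) (Ztilde Z) \<in> rep_space (iota (w2 \<theta>))
          \<and> (\<forall>j\<in>{P1, P2, P3}. \<forall>k\<in>{P1, P2, P3}. j \<noteq> k \<longrightarrow>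
               trace (chart (iota (w2 \<theta>)) (Ztilde Z) j ** chart (iota (w2 \<theta>)) (Ztilde Z) k)
               = trace (chart (iota \<theta>) Z j ** chart (iota \<theta>) Z k))
          \<and> (\<forall>l. omega (chart (iota (w2 \<theta>)) (Ztilde Z)) l = omega (chart (iota \<theta>) Z) l)"
  proof
    fix Z assume "Z \<in> coord_torus (iota \<theta>) \<inter> Ztilde_domain"
    then have Z: "Z \<in> coord_torus (iota \<theta>)" "Z \<in> Ztilde_domain" by simp_all
    note tilde = Ztilde_in_coord_torus[OF Z]
    show "chart (iota \<theta>) Z \<in> rep_space (iota \<theta>)
          \<and> entrywise_action \<theta> Ztilde (chart (iota \<theta>) Z) = chart (iota (w2 \<theta>)) (Ztilde Z)
          \<and> Ztilde Z \<in> coord_torus (iota (w2 \<theta>))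
          \<and> chart (iota (w2 \<theta>)) (Ztilde Z) \<in> rep_space (iota (w2 \<theta>))
          \<and> (\<forall>j\<in>{P1, P2, P3}. \<forall>k\<in>{P1, P2, P3}. j \<noteq> k \<longrightarrow>
               trace (chart (iota (w2 \<theta>)) (Ztilde Z) j ** chart (iota (w2 \<theta>)) (Ztilde Z) k)
               = trace (chart (iota \<theta>) Z j ** chart (iota \<theta>) Z k))
          \<and> (\<forall>l. omega (chart (iota (w2 \<theta>)) (Ztilde Z)) l = omega (chart (iota \<theta>) Z) l)"
      using same_monodromy_data_Ztilde[OF Z] unfolding same_monodromy_data_def
      by (intro conjI chart_in_rep_space(1)[OF iota_nz Z(1)] chart_in_rep_space(1)[OF iota_nz tilde]
          tilde entrywise_action_chart[OF Z(1)]) (elim conjE, assumption)+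
  qed
next
  show "\<forall>T0. reference_triangulation T0 \<longrightarrow>
          foldr flip (w2_word \<alpha> \<beta> \<gamma>) T0 = rotate_pi T0
          \<and> (\<forall>n \<le> length (w2_word \<alpha> \<beta> \<gamma>).
               coloured_triangulation (foldr flip (drop n (w2_word \<alpha> \<beta> \<gamma>)) T0)
               \<and> triangulation_quiver (foldr flip (drop n (w2_word \<alpha> \<beta> \<gamma>)) T0)
                 = fst (foldr mutate (drop n (w2_word \<alpha> \<beta> \<gamma>)) (initial_quiver, indet)))"
    using w2_word_triangulations[OF labelling] by blast
next
  show "\<forall>T0. reference_triangulation T0 \<and> \<Union> (range T0) = {2, 4, 6} \<longrightarrow>
          star_shaped (dual_spine T0)
          \<and> same_spine (foldr flip_fg (w2_word \<alpha> \<beta> \<gamma>) (dual_spine T0)) (dual_spine (rotate_pi T0))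
          \<and> (\<forall>n \<le> length (w2_word \<alpha> \<beta> \<gamma>).
               spine_of_sphere (foldr flip_fg (drop n (w2_word \<alpha> \<beta> \<gamma>)) (dual_spine T0))
               \<and> same_spine (foldr flip_fg (drop n (w2_word \<alpha> \<beta> \<gamma>)) (dual_spine T0))
                    (dual_spine (foldr flip (drop n (w2_word \<alpha> \<beta> \<gamma>)) T0))
               \<and> fg_quiver (foldr flip_fg (drop n (w2_word \<alpha> \<beta> \<gamma>)) (dual_spine T0))
                 = fst (foldr mutate (drop n (w2_word \<alpha> \<beta> \<gamma>)) (initial_quiver, indet)))"
    by (intro allI impI conjI; elim conjE; rule w2_word_spines[OF labelling]; assumption)
qed

end
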